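(* For every $n$-dimensional locally finite simplicial complex $K$ and every $0\leq p<n$, the measure $q_{\mathrm{Lk}(\sigma,\mathrm{Sd}^d(K))}(T)\,d\gamma^d_{p,K}(\sigma)$ (with values in the space $\mathbb{R}_{n-p-1}[T]$ of polynomials of degree at most $n-p-1$) weakly converges to $$\left(\sum_{l=0}^{n-p-1}q_{p+l+1,n}\,f_p(\Delta_{p+l+1})\,T^l\right)d\mathrm{vol}_K$$ as $d$ grows to $+\infty$.
   Context: $\mathrm{Sd}^d(K)$ is the $d$-th iterated barycentric subdivision of $K$, $K^{[p]}$ is the set of $p$-dimensional simplices of a complex $K$, $f_p(K)=\#K^{[p]}$ for a finite complex, and $q_K(T)=\sum_{p\ge0}f_p(K)T^p$ is its face polynomial. $\Delta_m$ is the standard $m$-simplex, so $f_p(\Delta_m)=\binom{m+1}{p+1}$. The link of a simplex $\sigma$ in a complex $K$ is $\mathrm{Lk}(\sigma,K)=\{\tau\in K\mid \sigma \text{ and }\tau\text{ are disjoint and both are faces of a simplex in }K\}$. For $d\geq0$, $\gamma^d_{p,K}=\frac{1}{(n+1)!^d}\sum_{\sigma\in \mathrm{Sd}^d(K)^{[p]}}\delta_{\hat\sigma}$, where $\delta_{\hat\sigma}$ is the Dirac measure at the barycenter $\hat\sigma$ of $\sigma$. Thus the measure $q_{\mathrm{Lk}(\sigma,\mathrm{Sd}^d(K))}(T)\,d\gamma^d_{p,K}(\sigma)$ is $\frac{1}{(n+1)!^d}\sum_{\sigma\in \mathrm{Sd}^d(K)^{[p]}}q_{\mathrm{Lk}(\sigma,\mathrm{Sd}^d(K))}(T)\,\delta_{\hat\sigma}$.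 Let $d\mathrm{vol}_{\Delta_n}$ be Lebesgue measure on $\Delta_n$ normalized to total mass $1$; then $d\mathrm{vol}_K=\sum_{\sigma\in K^{[n]}}(f_\sigma)_*(d\mathrm{vol}_{\Delta_n})$, where $f_\sigma:\Delta_n\to\sigma$ is a simplicial isomorphism. For $0\le p\le n$, $q_{p,n}>0$ is defined by $q_{p,n}=\lim_{d\to+\infty}\frac{f_p(\mathrm{Sd}^d(L))}{(n+1)!^d f_n(L)}$, where $L$ is any $n$-dimensional finite simplicial complex; it is a known theorem (Brenti–Welker, Delucchi–Pixton–Sabalka) that this limit exists, is positive and does not depend on $L$. Weak convergence of measures on $|K|$ means convergence of the integrals of every continuous function with compact support in $|K|$. *)

theory Defs
  imports "HOL-Probability.Probability" "HOL-Computational_Algebra.Polynomial"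
begin

section \<open>Simplicial complexes\<close>

text \<open>Simplices are nonempty finite vertex sets; the empty simplex is not a member of a complex, so
  face polynomials start with the number of vertices.\<close>

definition abstract_complex :: "'v set set \<Rightarrow> bool" where
  "abstract_complex K \<longleftrightarrow>
     (\<forall>s\<in>K. finite s \<and> s \<noteq> {} \<and> (\<forall>t. t \<subseteq> s \<and> t \<noteq> {} \<longrightarrow> t \<in> K))"

definition locally_finite_complex :: "'v set set \<Rightarrow> bool" where
  "locally_finite_complex K \<longleftrightarrow> (\<forall>v. finite {s \<in> K. v \<in> s})"

definition simplices :: "'v set set \<Rightarrow> nat \<Rightarrow> 'v set set" where
  "simplices K p = {s \<in> K. card s = p + 1}"

definition complex_of_dim :: "nat \<Rightarrow> 'v set set \<Rightarrow> bool" where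
  "complex_of_dim n K \<longleftrightarrow> (\<forall>s\<in>K. card s \<le> n + 1) \<and> simplices K n \<noteq> {}"

definition face_number :: "'v set set \<Rightarrow> nat \<Rightarrow> nat" where
  "face_number K p = card (simplices K p)"

definition face_poly :: "'v set set \<Rightarrow> real poly" where
  "face_poly K = (\<Sum>p | simplices K p \<noteq> {}. monom (real (face_number K p)) p)"

definition link :: "'v set \<Rightarrow> 'v set set \<Rightarrow> 'v set set" where
  "link s K = {t \<in> K. s \<inter> t = {} \<and> (\<exists>u\<in>K. s \<subseteq> u \<and> t \<subseteq> u)}"

definition std_complex :: "nat \<Rightarrow> nat set set" where
  "std_complex m = {s. s \<subseteq> {..m} \<and> s \<noteq> {}}"


section \<open>Geometric realization\<close>

text \<open>Points of the realization are given by their barycentric coordinates. On a closed simplex (whose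
  vertex set is finite) the product topology of \<^typ>\<open>'a \<Rightarrow> real\<close> is the Euclidean one. The realization
  carries the weak topology determined by its closed simplices.\<close>

definition geom_simplex :: "'a set \<Rightarrow> ('a \<Rightarrow> real) set" where
  "geom_simplex s = {x. (\<forall>v. 0 \<le> x v) \<and> (\<forall>v. v \<notin> s \<longrightarrow> x v = 0) \<and> (\<Sum>v\<in>s. x v) = 1}"

definition realization :: "'a set set \<Rightarrow> ('a \<Rightarrow> real) set" where
  "realization K = (\<Union>s\<in>K. geom_simplex s)"

definition complex_topology :: "'a set set \<Rightarrow> ('a \<Rightarrow> real) topology" where
  "complex_topology K = topology (\<lambda>U. U \<subseteq> realization K \<and>
     (\<forall>s\<in>K. openin (top_of_set (geom_simplex s)) (U \<inter> geom_simplex s)))"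

lemma openin_complex_topology:
  "openin (complex_topology K) U \<longleftrightarrow> U \<subseteq> realization K \<and>
     (\<forall>s\<in>K. openin (top_of_set (geom_simplex s)) (U \<inter> geom_simplex s))"
proof -
  define P where "P U s \<longleftrightarrow> openin (top_of_set (geom_simplex s)) (U \<inter> geom_simplex s)"
    for U and s :: "'a set"
  have Int: "P (S \<inter> T) s" if "P S s" "P T s" for S T s
  proof -
    have "S \<inter> T \<inter> geom_simplex s = (S \<inter> geom_simplex s) \<inter> (T \<inter> geom_simplex s)"
      by blast
    then show ?thesis
      using that unfolding P_def by (metis openin_Int)
  qed
  have Union: "P (\<Union>F) s" if "\<forall>U\<in>F. P U s" for F s
  proof -
    have "\<Union>F \<inter> geom_simplex s = \<Union>((\<lambda>U. U \<inter> geom_simplex s) ` F)"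
      by blast
    moreover have "openin (top_of_set (geom_simplex s)) (\<Union>((\<lambda>U. U \<inter> geom_simplex s) ` F))"
      by (rule openin_Union) (use that in \<open>auto simp only: P_def\<close>)
    ultimately show ?thesis
      unfolding P_def by metis
  qed
  have "istopology (\<lambda>U. U \<subseteq> realization K \<and> (\<forall>s\<in>K. P U s))"
    unfolding istopology_def
  proof (intro conjI allI impI)
    fix S T
    assume "S \<subseteq> realization K \<and> (\<forall>s\<in>K. P S s)" "T \<subseteq> realization K \<and> (\<forall>s\<in>K. P T s)"
    then show "S \<inter> T \<subseteq> realization K" "\<forall>s\<in>K. P (S \<inter> T) s"
      using Int by blast+
  next
    fix F
    assume "\<forall>U\<in>F. U \<subseteq> realization K \<and> (\<forall>s\<in>K. P U s)"
    then show "\<Union>F \<subseteq> realization K" "\<forall>s\<in>K. P (\<Union>F) s"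
      using Union by blast+
  qed
  then show ?thesis
    unfolding complex_topology_def P_def by (simp only: topology_inverse')
qed

lemma topspace_complex_topology: "topspace (complex_topology K) = realization K"
proof -
  have "openin (top_of_set (geom_simplex s)) (realization K \<inter> geom_simplex s)" if "s \<in> K" for s
  proof -
    have "realization K \<inter> geom_simplex s = geom_simplex s"
      using that by (auto simp: realization_def)
    then show ?thesis
      by (metis openin_topspace topspace_euclidean_subtopology)
  qed
  then have "openin (complex_topology K) (realization K)"
    by (simp add: openin_complex_topology)
  then show ?thesis
    by (meson openin_complex_topology openin_subset openin_topspace subset_antisym)
qed

definition borel_complex :: "'a set set \<Rightarrow> ('a \<Rightarrow> real) measure" where
  "borel_complex K = sigma (realization K) {U. openin (complex_topology K) U}"


section \<open>Barycentric subdivision\<close>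

definition vertex_point :: "'a \<Rightarrow> 'a \<Rightarrow> real" where
  "vertex_point a = indicator {a}"

text \<open>The subdivided complexes have points of the realization as vertices; a simplex is the finite set of
  its vertices, as before.\<close>

definition barycenter :: "('a \<Rightarrow> real) set \<Rightarrow> 'a \<Rightarrow> real" where
  "barycenter s = (\<lambda>v. (\<Sum>x\<in>s. x v) / real (card s))"

definition subdivision :: "('a \<Rightarrow> real) set set \<Rightarrow> ('a \<Rightarrow> real) set set" where
  "subdivision K = {barycenter ` C | C. C \<subseteq> K \<and> finite C \<and> C \<noteq> {} \<and> (\<forall>s\<in>C. \<forall>t\<in>C. s \<subseteq> t \<or> t \<subseteq> s)}"

definition Sd :: "nat \<Rightarrow> 'a set set \<Rightarrow> ('a \<Rightarrow> real) set set" where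
  "Sd d K = (subdivision ^^ d) ((`) vertex_point ` K)"

text \<open>The existence of this number, and its independence of the complex, is a theorem of
  Brenti--Welker and Delucchi--Pixton--Sabalka. Every finite complex is isomorphic to one
  with natural numbers as vertices.\<close>

definition q_limit :: "nat \<Rightarrow> nat \<Rightarrow> real" where
  "q_limit p n = (THE q. \<forall>L :: nat set set.
     abstract_complex L \<and> finite L \<and> complex_of_dim n L \<longrightarrow>
     (\<lambda>d. real (face_number (Sd d L) p) / (fact (n + 1) ^ d * real (face_number L n))) \<longlonglongrightarrow> q)"


section \<open>Measures\<close>

definition sum_measure :: "'x measure \<Rightarrow> 'i set \<Rightarrow> ('i \<Rightarrow> 'x measure) \<Rightarrow> 'x measure" where
  "sum_measure B I \<mu> =
     measure_of (space B) (sets B) (\<lambda>A. \<integral>\<^sup>+ i. emeasure (\<mu> i) A \<partial>count_space I)"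

lemma sets_sum_measure: "sets (sum_measure B I \<mu>) = sets B"
  and space_sum_measure: "space (sum_measure B I \<mu>) = space B"
  by (simp_all add: sum_measure_def)

lemma emeasure_sum_measure:
  fixes B :: "'x measure"
  assumes "\<And>i. i \<in> I \<Longrightarrow> sets (\<mu> i) = sets B" and "A \<in> sets B"
  shows "emeasure (sum_measure B I \<mu>) A = (\<integral>\<^sup>+ i. emeasure (\<mu> i) A \<partial>count_space I)"
proof (rule emeasure_measure_of[OF sum_measure_def])
  show "sets B \<subseteq> Pow (space B)"
    by (rule sets.space_closed)
  show "positive (sets (sum_measure B I \<mu>)) (\<lambda>A. \<integral>\<^sup>+ i. emeasure (\<mu> i) A \<partial>count_space I)"
    by (simp add: positive_def)
  show "countably_additive (sets (sum_measure B I \<mu>)) (\<lambda>A. \<integral>\<^sup>+ i. emeasure (\<mu> i) A \<partial>count_space I)"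
  proof (rule countably_additiveI)
    fix F :: "nat \<Rightarrow> 'x set"
    assume F: "range F \<subseteq> sets (sum_measure B I \<mu>)" "disjoint_family F"
    have "(\<Sum>k. \<integral>\<^sup>+ i. emeasure (\<mu> i) (F k) \<partial>count_space I)
        = (\<integral>\<^sup>+ i. (\<Sum>k. emeasure (\<mu> i) (F k)) \<partial>count_space I)"
      by (rule nn_integral_suminf[symmetric]) simp
    also have "\<dots> = (\<integral>\<^sup>+ i. emeasure (\<mu> i) (\<Union>k. F k) \<partial>count_space I)"
      using F assms(1) by (intro nn_integral_cong suminf_emeasure) (auto simp: sets_sum_measure)
    finally show "(\<Sum>k. \<integral>\<^sup>+ i. emeasure (\<mu> i) (F k) \<partial>count_space I)
        = (\<integral>\<^sup>+ i. emeasure (\<mu> i) (\<Union>k. F k) \<partial>count_space I)" .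
  qed
qed (use assms in \<open>simp add: sets_sum_measure\<close>)

text \<open>Normalized Lebesgue measure on the standard simplex, computed in the affine chart that omits the
  zeroth barycentric coordinate: affine bijections rescale Lebesgue measure by a constant, which
  the normalization cancels.\<close>

definition corner_simplex :: "nat \<Rightarrow> (nat \<Rightarrow> real) set" where
  "corner_simplex n = {y \<in> {1..n} \<rightarrow>\<^sub>E UNIV. (\<forall>i\<in>{1..n}. 0 \<le> y i) \<and> (\<Sum>i=1..n. y i) \<le> 1}"

definition simplex_chart :: "nat \<Rightarrow> (nat \<Rightarrow> real) \<Rightarrow> nat \<Rightarrow> real" where
  "simplex_chart n y =
     (\<lambda>i. if i = 0 then 1 - (\<Sum>j=1..n. y j) else if i \<le> n then y i else 0)"

definition vol_std :: "nat \<Rightarrow> (nat \<Rightarrow> real) measure" where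
  "vol_std n = distr
     (restrict_space (uniform_measure (\<Pi>\<^sub>M i\<in>{1..n}. lborel) (corner_simplex n)) (corner_simplex n))
     (borel_complex (std_complex n)) (simplex_chart n)"

text \<open>The affine map sending the vertex \<open>i\<close> of the standard simplex to the vertex \<open>\<phi> i\<close>. The
  measure \<open>vol_complex\<close> does not depend on the chosen enumeration of the vertices.\<close>

definition affine_extension :: "nat \<Rightarrow> (nat \<Rightarrow> 'a) \<Rightarrow> (nat \<Rightarrow> real) \<Rightarrow> 'a \<Rightarrow> real" where
  "affine_extension n \<phi> x = (\<lambda>v. \<Sum>i\<le>n. x i * vertex_point (\<phi> i) v)"

definition simplex_iso :: "nat \<Rightarrow> 'a set \<Rightarrow> (nat \<Rightarrow> real) \<Rightarrow> 'a \<Rightarrow> real" where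
  "simplex_iso n s = affine_extension n (SOME \<phi>. bij_betw \<phi> {..n} s)"

definition vol_complex :: "nat \<Rightarrow> 'a set set \<Rightarrow> ('a \<Rightarrow> real) measure" where
  "vol_complex n K =
     sum_measure (borel_complex K) (simplices K n) (\<lambda>s. distr (vol_std n) (borel_complex K) (simplex_iso n s))"


section \<open>Polynomial-valued measures\<close>

text \<open>A measure with values in real polynomials is represented by its coefficient measures: the \<open>l\<close>-th
  component is the coefficient of \<open>T ^ l\<close>. All polynomials occurring below have nonnegative
  coefficients, so nothing is lost by using nonnegative measures and \<^const>\<open>ennreal\<close>.\<close>

type_synonym 'x poly_measure = "nat \<Rightarrow> 'x measure"

definition poly_times_measure :: "real poly \<Rightarrow> 'x measure \<Rightarrow> 'x poly_measure" where
  "poly_times_measure q \<mu> l = scale_measure (ennreal (coeff q l)) \<mu>"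

definition poly_measure_degree_le :: "nat \<Rightarrow> 'x poly_measure \<Rightarrow> bool" where
  "poly_measure_degree_le m M \<longleftrightarrow> (\<forall>l>m. emeasure (M l) (space (M l)) = 0)"

text \<open>The measure \<open>\<Sum>\<sigma>. w \<sigma> \<cdot> \<delta>\<^bsub>barycenter \<sigma>\<^esub>\<close>, divided by \<open>(n+1)!^d\<close>, where \<open>\<sigma>\<close> ranges over the
  \<open>p\<close>-simplices of the \<open>d\<close>-th subdivision. The constant weight \<open>1\<close> gives the measure \<open>\<gamma>\<close> itself,
  as the coefficient of \<open>T ^ 0\<close>.\<close>

definition weighted_gamma ::
  "nat \<Rightarrow> nat \<Rightarrow> nat \<Rightarrow> 'a set set \<Rightarrow> (('a \<Rightarrow> real) set \<Rightarrow> real poly) \<Rightarrow> ('a \<Rightarrow> real) poly_measure" where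
  "weighted_gamma n d p K w l = scale_measure (ennreal (1 / fact (n + 1) ^ d))
     (sum_measure (borel_complex K) (simplices (Sd d K) p)
        (\<lambda>\<sigma>. poly_times_measure (w \<sigma>) (return (borel_complex K) (barycenter \<sigma>)) l))"

definition link_measure ::
  "nat \<Rightarrow> nat \<Rightarrow> nat \<Rightarrow> 'a set set \<Rightarrow> ('a \<Rightarrow> real) poly_measure" where
  "link_measure n d p K = weighted_gamma n d p K (\<lambda>\<sigma>. face_poly (link \<sigma> (Sd d K)))"

definition compactly_supported :: "'x topology \<Rightarrow> ('x \<Rightarrow> real) \<Rightarrow> bool" where
  "compactly_supported X f \<longleftrightarrow> compactin X (X closure_of {x \<in> topspace X. f x \<noteq> 0})"

text \<open>Weak convergence of measures with values in the finite-dimensional space of polynomials of degree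
  at most \<open>m\<close>; convergence in that space is convergence of the coefficients.\<close>

definition poly_weakly_converges ::
  "'x topology \<Rightarrow> nat \<Rightarrow> (nat \<Rightarrow> 'x poly_measure) \<Rightarrow> 'x poly_measure \<Rightarrow> bool" where
  "poly_weakly_converges X m M N \<longleftrightarrow>
     (\<forall>d. poly_measure_degree_le m (M d)) \<and> poly_measure_degree_le m N \<and>
     (\<forall>f. continuous_map X euclideanreal f \<and> compactly_supported X f \<longrightarrow>
        (\<forall>l. integrable (N l) f \<and> (\<forall>d. integrable (M d l) f) \<and>
             (\<lambda>d. integral\<^sup>L (M d l) f) \<longlonglongrightarrow> integral\<^sup>L (N l) f))"

end

theory Submission
  imports Defs "HOL-Combinatorics.Permutations"
begin

text \<open>Exchanging the order of summation, the coefficient of \<open>T ^ l\<close> integrates \<open>f\<close> to the sum, over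
  the \<open>(p + l + 1)\<close>-simplices \<open>\<tau>\<close> of the subdivision, of the values of \<open>f\<close> at the barycenters of the
  \<open>p\<close>-faces of \<open>\<tau>\<close>. As the mesh tends to zero, these may be replaced by the value at the barycenter
  of \<open>\<tau>\<close>, and it remains to study the sums \<open>G j d\<close> of \<open>f\<close> over the barycenters of the \<open>j\<close>-simplices,
  divided by \<open>(n + 1)! ^ d\<close>.

  A \<open>j\<close>-simplex of \<open>Sd (d + 1)\<close> is a flag of length \<open>j + 1\<close> ending in a simplex of \<open>Sd d\<close>. The number of
  such flags depends on the dimension \<open>i\<close> of the last simplex only, so that up to \<open>o(1)\<close> the
  numbers \<open>G j d\<close> satisfy a triangular linear recursion whose diagonal entries \<open>(j + 1)! / (n + 1)!\<close>
  are less than \<open>1\<close> for \<open>j < n\<close>. Hence all of them converge to multiples of the limit of \<open>G n\<close>, with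
  constants independent of \<open>f\<close> and of the complex; \<open>f = 1\<close> identifies the constants with \<open>q_limit\<close>.
  Finally \<open>G n\<close> is a Riemann sum for the volume, because barycentric subdivision cuts a simplex
  into \<open>(n + 1)!\<close> pieces of equal volume.\<close>

section \<open>Lebesgue measure on the simplex\<close>

text \<open>The overview argues for a finite complex. If \<open>K\<close> is only locally finite, a
  compact support lies in finitely many open vertex stars, so the test function is nonzero on
  finitely many simplices; their faces form a finite subcomplex to which all sums are transferred. A
  simplex of an iterated subdivision is a set of points, so counting by flags requires that
  different simplices have different barycenters. \<open>geometric_complex\<close> is an invariant
  that implies this and survives subdivision: a combination with positive weights determines its
  simplex and its weights. The pieces of a subdivided simplex have equal volume because each is, up
  to a permutation of the vertices, the region where the barycentric coordinates decrease. That
  region is the image of the simplex under a triangular map with diagonal entries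
  \<open>1 / (k + 1)\<close>. The product topology on real functions of an arbitrary vertex type
  need not be metrizable. Distances are therefore estimated coordinate by coordinate, and uniform
  continuity is obtained on the standard simplex over \<open>nat\<close>.\<close>

abbreviation lebesgue_prod :: "nat set \<Rightarrow> (nat \<Rightarrow> real) measure" where
  "lebesgue_prod I \<equiv> Pi\<^sub>M I (\<lambda>_. lborel)"

lemma product_sigma_finite_lborel: "product_sigma_finite (\<lambda>_::nat. lborel :: real measure)"
  by standard

text \<open>The second condition on \<open>h\<close> says that it ignores the coordinate
  \<open>i\<close>. On each line in that direction the substitution is then a one-dimensional affine
  map, and Fubini does the rest. The factor \<open>a\<close> may be negative, as for the reflections
  that realize transpositions.\<close>

lemma nn_integral_shear:
  fixes h :: "(nat \<Rightarrow> real) \<Rightarrow> real"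
  assumes I: "finite I" "i \<in> I" and "a \<noteq> 0"
    and h: "h \<in> borel_measurable (lebesgue_prod I)" "\<And>y t. h (y(i := t)) = h y"
    and F: "F \<in> borel_measurable (lebesgue_prod I)"
  shows "(\<integral>\<^sup>+ y. F y \<partial>lebesgue_prod I) = ennreal \<bar>a\<bar> * (\<integral>\<^sup>+ y. F (y(i := h y + a * y i)) \<partial>lebesgue_prod I)"
proof -
  interpret product_sigma_finite "\<lambda>_::nat. lborel :: real measure"
    by (rule product_sigma_finite_lborel)
  define J where "J = I - {i}"
  have IJ: "I = insert i J" "finite J" "i \<notin> J"
    using I by (auto simp: J_def)
  note [measurable] = h(1) F
  have F': "F \<in> borel_measurable (lebesgue_prod (insert i J))"
    and h': "h \<in> borel_measurable (lebesgue_prod (insert i J))"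
    using F h(1) IJ(1) by simp_all
  note [measurable] = F' h'
  have "(\<integral>\<^sup>+ y. F y \<partial>lebesgue_prod I) = (\<integral>\<^sup>+ y. (\<integral>\<^sup>+ t. F (y(i := t)) \<partial>lborel) \<partial>lebesgue_prod J)"
    unfolding IJ(1) by (rule product_nn_integral_insert[OF IJ(2,3)]) measurable
  also have "\<dots> = (\<integral>\<^sup>+ y. ennreal \<bar>a\<bar> * (\<integral>\<^sup>+ t. F (y(i := h y + a * t)) \<partial>lborel) \<partial>lebesgue_prod J)"
  proof (rule nn_integral_cong)
    fix y assume y: "y \<in> space (lebesgue_prod J)"
    have [measurable]: "(\<lambda>t. F (y(i := t))) \<in> borel_measurable borel"
    proof -
      have "(\<lambda>t. y(i := t)) \<in> measurable borel (lebesgue_prod (insert i J))"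
        using y by (intro measurable_fun_upd[where J = J]) (auto simp: IJ)
      then show ?thesis
        by measurable
    qed
    show "(\<integral>\<^sup>+ t. F (y(i := t)) \<partial>lborel) = ennreal \<bar>a\<bar> * (\<integral>\<^sup>+ t. F (y(i := h y + a * t)) \<partial>lborel)"
      using \<open>a \<noteq> 0\<close> by (subst nn_integral_real_affine[where c = a and t = "h y"]) auto
  qed
  \<comment> \<open>The integrand is rewritten as a function of \<open>y(i := t)\<close>, so that
    the Fubini formula can be applied backwards.\<close>
  also have "\<dots> = (\<integral>\<^sup>+ y. (\<integral>\<^sup>+ t. ennreal \<bar>a\<bar> * F ((y(i := t))(i := h (y(i := t)) + a * (y(i := t)) i)) \<partial>lborel) \<partial>lebesgue_prod J)"
  proof (rule nn_integral_cong)
    fix y assume y: "y \<in> space (lebesgue_prod J)"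
    have 1: "(\<lambda>t. y(i := h y + a * t)) \<in> measurable borel (lebesgue_prod (insert i J))"
      using y by (intro measurable_fun_upd[where J = J]) (auto simp: IJ)
    have [measurable]: "(\<lambda>t. F (y(i := h y + a * t))) \<in> borel_measurable borel"
      using 1 by measurable
    show "ennreal \<bar>a\<bar> * (\<integral>\<^sup>+ t. F (y(i := h y + a * t)) \<partial>lborel) = (\<integral>\<^sup>+ t. ennreal \<bar>a\<bar> * F ((y(i := t))(i := h (y(i := t)) + a * (y(i := t)) i)) \<partial>lborel)"
      by (subst nn_integral_cmult[symmetric]) (simp_all add: h(2))
  qed
  also have "\<dots> = (\<integral>\<^sup>+ y. ennreal \<bar>a\<bar> * F (y(i := h y + a * y i)) \<partial>lebesgue_prod I)"
  proof -
    have 1: "(\<lambda>y. y(i := h y + a * y i)) \<in> measurable (lebesgue_prod (insert i J)) (lebesgue_prod (insert i J))"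
      by (intro measurable_fun_upd[where J = "insert i J"]) auto
    note [measurable] = measurable_compose[OF 1 F']
    show ?thesis
      unfolding IJ(1) by (intro product_nn_integral_insert[OF IJ(2,3), symmetric]) measurable
  qed
  also have "\<dots> = ennreal \<bar>a\<bar> * (\<integral>\<^sup>+ y. F (y(i := h y + a * y i)) \<partial>lebesgue_prod I)"
  proof -
    have 1: "(\<lambda>y. y(i := h y + a * y i)) \<in> measurable (lebesgue_prod I) (lebesgue_prod I)"
      using I by (intro measurable_fun_upd[where J = I]) (auto)
    show ?thesis
      using measurable_compose[OF 1 F] by (intro nn_integral_cmult)
  qed
  finally show ?thesis .
qed

text \<open>Every line in direction \<open>i\<close> meets the graph in at most one point. The lemma
  serves to discard the points with two equal barycentric coordinates.\<close>

lemma null_graph: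
  fixes h :: "(nat \<Rightarrow> real) \<Rightarrow> real"
  assumes I: "finite I" "i \<in> I"
    and h: "h \<in> borel_measurable (lebesgue_prod I)" "\<And>y t. h (y(i := t)) = h y"
  shows "AE y in lebesgue_prod I. y i \<noteq> h y"
proof -
  interpret product_sigma_finite "\<lambda>_::nat. lborel :: real measure"
    by (rule product_sigma_finite_lborel)
  define J where "J = I - {i}"
  have IJ: "I = insert i J" "finite J" "i \<notin> J"
    using I by (auto simp: J_def)
  have h'[measurable]: "h \<in> borel_measurable (lebesgue_prod (insert i J))"
    using h(1) IJ(1) by simp_all
  have "{y \<in> space (lebesgue_prod (insert i J)). y i = h y} \<in> sets (lebesgue_prod (insert i J))"
    by measurable
  then have "emeasure (lebesgue_prod (insert i J)) {y \<in> space (lebesgue_prod (insert i J)). y i = h y} = 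
    (\<integral>\<^sup>+ y. indicator {y \<in> space (lebesgue_prod (insert i J)). y i = h y} y \<partial>lebesgue_prod (insert i J))"
    by simp
  also have "\<dots> = (\<integral>\<^sup>+ y. \<integral>\<^sup>+ t. indicator {y \<in> space (lebesgue_prod (insert i J)). y i = h y} (y(i := t)) \<partial>lborel \<partial>lebesgue_prod J)"
    by (intro product_nn_integral_insert IJ) measurable
  also have "\<dots> \<le> (\<integral>\<^sup>+ y. \<integral>\<^sup>+ t. indicator {h y} t \<partial>lborel \<partial>lebesgue_prod J)"
    by (intro nn_integral_mono) (auto simp: indicator_def h(2))
  also have "\<dots> = 0"
    by (simp)
  finally show ?thesis
    unfolding IJ(1) by (intro AE_I[where N = "{y \<in> space (lebesgue_prod (insert i J)). y i = h y}"]) auto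
qed

text \<open>The integral runs over the whole affine hyperplane of coordinate sum \<open>1\<close>;
  the simplex enters later as an indicator inside \<open>F\<close>. This admits substitutions, such
  as \<open>flag_map\<close>, that do not map the simplex onto itself.\<close>

definition chart_integral :: "nat \<Rightarrow> ((nat \<Rightarrow> real) \<Rightarrow> ennreal) \<Rightarrow> ennreal" where
  "chart_integral n F = (\<integral>\<^sup>+ y. F (simplex_chart n y) \<partial>lebesgue_prod {1..n})"

lemma simplex_chart_measurable [measurable]:
  "simplex_chart n \<in> measurable (lebesgue_prod {1..n}) borel"
proof (rule measurable_coordinatewise_then_product)
  fix i
  show "(\<lambda>y. simplex_chart n y i) \<in> borel_measurable (lebesgue_prod {1..n})"
    unfolding simplex_chart_def by (cases "i = 0"; cases "i \<le> n") simp_all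
qed

lemma sum_simplex_chart: "(\<Sum>i\<le>n. simplex_chart n y i) = 1"
proof -
  have "(\<Sum>i\<le>n. simplex_chart n y i) = simplex_chart n y 0 + (\<Sum>i=1..n. simplex_chart n y i)"
    by (simp add: atMost_atLeast0 sum.atLeast_Suc_atMost)
  also have "(\<Sum>i=1..n. simplex_chart n y i) = (\<Sum>i=1..n. y i)"
    by (intro sum.cong) (auto simp: simplex_chart_def)
  finally show ?thesis
    by (simp add: simplex_chart_def)
qed

text \<open>Exchanging the coordinates \<open>0\<close> and \<open>i\<close> replaces the chart
  coordinate \<open>y i\<close> by the omitted coordinate, which is affine in \<open>y i\<close>
  with slope \<open>-1\<close>.\<close>

lemma chart_integral_star_transpose:
  assumes F: "F \<in> borel_measurable borel" and i: "i \<le> n"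
  shows "chart_integral n (\<lambda>x. F (x \<circ> Transposition.transpose 0 i)) = chart_integral n F"
proof (cases "i = 0")
  case False
  define h where "h y = 1 - (\<Sum>j\<in>{1..n} - {i}. y j)" for y :: "nat \<Rightarrow> real"
  have i': "i \<in> {1..n}"
    using i False by auto
  have "simplex_chart n (y(i := h y + - 1 * y i)) = simplex_chart n y \<circ> Transposition.transpose 0 i" for y
  proof
    fix k
    have s: "(\<Sum>j=1..n. y j) = y i + (\<Sum>j\<in>{1..n} - {i}. y j)" for y :: "nat \<Rightarrow> real"
      using i' by (simp add: sum.remove)
    have "(\<Sum>j=1..n. (y(i := h y + - 1 * y i)) j) = h y - y i + (\<Sum>j\<in>{1..n} - {i}. y j)"
      by (subst s) simp
    also have "\<dots> = 1 - y i"
      by (simp add: h_def)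
    finally have "(\<Sum>j=1..n. (y(i := h y + - 1 * y i)) j) = 1 - y i" .
    moreover have "h y - y i = 1 - (\<Sum>j=1..n. y j)"
      using s[of y] by (simp add: h_def)
    ultimately show "simplex_chart n (y(i := h y + - 1 * y i)) k = (simplex_chart n y \<circ> Transposition.transpose 0 i) k"
      using i' by (auto simp: simplex_chart_def Transposition.transpose_def)
  qed
  moreover have "chart_integral n F = ennreal \<bar>- 1\<bar> * (\<integral>\<^sup>+ y. F (simplex_chart n (y(i := h y + - 1 * y i))) \<partial>lebesgue_prod {1..n})"
    unfolding chart_integral_def
  proof (rule nn_integral_shear)
    show "h \<in> borel_measurable (lebesgue_prod {1..n})"
      unfolding h_def by measurable
    show "h (y(i := t)) = h y" for y t
      by (simp add: h_def)
    show "(\<lambda>y. F (simplex_chart n y)) \<in> borel_measurable (lebesgue_prod {1..n})"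
      using F by measurable
  qed (use i' in auto)
  ultimately show ?thesis
    by (simp add: chart_integral_def)
qed (simp add: comp_def)

lemma measurable_comp_fun [measurable]: "(\<lambda>x. x \<circ> \<pi>) \<in> measurable borel (borel :: (nat \<Rightarrow> real) measure)" for \<pi> :: "nat \<Rightarrow> nat"
  unfolding comp_def by (rule measurable_coordinatewise_then_product) simp

text \<open>The transpositions that move \<open>0\<close> generate all permutations:
  \<open>(a b) = (0 a) (0 b) (0 a)\<close>.\<close>

lemma chart_integral_permute:
  assumes \<pi>: "\<pi> permutes {..n}" and F: "F \<in> borel_measurable borel"
  shows "chart_integral n (\<lambda>x. F (x \<circ> \<pi>)) = chart_integral n F"
  using \<pi> finite_atMost[of n] F
proof (induction arbitrary: F rule: permutes_induct)
  case (swap a b p)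
  note 3 = swap.hyps swap.IH swap.prems
  have star: "chart_integral n (\<lambda>x. F (x \<circ> Transposition.transpose a b)) = chart_integral n F"
    if F: "F \<in> borel_measurable borel" for F
  proof (cases "a = 0 \<or> b = 0")
    case True
    then show ?thesis
      using chart_integral_star_transpose[OF F, of a n] chart_integral_star_transpose[OF F, of b n] 3(1,2)
      by (auto simp: transpose_commute[of a 0])
  next
    case False
    have eq: "x \<circ> Transposition.transpose a b = x \<circ> Transposition.transpose 0 a \<circ> Transposition.transpose 0 b \<circ> Transposition.transpose 0 a" for x :: "nat \<Rightarrow> real"
      using False \<open>a \<noteq> b\<close> by (auto simp: fun_eq_iff Transposition.transpose_def)
    have "chart_integral n (\<lambda>x. F (x \<circ> Transposition.transpose a b))
        = chart_integral n (\<lambda>x. F (x \<circ> Transposition.transpose 0 b \<circ> Transposition.transpose 0 a))"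
      unfolding eq using F 3(1)
      by (intro chart_integral_star_transpose[of "\<lambda>x. F (x \<circ> Transposition.transpose 0 b \<circ> Transposition.transpose 0 a)"]) auto
    also have "\<dots> = chart_integral n (\<lambda>x. F (x \<circ> Transposition.transpose 0 a))"
      using F 3(2) by (intro chart_integral_star_transpose[of "\<lambda>x. F (x \<circ> Transposition.transpose 0 a)"]) auto
    also have "\<dots> = chart_integral n F"
      using F 3(1) by (intro chart_integral_star_transpose) auto
    finally show ?thesis .
  qed
  have "chart_integral n (\<lambda>x. F (x \<circ> Transposition.transpose a b \<circ> p)) = chart_integral n (\<lambda>x. F (x \<circ> p))"
    using 3 by (intro star[of "\<lambda>x. F (x \<circ> p)"]) auto
  also have "\<dots> = chart_integral n F"
    using swap.prems by (rule swap.IH)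
  finally show ?case
    unfolding comp_assoc .
qed (auto simp: comp_def)

text \<open>The affine map sending the vertex \<open>k\<close> to the barycenter of the vertices \<open>0, \<dots>, k\<close>. Omitting the
  zeroth coordinate makes it triangular, hence a product of shears of single coordinates.\<close>

definition flag_map :: "nat \<Rightarrow> (nat \<Rightarrow> real) \<Rightarrow> nat \<Rightarrow> real" where
  "flag_map n x = (\<lambda>j. if j \<le> n then \<Sum>k=j..n. x k / (real k + 1) else 0)"

lemma flag_map_measurable [measurable]: "flag_map n \<in> measurable borel borel"
  by (rule measurable_coordinatewise_then_product) (simp add: flag_map_def)

lemma sum_triangle:
  fixes f :: "nat \<Rightarrow> nat \<Rightarrow> 'b::comm_monoid_add"
  shows "(\<Sum>j\<le>n. \<Sum>k=j..n. f j k) = (\<Sum>k\<le>n. \<Sum>j\<le>k. f j k)"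
proof -
  have "(\<Sum>j\<le>n. \<Sum>k=j..n. f j k) = (\<Sum>j\<le>n. \<Sum>k | k \<in> {..n} \<and> j \<le> k. f j k)"
    by (intro sum.cong) auto
  also have "\<dots> = (\<Sum>k\<le>n. \<Sum>j | j \<in> {..n} \<and> j \<le> k. f j k)"
    by (rule sum.swap_restrict) auto
  also have "\<dots> = (\<Sum>k\<le>n. \<Sum>j\<le>k. f j k)"
    by (intro sum.cong) auto
  finally show ?thesis .
qed

lemma sum_flag_map: "(\<Sum>j\<le>n. flag_map n x j) = (\<Sum>k\<le>n. x k)"
proof -
  have "(\<Sum>j\<le>n. flag_map n x j) = (\<Sum>j\<le>n. \<Sum>k=j..n. x k / (real k + 1))"
    by (simp add: flag_map_def)
  also have "\<dots> = (\<Sum>k\<le>n. \<Sum>j\<le>k. x k / (real k + 1))"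
    by (rule sum_triangle)
  also have "\<dots> = (\<Sum>k\<le>n. x k)"
    by (intro sum.cong) (auto simp: field_simps)
  finally show ?thesis .
qed

text \<open>The constant is a determinant: in the chart the map is triangular with diagonal entries
  \<open>1 / (k + 1)\<close> for \<open>k\<close> from \<open>1\<close> to \<open>n\<close>, whose
  product is \<open>1 / (n + 1)!\<close>.\<close>

lemma chart_integral_flag_map:
  assumes F: "F \<in> borel_measurable borel"
  shows "chart_integral n F = ennreal (1 / fact (n + 1)) * chart_integral n (\<lambda>x. F (flag_map n x))"
proof -
  \<comment> \<open>\<open>Bm m\<close> applies the triangular map to the coordinates
    \<open>1\<close> to \<open>m\<close> only. A new coordinate \<open>j\<close> involves only old
    coordinates \<open>k \<ge> j\<close>, so passing from \<open>m\<close> to \<open>m + 1\<close>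
    is a shear whose offset uses coordinates that are still untouched.\<close>
  define Bm where "Bm m y = (\<lambda>j. if 1 \<le> j \<and> j \<le> m then \<Sum>k=j..n. y k / (real k + 1) else y j)"
    for m and y :: "nat \<Rightarrow> real"
  have step: "(\<integral>\<^sup>+ y. G y \<partial>lebesgue_prod {1..n})
      = ennreal (1 / fact (m + 1)) * (\<integral>\<^sup>+ y. G (Bm m y) \<partial>lebesgue_prod {1..n})"
    if "m \<le> n" "G \<in> borel_measurable (lebesgue_prod {1..n})" for m G
    using that
  proof (induction m arbitrary: G)
    case 0
    have "Bm 0 y = y" for y
      by (auto simp: Bm_def)
    then show ?case
      by simp
  next
    case (Suc m)
    define h where "h y = (\<Sum>k=Suc (Suc m)..n. y k / (real k + 1))" for y :: "nat \<Rightarrow> real"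
    define a where "a = 1 / (real (Suc m) + 1)"
    define S where "S y = y(Suc m := h y + a * y (Suc m))" for y
    have h: "h \<in> borel_measurable (lebesgue_prod {1..n})"
      unfolding h_def by measurable
    have S: "S \<in> measurable (lebesgue_prod {1..n}) (lebesgue_prod {1..n})"
    proof -
      have "Suc m \<in> {1..n}"
        using Suc.prems(1) by simp
      then have "(\<lambda>y. h y + a * y (Suc m)) \<in> measurable (lebesgue_prod {1..n}) lborel"
        using h by measurable
      then show ?thesis
        unfolding S_def using Suc.prems(1) insert_absorb[of "Suc m" "{1..n}"]
        by (intro measurable_fun_upd[where J = "{1..n}"]) auto
    qed
    have SB: "S (Bm m y) = Bm (Suc m) y" for y
    proof
      fix j
      have "h (Bm m y) = h y"
        unfolding h_def by (intro sum.cong) (auto simp: Bm_def)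
      moreover have "(\<Sum>k=Suc m..n. y k / (real k + 1)) = y (Suc m) / (real (Suc m) + 1) + h y"
        unfolding h_def using Suc.prems(1) by (simp add: sum.atLeast_Suc_atMost)
      ultimately show "S (Bm m y) j = Bm (Suc m) y j"
        by (auto simp: S_def Bm_def a_def le_Suc_eq)
    qed
    have "(\<integral>\<^sup>+ y. G y \<partial>lebesgue_prod {1..n}) = ennreal \<bar>a\<bar> * (\<integral>\<^sup>+ y. G (S y) \<partial>lebesgue_prod {1..n})"
      unfolding S_def using Suc.prems h
      by (intro nn_integral_shear) (auto simp: a_def h_def)
    also have "(\<integral>\<^sup>+ y. G (S y) \<partial>lebesgue_prod {1..n})
        = ennreal (1 / fact (m + 1)) * (\<integral>\<^sup>+ y. G (S (Bm m y)) \<partial>lebesgue_prod {1..n})"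
      using Suc.prems by (intro Suc.IH[of "\<lambda>y. G (S y)"] measurable_compose[OF S]) auto
    also have "ennreal \<bar>a\<bar> * (ennreal (1 / fact (m + 1)) * (\<integral>\<^sup>+ y. G (S (Bm m y)) \<partial>lebesgue_prod {1..n}))
        = ennreal (\<bar>a\<bar> * (1 / fact (m + 1))) * (\<integral>\<^sup>+ y. G (Bm (Suc m) y) \<partial>lebesgue_prod {1..n})"
      by (simp only: SB mult.assoc[symmetric] ennreal_mult abs_ge_zero zero_le_divide_1_iff fact_ge_zero)
    also have "\<bar>a\<bar> * (1 / fact (m + 1)) = 1 / fact (Suc m + 1)"
      by (simp add: a_def field_simps)
    finally show ?case .
  qed
  have "simplex_chart n (Bm n y) = flag_map n (simplex_chart n y)" for y
  proof
    fix j
    have pos: "simplex_chart n (Bm n y) j = flag_map n (simplex_chart n y) j" if "j \<noteq> 0" for j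
    proof -
      have "(\<Sum>k=j..n. simplex_chart n y k / (real k + 1)) = (\<Sum>k=j..n. y k / (real k + 1))"
        using that by (intro sum.cong) (auto simp: simplex_chart_def)
      then show ?thesis
        using that by (auto simp: simplex_chart_def flag_map_def Bm_def)
    qed
    have split: "(\<Sum>i\<le>n. x i) = x 0 + (\<Sum>i=1..n. x i)" for x :: "nat \<Rightarrow> real"
      by (simp add: atMost_atLeast0 sum.atLeast_Suc_atMost)
    \<comment> \<open>The zeroth coordinates agree because the other ones do and both points have
      coordinate sum \<open>1\<close>.\<close>
    have "(\<Sum>i\<le>n. simplex_chart n (Bm n y) i) = (\<Sum>i\<le>n. flag_map n (simplex_chart n y) i)"
      by (simp add: sum_flag_map sum_simplex_chart)
    moreover have "(\<Sum>i=1..n. simplex_chart n (Bm n y) i) = (\<Sum>i=1..n. flag_map n (simplex_chart n y) i)"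
      by (intro sum.cong pos) auto
    ultimately have "simplex_chart n (Bm n y) 0 = flag_map n (simplex_chart n y) 0"
      unfolding split by simp
    then show "simplex_chart n (Bm n y) j = flag_map n (simplex_chart n y) j"
      using pos by (cases "j = 0") auto
  qed
  then show ?thesis
    unfolding chart_integral_def
    using step[OF order.refl measurable_compose[OF simplex_chart_measurable F]] by simp
qed

section \<open>Decomposition of the simplex into chambers of sorted points\<close>

definition antitone_upto :: "nat \<Rightarrow> (nat \<Rightarrow> real) \<Rightarrow> bool" where
  "antitone_upto n x \<longleftrightarrow> (\<forall>i<n. x (Suc i) \<le> x i)"

lemma antitone_upto_measurable [measurable]: "Measurable.pred borel (antitone_upto n)"
proof -
  have "{x. antitone_upto n x} = (\<Inter>i\<in>{..<n}. {x. x (Suc i) \<le> x i})"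
    by (auto simp: antitone_upto_def)
  also have "closed \<dots>"
    by (intro closed_INT ballI closed_Collect_le continuous_on_product_coordinates)
  finally show ?thesis
    by (simp add: pred_def)
qed

lemma flag_map_Suc: "j < n \<Longrightarrow> flag_map n x j = flag_map n x (Suc j) + x j / (real j + 1)"
  unfolding flag_map_def by (subst sum.atLeast_Suc_atMost) simp_all

text \<open>Consecutive coordinates of the image differ by \<open>x j / (j + 1)\<close> and the last
  one is \<open>x n / (n + 1)\<close>. Hence being decreasing and nonnegative amounts to
  nonnegativity of all \<open>x j\<close>.\<close>

lemma flag_map_chamber:
  assumes "\<And>i. n < i \<Longrightarrow> x i = 0" "(\<Sum>i\<le>n. x i) = 1"
  shows "flag_map n x \<in> geom_simplex {..n} \<and> antitone_upto n (flag_map n x) \<longleftrightarrow> x \<in> geom_simplex {..n}"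
proof
  assume *: "flag_map n x \<in> geom_simplex {..n} \<and> antitone_upto n (flag_map n x)"
  have "0 \<le> x i" for i
  proof (cases i n rule: linorder_cases)
    case less
    then have "flag_map n x (Suc i) \<le> flag_map n x i"
      using * by (simp add: antitone_upto_def)
    then show ?thesis
      using flag_map_Suc[OF less, of x] by (simp add: zero_le_divide_iff)
  next
    case equal
    have "0 \<le> flag_map n x n"
      using * by (simp add: geom_simplex_def)
    then show ?thesis
      using equal by (simp add: flag_map_def zero_le_divide_iff)
  qed (use assms(1) in simp)
  then show "x \<in> geom_simplex {..n}"
    using assms by (simp add: geom_simplex_def)
next
  assume "x \<in> geom_simplex {..n}"
  then have pos: "0 \<le> x i" for i
    by (simp add: geom_simplex_def)
  then have "0 \<le> flag_map n x j" for j
    by (simp add: flag_map_def sum_nonneg)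
  moreover have "antitone_upto n (flag_map n x)"
    using pos flag_map_Suc[of _ n x] by (simp add: antitone_upto_def)
  moreover have "(\<Sum>i\<le>n. flag_map n x i) = 1"
    using assms(2) by (simp add: sum_flag_map)
  moreover have "flag_map n x i = 0" if "n < i" for i
    using that by (simp add: flag_map_def)
  ultimately show "flag_map n x \<in> geom_simplex {..n} \<and> antitone_upto n (flag_map n x)"
    by (simp add: geom_simplex_def)
qed

text \<open>For existence, position \<open>i\<close> is sent to the index at which the
  \<open>i\<close>-th largest value occurs. For uniqueness, any two such permutations list the same
  set of values in the same order, and injectivity of \<open>x\<close> recovers the indices.\<close>

lemma sorting_permutation_unique:
  fixes x :: "nat \<Rightarrow> real"
  assumes x: "inj_on x {..n}"
  shows "\<exists>!\<pi>. \<pi> permutes {..n} \<and> antitone_upto n (x \<circ> \<pi>)"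
proof (rule ex_ex1I)
  define l where "l = rev (sorted_list_of_set (x ` {..n}))"
  have l: "length l = Suc n" "set l = x ` {..n}" "distinct l" "sorted_wrt (\<ge>) l"
    using x by (auto simp: l_def card_image sorted_wrt_rev)
  define \<pi> where "\<pi> i = (if i \<le> n then inv_into {..n} x (l ! i) else i)" for i
  have x\<pi>: "x (\<pi> i) = l ! i" "\<pi> i \<le> n" if "i \<le> n" for i
  proof -
    have "l ! i \<in> x ` {..n}"
      using that l(1,2) nth_mem[of i l] by simp
    moreover have "\<pi> i = inv_into {..n} x (l ! i)"
      using that by (simp only: \<pi>_def if_True)
    ultimately show "x (\<pi> i) = l ! i" "\<pi> i \<le> n"
      using f_inv_into_f[of "l ! i" x "{..n}"] inv_into_into[of "l ! i" x "{..n}"]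
      by (simp_all only: atMost_iff)
  qed
  have "inj_on \<pi> {..n}"
  proof (rule inj_onI)
    fix i j assume ij: "i \<in> {..n}" "j \<in> {..n}" "\<pi> i = \<pi> j"
    then have "l ! i = l ! j"
      using x\<pi>(1)[of i] x\<pi>(1)[of j] by simp
    then show "i = j"
      using ij(1,2) l(1,3) by (simp add: nth_eq_iff_index_eq)
  qed
  moreover have "\<pi> ` {..n} \<subseteq> {..n}"
    using x\<pi>(2) by auto
  ultimately have "bij_betw \<pi> {..n} {..n}"
    by (simp add: bij_betw_def endo_inj_surj)
  then have "\<pi> permutes {..n}"
    by (rule bij_imp_permutes) (simp add: \<pi>_def)
  moreover have "antitone_upto n (x \<circ> \<pi>)"
    using l(1,4) x\<pi>(1) by (auto simp: antitone_upto_def sorted_wrt_iff_nth_less)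
  ultimately show "\<exists>\<pi>. \<pi> permutes {..n} \<and> antitone_upto n (x \<circ> \<pi>)"
    by blast
next
  fix \<pi> \<rho>
  assume *: "\<pi> permutes {..n} \<and> antitone_upto n (x \<circ> \<pi>)" "\<rho> permutes {..n} \<and> antitone_upto n (x \<circ> \<rho>)"
  define l where "l \<sigma> = rev (map (x \<circ> \<sigma>) [0..<Suc n])" for \<sigma>
  have l: "sorted (l \<sigma>) \<and> distinct (l \<sigma>) \<and> set (l \<sigma>) = x ` {..n}"
    if "\<sigma> permutes {..n} \<and> antitone_upto n (x \<circ> \<sigma>)" for \<sigma>
  proof (intro conjI)
    have img: "\<sigma> ` {..n} = {..n}"
      using that permutes_image by blast
    have "inj_on (x \<circ> \<sigma>) {..n}"
      using that x img by (intro comp_inj_on) (auto simp: permutes_inj_on)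
    then show "distinct (l \<sigma>)"
      by (simp add: l_def distinct_map atLeast0LessThan lessThan_Suc_atMost del: upt_Suc)
    show "set (l \<sigma>) = x ` {..n}"
      using img by (metis (no_types) l_def set_rev set_map set_upt atLeast0LessThan lessThan_Suc_atMost image_comp)
    have "sorted_wrt (\<ge>) (map (x \<circ> \<sigma>) [0..<Suc n])"
      using that by (subst sorted_wrt_iff_nth_Suc_transp)
        (auto simp: antitone_upto_def transp_def simp del: upt_Suc)
    then show "sorted (l \<sigma>)"
      by (simp add: l_def sorted_wrt_rev del: upt_Suc)
  qed
  have "l \<pi> = l \<rho>"
    using l[OF *(1)] l[OF *(2)] by (intro sorted_distinct_set_unique) auto
  then have "map (x \<circ> \<pi>) [0..<Suc n] = map (x \<circ> \<rho>) [0..<Suc n]"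
    by (simp add: l_def del: upt_Suc)
  then have eq: "x (\<pi> i) = x (\<rho> i)" if "i \<le> n" for i
    using that by (simp add: map_eq_conv del: upt_Suc)
  show "\<pi> = \<rho>"
  proof
    fix i
    show "\<pi> i = \<rho> i"
    proof (cases "i \<le> n")
      case True
      then have "\<pi> i \<in> {..n}" "\<rho> i \<in> {..n}"
        using * permutes_in_image[of _ "{..n}" i] by auto
      then show ?thesis
        using eq[OF True] x by (auto dest: inj_onD)
    next
      case False
      then show ?thesis
        using * permutes_not_in[of \<pi> "{..n}" i] permutes_not_in[of \<rho> "{..n}" i] by simp
    qed
  qed
qed

lemma AE_simplex_chart_inj: "AE y in lebesgue_prod {1..n}. inj_on (simplex_chart n y) {..n}"
proof -
  have ne: "AE y in lebesgue_prod {1..n}. simplex_chart n y i \<noteq> simplex_chart n y j"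
    if ij: "i < j" "j \<le> n" for i j
  proof (cases "i = 0")
    case True
    \<comment> \<open>For \<open>i = 0\<close> the equation between the two coordinates contains
      \<open>y j\<close> on both sides; solving for \<open>y j\<close> produces the factor
      \<open>1 / 2\<close>.\<close>
    define h where "h y = (1 - (\<Sum>k\<in>{1..n} - {j}. y k)) / 2" for y :: "nat \<Rightarrow> real"
    have "AE y in lebesgue_prod {1..n}. y j \<noteq> h y"
    proof (rule null_graph)
      show "h \<in> borel_measurable (lebesgue_prod {1..n})"
        unfolding h_def by measurable
    qed (use ij in \<open>auto simp: h_def\<close>)
    then show ?thesis
    proof eventually_elim
      case (elim y)
      have "(\<Sum>k=1..n. y k) = y j + (\<Sum>k\<in>{1..n} - {j}. y k)"
        using ij by (intro sum.remove) auto
      then show ?case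
        using elim True ij by (auto simp: simplex_chart_def h_def field_simps)
    qed
  next
    case False
    have "AE y in lebesgue_prod {1..n}. y j \<noteq> y i"
      by (rule null_graph) (use ij False in auto)
    then show ?thesis
      by eventually_elim (use ij False in \<open>auto simp: simplex_chart_def\<close>)
  qed
  have "AE y in lebesgue_prod {1..n}. \<forall>j\<in>{..n}. \<forall>i\<in>{..<j}. simplex_chart n y i \<noteq> simplex_chart n y j"
    using ne by (simp add: AE_ball_countable)
  then show ?thesis
  proof (rule eventually_mono)
    fix y assume y: "\<forall>j\<in>{..n}. \<forall>i\<in>{..<j}. simplex_chart n y i \<noteq> simplex_chart n y j"
    show "inj_on (simplex_chart n y) {..n}"
      by (rule linorder_inj_onI) (use y in auto)
  qed
qed

lemma geom_simplex_nat_closed: "closed (geom_simplex {..n::nat})"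
proof -
  have "geom_simplex {..n} = (\<Inter>v. {x. 0 \<le> x v}) \<inter> (\<Inter>v\<in>{n<..}. {x. x v = 0}) \<inter> {x. (\<Sum>v\<le>n. x v) = 1}"
    by (auto simp: geom_simplex_def)
  also have "closed \<dots>"
    by (intro closed_Int closed_INT ballI closed_Collect_le closed_Collect_eq continuous_intros
        continuous_on_product_coordinates)
  finally show ?thesis .
qed

lemma geom_simplex_borel [measurable]: "geom_simplex {..n::nat} \<in> sets borel"
  using geom_simplex_nat_closed by simp

lemma geom_simplex_permute:
  assumes "\<pi> permutes {..n::nat}"
  shows "x \<circ> \<pi> \<in> geom_simplex {..n} \<longleftrightarrow> x \<in> geom_simplex {..n}"
proof -
  have *: "x \<circ> \<pi> \<in> geom_simplex {..n}" if "x \<in> geom_simplex {..n}" "\<pi> permutes {..n}" for x \<pi>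
  proof -
    have "(\<Sum>i\<le>n. x (\<pi> i)) = (\<Sum>i\<le>n. x i)"
      using sum.permute[OF that(2), of x] by simp
    moreover have "\<pi> i \<notin> {..n}" if "i \<notin> {..n}" for i
      using that permutes_in_image[OF \<open>\<pi> permutes {..n}\<close>, of i] by simp
    ultimately show ?thesis
      using that(1) by (auto simp: geom_simplex_def)
  qed
  moreover have "(x \<circ> \<pi>) \<circ> inv \<pi> = x"
    using assms by (simp only: comp_assoc permutes_inv_o comp_id)
  ultimately show ?thesis
    using *[OF _ assms, of x] *[OF _ permutes_inv[OF assms], of "x \<circ> \<pi>"] by argo
qed

lemma flag_map_geom_simplex:
  assumes x: "x \<in> geom_simplex {..n}"
  shows "flag_map n x \<in> geom_simplex {..n}"
proof -
  have "x i = 0" if "n < i" for i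
    using x that by (simp add: geom_simplex_def)
  moreover have "(\<Sum>i\<le>n. x i) = 1"
    using x by (simp add: geom_simplex_def)
  ultimately show ?thesis
    using flag_map_chamber[of n x] x by blast
qed

text \<open>Almost every point has a unique sorting permutation, so that its images under the
  \<open>(n + 1)!\<close> permutations meet the chamber \<open>x 0 \<ge> \<dots> \<ge> x n\<close> exactly once.\<close>

lemma chart_integral_subdivide:
  assumes h: "h \<in> borel_measurable borel"
  shows "chart_integral n (\<lambda>x. h x * indicator (geom_simplex {..n}) x) =
    ennreal (1 / fact (n + 1)) *
    (\<Sum>\<pi> | \<pi> permutes {..n}. chart_integral n (\<lambda>x. h (flag_map n x \<circ> inv \<pi>) * indicator (geom_simplex {..n}) x))"
proof -
  define S where "S = {x. antitone_upto n x}"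
  have S [measurable]: "S \<in> sets borel"
    unfolding S_def by (simp add: borel_def[symmetric])
  let ?D = "geom_simplex {..n}"
  have fin: "finite {\<pi>. \<pi> permutes {..n}}"
    by (simp add: finite_permutations)
  note [measurable] = h
  have "chart_integral n (\<lambda>x. h x * indicator ?D x)
      = chart_integral n (\<lambda>x. \<Sum>\<pi> | \<pi> permutes {..n}. h x * indicator ?D x * indicator S (x \<circ> \<pi>))"
    unfolding chart_integral_def
  proof (rule nn_integral_cong_AE, use AE_simplex_chart_inj[of n] in eventually_elim)
    case (elim y)
    let ?x = "simplex_chart n y"
    obtain \<pi> where \<pi>: "\<And>\<rho>. \<rho> permutes {..n} \<and> antitone_upto n (?x \<circ> \<rho>) \<longleftrightarrow> \<rho> = \<pi>"
      using sorting_permutation_unique[OF elim] by metis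
    have "(\<Sum>\<rho> | \<rho> permutes {..n}. h ?x * indicator ?D ?x * indicator S (?x \<circ> \<rho>))
        = (\<Sum>\<rho> | \<rho> permutes {..n}. if \<rho> = \<pi> then h ?x * indicator ?D ?x else 0)"
    proof (rule sum.cong)
      fix \<rho> assume "\<rho> \<in> {\<rho>. \<rho> permutes {..n}}"
      then have "antitone_upto n (?x \<circ> \<rho>) \<longleftrightarrow> \<rho> = \<pi>"
        using \<pi>[of \<rho>] by simp
      then show "h ?x * indicator ?D ?x * indicator S (?x \<circ> \<rho>) = (if \<rho> = \<pi> then h ?x * indicator ?D ?x else 0)"
        by (auto simp: S_def indicator_def)
    qed simp
    also have "\<dots> = h ?x * indicator ?D ?x"
      using \<pi>[of \<pi>] fin by simp
    finally show ?case
      by simp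
  qed
  also have "\<dots> = (\<Sum>\<pi> | \<pi> permutes {..n}. chart_integral n (\<lambda>x. h x * indicator ?D x * indicator S (x \<circ> \<pi>)))"
    unfolding chart_integral_def
  proof (rule nn_integral_sum)
    fix \<pi>
    have "(\<lambda>x. h x * indicator ?D x * indicator S (x \<circ> \<pi>)) \<in> borel_measurable borel"
      by measurable
    then show "(\<lambda>y. h (simplex_chart n y) * indicator ?D (simplex_chart n y) * indicator S (simplex_chart n y \<circ> \<pi>))
        \<in> borel_measurable (lebesgue_prod {1..n})"
      by (rule measurable_compose[OF simplex_chart_measurable])
  qed
  also have "\<dots> = (\<Sum>\<pi> | \<pi> permutes {..n}.
      ennreal (1 / fact (n + 1)) * chart_integral n (\<lambda>x. h (flag_map n x \<circ> inv \<pi>) * indicator ?D x))"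
  proof (rule sum.cong)
    fix \<pi> assume "\<pi> \<in> {\<pi>. \<pi> permutes {..n}}"
    then have \<pi>: "\<pi> permutes {..n}"
      by simp
    \<comment> \<open>\<open>G\<close> lives on the sorted points of the simplex, and
      \<open>inv \<pi>\<close> undoes the sorting in the argument of \<open>h\<close>. After
      substituting \<open>flag_map\<close>, the two indicators merge into that of the simplex by
      \<open>flag_map_chamber\<close>.\<close>
    define G where "G x = h (x \<circ> inv \<pi>) * indicator ?D x * indicator S x" for x
    have G: "G \<in> borel_measurable borel"
      unfolding G_def by measurable
    have "G (x \<circ> \<pi>) = h x * indicator ?D x * indicator S (x \<circ> \<pi>)" for x
      using \<pi> by (simp add: G_def comp_assoc permutes_inv_o geom_simplex_permute indicator_def)
    then have "chart_integral n (\<lambda>x. h x * indicator ?D x * indicator S (x \<circ> \<pi>)) = chart_integral n G"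
      using chart_integral_permute[OF \<pi> G] by simp
    also have "\<dots> = ennreal (1 / fact (n + 1)) * chart_integral n (\<lambda>x. G (flag_map n x))"
      by (rule chart_integral_flag_map[OF G])
    also have "chart_integral n (\<lambda>x. G (flag_map n x)) = chart_integral n (\<lambda>x. h (flag_map n x \<circ> inv \<pi>) * indicator ?D x)"
      unfolding chart_integral_def
    proof (rule nn_integral_cong)
      fix y
      let ?x = "simplex_chart n y"
      have "flag_map n ?x \<in> ?D \<and> antitone_upto n (flag_map n ?x) \<longleftrightarrow> ?x \<in> ?D"
        by (rule flag_map_chamber) (simp_all only: sum_simplex_chart, simp add: simplex_chart_def)
      then show "G (flag_map n ?x) = h (flag_map n ?x \<circ> inv \<pi>) * indicator ?D ?x"
        by (auto simp: G_def S_def indicator_def)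
    qed
    finally show "chart_integral n (\<lambda>x. h x * indicator ?D x * indicator S (x \<circ> \<pi>))
        = ennreal (1 / fact (n + 1)) * chart_integral n (\<lambda>x. h (flag_map n x \<circ> inv \<pi>) * indicator ?D x)" .
  qed simp
  finally show ?thesis
    by (simp add: sum_distrib_left)
qed

section \<open>Borel sets of a complex and the normalized volume\<close>

lemma space_borel_complex [simp]: "space (borel_complex K) = realization K"
  by (simp add: borel_complex_def space_measure_of_conv)

lemma openin_complex_topology_subset: "{U. openin (complex_topology K) U} \<subseteq> Pow (realization K)"
  using openin_subset[of "complex_topology K"] by (auto simp: topspace_complex_topology)

lemma measurable_into_borel_complex:
  assumes "f \<in> space M \<rightarrow> realization K"
    and "\<And>U. openin (complex_topology K) U \<Longrightarrow> f -` U \<inter> space M \<in> sets M"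
  shows "f \<in> measurable M (borel_complex K)"
  unfolding borel_complex_def
  by (rule measurable_measure_of[OF openin_complex_topology_subset assms(1)]) (simp add: assms(2))

lemma openin_sets_borel_complex: "openin (complex_topology K) U \<Longrightarrow> U \<in> sets (borel_complex K)"
  unfolding borel_complex_def by (simp add: sets_measure_of[OF openin_complex_topology_subset] sigma_sets.Basic)

lemma continuous_map_measurable_borel_complex:
  assumes "continuous_map (complex_topology K) euclidean f"
  shows "f \<in> measurable (borel_complex K) borel"
proof (rule borel_measurableI)
  fix S :: "'b set" assume "open S"
  then have "openin (complex_topology K) {x \<in> topspace (complex_topology K). f x \<in> S}"
    using assms by (simp add: continuous_map_def)
  moreover have "f -` S \<inter> space (borel_complex K) = {x \<in> topspace (complex_topology K). f x \<in> S}"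
    by (auto simp: topspace_complex_topology)
  ultimately show "f -` S \<inter> space (borel_complex K) \<in> sets (borel_complex K)"
    by (simp add: openin_sets_borel_complex)
qed

lemma continuous_map_complex_topology_iff:
  "continuous_map (complex_topology K) euclidean f \<longleftrightarrow> (\<forall>s\<in>K. continuous_on (geom_simplex s) f)"
  for f :: "_ \<Rightarrow> 'b::topological_space"
proof -
  have eq: "{x \<in> realization K. f x \<in> U} \<inter> geom_simplex s = geom_simplex s \<inter> f -` U" if "s \<in> K" for s U
    using that by (auto simp: realization_def)
  show ?thesis
    unfolding continuous_map_def continuous_openin_preimage_eq openin_complex_topology topspace_complex_topology
    by (auto simp: eq)
qed

lemma realization_std_complex: "realization (std_complex n) = geom_simplex {..n}"
proof
  have "{..n} \<in> std_complex n"
    by (auto simp: std_complex_def)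
  then show "geom_simplex {..n} \<subseteq> realization (std_complex n)"
    by (auto simp: realization_def)
  have "geom_simplex s \<subseteq> geom_simplex {..n}" if "s \<in> std_complex n" for s
  proof
    fix x assume x: "x \<in> geom_simplex s"
    have s: "s \<subseteq> {..n}"
      using that by (simp add: std_complex_def)
    have "(\<Sum>v\<in>s. x v) = (\<Sum>v\<le>n. x v)"
      using x s by (intro sum.mono_neutral_left) (auto simp: geom_simplex_def)
    then show "x \<in> geom_simplex {..n}"
      using x s by (auto simp: geom_simplex_def)
  qed
  then show "realization (std_complex n) \<subseteq> geom_simplex {..n}"
    by (auto simp: realization_def)
qed

lemma simplex_chart_corner:
  assumes y: "y \<in> {1..n} \<rightarrow>\<^sub>E UNIV"
  shows "simplex_chart n y \<in> geom_simplex {..n} \<longleftrightarrow> y \<in> corner_simplex n"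
proof -
  have "simplex_chart n y \<in> geom_simplex {..n} \<longleftrightarrow> (\<forall>v\<le>n. 0 \<le> simplex_chart n y v)"
    unfolding geom_simplex_def by (auto simp: sum_simplex_chart) (auto simp: simplex_chart_def)
  also have "\<dots> \<longleftrightarrow> 0 \<le> simplex_chart n y 0 \<and> (\<forall>v\<in>{1..n}. 0 \<le> simplex_chart n y v)"
    by (metis One_nat_def atLeastAtMost_iff le0 less_Suc0 not_less)
  also have "\<dots> \<longleftrightarrow> y \<in> corner_simplex n"
    using y by (auto simp: corner_simplex_def simplex_chart_def)
  finally show ?thesis .
qed

lemma corner_simplex_sets [measurable]: "corner_simplex n \<in> sets (lebesgue_prod {1..n})"
proof -
  have "corner_simplex n = simplex_chart n -` geom_simplex {..n} \<inter> space (lebesgue_prod {1..n})"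
    using simplex_chart_corner[of _ n] by (auto simp: space_PiM corner_simplex_def)
  also have "\<dots> \<in> sets (lebesgue_prod {1..n})"
    by (rule measurable_sets[OF simplex_chart_measurable geom_simplex_borel])
  finally show ?thesis .
qed

text \<open>The corner simplex is squeezed between cubes of side \<open>1 / (n + 1)\<close> and
  \<open>1\<close>. Both facts are what makes the normalization in \<open>vol_std\<close> a
  probability measure.\<close>

lemma emeasure_corner_simplex:
  "emeasure (lebesgue_prod {1..n}) (corner_simplex n) \<noteq> 0"
  "emeasure (lebesgue_prod {1..n}) (corner_simplex n) \<noteq> \<infinity>"
proof -
  interpret product_sigma_finite "\<lambda>_::nat. lborel :: real measure"
    by (rule product_sigma_finite_lborel)
  have "({1..n} \<rightarrow>\<^sub>E {0..1 / (real n + 1)}) \<subseteq> corner_simplex n"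
  proof
    fix y assume y: "y \<in> {1..n} \<rightarrow>\<^sub>E {0..1 / (real n + 1)}"
    then have "(\<Sum>i=1..n. y i) \<le> (\<Sum>i=1..n. 1 / (real n + 1))"
      by (intro sum_mono) (auto simp: PiE_def Pi_def)
    also have "\<dots> \<le> 1"
      by (simp add: field_simps)
    finally show "y \<in> corner_simplex n"
      using y by (auto simp: corner_simplex_def PiE_def Pi_def)
  qed
  then have "emeasure (lebesgue_prod {1..n}) ({1..n} \<rightarrow>\<^sub>E {0..1 / (real n + 1)})
      \<le> emeasure (lebesgue_prod {1..n}) (corner_simplex n)"
    by (rule emeasure_mono) (rule corner_simplex_sets)
  moreover have "emeasure (lebesgue_prod {1..n}) ({1..n} \<rightarrow>\<^sub>E {0..1 / (real n + 1)}) = ennreal (1 / (real n + 1)) ^ n"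
    by (subst emeasure_PiM) auto
  moreover have "ennreal (1 / (real n + 1)) ^ n \<noteq> 0"
    by (simp add: ennreal_power)
  ultimately show "emeasure (lebesgue_prod {1..n}) (corner_simplex n) \<noteq> 0"
    by auto
  have "corner_simplex n \<subseteq> {1..n} \<rightarrow>\<^sub>E {0..1}"
  proof
    fix y assume y: "y \<in> corner_simplex n"
    have "y i \<le> 1" if i: "i \<in> {1..n}" for i
    proof -
      have "y i \<le> (\<Sum>i=1..n. y i)"
        using y i by (intro member_le_sum) (auto simp: corner_simplex_def)
      then show ?thesis
        using y by (simp add: corner_simplex_def)
    qed
    then show "y \<in> {1..n} \<rightarrow>\<^sub>E {0..1}"
      using y by (auto simp: corner_simplex_def PiE_def Pi_def)
  qed
  then have "emeasure (lebesgue_prod {1..n}) (corner_simplex n) \<le> emeasure (lebesgue_prod {1..n}) ({1..n} \<rightarrow>\<^sub>E {0..1})"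
    by (rule emeasure_mono) (auto intro!: sets_PiM_I_finite)
  also have "\<dots> = 1"
    by (subst emeasure_PiM) auto
  finally show "emeasure (lebesgue_prod {1..n}) (corner_simplex n) \<noteq> \<infinity>"
    by (auto simp: top_unique)
qed

text \<open>The full simplex is itself a member of the standard complex, so a set that is open in
  the weak topology is the trace of an open set on this one closed simplex.\<close>

lemma simplex_chart_measurable_complex:
  "simplex_chart n \<in> measurable
     (restrict_space (uniform_measure (lebesgue_prod {1..n}) (corner_simplex n)) (corner_simplex n))
     (borel_complex (std_complex n))"
proof (rule measurable_into_borel_complex)
  let ?M = "restrict_space (uniform_measure (lebesgue_prod {1..n}) (corner_simplex n)) (corner_simplex n)"
  have ext: "corner_simplex n \<subseteq> {1..n} \<rightarrow>\<^sub>E UNIV"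
    by (auto simp: corner_simplex_def)
  then have sp: "space ?M = corner_simplex n"
    by (auto simp: space_restrict_space space_PiM)
  show "simplex_chart n \<in> space ?M \<rightarrow> realization (std_complex n)"
    unfolding sp realization_std_complex using ext simplex_chart_corner by blast
  fix U assume "openin (complex_topology (std_complex n)) U"
  then have "openin (top_of_set (geom_simplex {..n})) (U \<inter> geom_simplex {..n})"
    and U: "U \<subseteq> geom_simplex {..n}"
    by (auto simp: openin_complex_topology realization_std_complex) (simp add: std_complex_def)
  then obtain W where W: "open W" "U = geom_simplex {..n} \<inter> W"
    by (auto simp: openin_open inf.absorb1)
  have "simplex_chart n -` U \<inter> space ?M = corner_simplex n \<inter> (simplex_chart n -` U \<inter> space (lebesgue_prod {1..n}))"
    unfolding sp using ext by (auto simp: space_PiM)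
  moreover have "simplex_chart n -` U \<inter> space (lebesgue_prod {1..n}) \<in> sets (lebesgue_prod {1..n})"
    using W by (intro measurable_sets[OF simplex_chart_measurable]) auto
  ultimately show "simplex_chart n -` U \<inter> space ?M \<in> sets ?M"
    by (auto simp: sets_restrict_space)
qed

lemma space_vol_std: "space (vol_std n) = geom_simplex {..n}"
  by (simp add: vol_std_def realization_std_complex)

lemma sets_vol_std: "sets (vol_std n) = sets (borel_complex (std_complex n))"
  by (simp add: vol_std_def)

lemma prob_space_vol_std: "prob_space (vol_std n)"
proof -
  let ?U = "uniform_measure (lebesgue_prod {1..n}) (corner_simplex n)"
  have U: "prob_space ?U"
    using emeasure_corner_simplex by (intro prob_space_uniform_measure) auto
  have "prob_space (restrict_space ?U (corner_simplex n))"
  proof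
    have "emeasure ?U (corner_simplex n) = 1"
      unfolding emeasure_uniform_measure[OF corner_simplex_sets corner_simplex_sets] Int_absorb
      by (rule ennreal_divide_self) (use emeasure_corner_simplex[of n] in \<open>auto simp: less_top\<close>)
    moreover have "corner_simplex n \<subseteq> space ?U"
      using sets.sets_into_space[OF corner_simplex_sets] by simp
    ultimately show "emeasure (restrict_space ?U (corner_simplex n)) (space (restrict_space ?U (corner_simplex n))) = 1"
      by (simp add: emeasure_restrict_space space_restrict_space inf.absorb1 del: One_nat_def)
  qed
  then show ?thesis
    unfolding vol_std_def by (rule prob_space.prob_space_distr[OF _ simplex_chart_measurable_complex])
qed

lemma borel_complex_std_measurable:
  assumes "f \<in> borel_measurable borel"
  shows "f \<in> borel_measurable (borel_complex (std_complex n))"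
proof -
  have "(\<lambda>x. x) \<in> measurable (borel_complex (std_complex n)) borel"
    by (rule continuous_map_measurable_borel_complex)
      (unfold continuous_map_complex_topology_iff, intro ballI continuous_on_id)
  then show ?thesis
    using assms by (rule measurable_compose)
qed

lemma nn_integral_vol_std:
  assumes h: "h \<in> borel_measurable borel"
  shows "(\<integral>\<^sup>+ x. h x \<partial>vol_std n) =
    chart_integral n (\<lambda>x. h x * indicator (geom_simplex {..n}) x) / emeasure (lebesgue_prod {1..n}) (corner_simplex n)"
proof -
  let ?U = "uniform_measure (lebesgue_prod {1..n}) (corner_simplex n)"
  have hc: "(\<lambda>y. h (simplex_chart n y)) \<in> borel_measurable (lebesgue_prod {1..n})"
    using h by (rule measurable_compose[OF simplex_chart_measurable])
  have "(\<integral>\<^sup>+ x. h x \<partial>vol_std n) = (\<integral>\<^sup>+ y. h (simplex_chart n y) \<partial>restrict_space ?U (corner_simplex n))"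
    unfolding vol_std_def
    by (rule nn_integral_distr[OF simplex_chart_measurable_complex]) (use borel_complex_std_measurable[OF h] in simp)
  also have "\<dots> = (\<integral>\<^sup>+ y. h (simplex_chart n y) * indicator (corner_simplex n) y \<partial>?U)"
    using sets.Int_space_eq2[OF corner_simplex_sets, of n]
    by (intro nn_integral_restrict_space) (simp add: corner_simplex_sets del: One_nat_def)
  \<comment> \<open>One indicator comes from \<open>restrict_space\<close>, the other from
    \<open>uniform_measure\<close>.\<close>
  also have "\<dots> = (\<integral>\<^sup>+ y. h (simplex_chart n y) * indicator (corner_simplex n) y * indicator (corner_simplex n) y \<partial>lebesgue_prod {1..n})
      / emeasure (lebesgue_prod {1..n}) (corner_simplex n)"
    by (intro nn_integral_uniform_measure borel_measurable_times_ennreal hc borel_measurable_indicator corner_simplex_sets)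
  also have "(\<integral>\<^sup>+ y. h (simplex_chart n y) * indicator (corner_simplex n) y * indicator (corner_simplex n) y \<partial>lebesgue_prod {1..n})
      = chart_integral n (\<lambda>x. h x * indicator (geom_simplex {..n}) x)"
    unfolding chart_integral_def
    by (intro nn_integral_cong) (auto simp: indicator_def space_PiM simplex_chart_corner)
  finally show ?thesis .
qed

section \<open>Continuous functions and the normalized volume\<close>

lemma continuous_on_indicator_borel:
  fixes h :: "(nat \<Rightarrow> real) \<Rightarrow> real"
  assumes "continuous_on (geom_simplex {..n}) h"
  shows "(\<lambda>x. indicator (geom_simplex {..n}) x * h x) \<in> borel_measurable borel"
  using borel_measurable_continuous_on_indicator[OF _ assms] by simp

lemma continuous_on_permute: "continuous_on A (\<lambda>x. x \<circ> \<pi>)" for \<pi> :: "nat \<Rightarrow> nat" and A :: "(nat \<Rightarrow> real) set"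
  unfolding comp_def
  by (intro continuous_on_coordinatewise_then_product continuous_on_subset[OF continuous_on_product_coordinates]) auto

lemma continuous_on_flag_map: "continuous_on A (flag_map n)"
proof (rule continuous_on_coordinatewise_then_product)
  fix i
  show "continuous_on A (\<lambda>x. flag_map n x i)"
    unfolding flag_map_def
    by (cases "i \<le> n")
      (auto intro!: continuous_intros continuous_on_subset[OF continuous_on_product_coordinates])
qed

text \<open>The simplex is a closed subset of a product of unit intervals, which is compact by
  Tychonoff.\<close>

lemma compact_geom_simplex_nat: "compact (geom_simplex {..n::nat})"
proof -
  have "compact (Pi\<^sub>E UNIV (\<lambda>i::nat. {0..1::real}))"
    using compactin_PiE[of "\<lambda>_. euclidean" UNIV "\<lambda>i::nat. {0..1::real}"]
    by (simp add: euclidean_product_topology)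
  moreover have "geom_simplex {..n} \<subseteq> Pi\<^sub>E UNIV (\<lambda>i::nat. {0..1::real})"
  proof
    fix x assume x: "x \<in> geom_simplex {..n}"
    have "x i \<le> 1" for i
    proof (cases "i \<le> n")
      case True
      then have "x i \<le> (\<Sum>i\<le>n. x i)"
        using x by (intro member_le_sum) (auto simp: geom_simplex_def)
      then show ?thesis
        using x by (simp add: geom_simplex_def)
    qed (use x in \<open>auto simp: geom_simplex_def\<close>)
    then show "x \<in> Pi\<^sub>E UNIV (\<lambda>i::nat. {0..1::real})"
      using x by (auto simp: geom_simplex_def)
  qed
  ultimately show ?thesis
    using geom_simplex_nat_closed by (metis compact_Int_closed inf.absorb2)
qed

lemma integrable_vol_std:
  fixes h :: "(nat \<Rightarrow> real) \<Rightarrow> real"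
  assumes h: "continuous_on (geom_simplex {..n}) h"
  shows "integrable (vol_std n) h"
proof -
  have "bounded (h ` geom_simplex {..n})"
    using compact_continuous_image[OF h compact_geom_simplex_nat] compact_imp_bounded by blast
  then obtain B where B: "\<And>x. x \<in> geom_simplex {..n} \<Longrightarrow> norm (h x) \<le> B"
    by (auto simp: bounded_iff)
  have "continuous_on (geom_simplex s) h" if "s \<in> std_complex n" for s
    using that continuous_on_subset[OF h] realization_std_complex[of n] by (auto simp: realization_def)
  then have "h \<in> borel_measurable (borel_complex (std_complex n))"
    by (intro continuous_map_measurable_borel_complex) (simp add: continuous_map_complex_topology_iff)
  then have "h \<in> borel_measurable (vol_std n)"
    using measurable_cong_sets[OF sets_vol_std refl] by blast
  then show ?thesis
    using B prob_space_vol_std[of n]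
    by (intro finite_measure.integrable_const_bound[where B = B] AE_I2)
      (auto simp: space_vol_std prob_space.finite_measure)
qed

text \<open>\<open>h\<close> is controlled on the simplex only. Cutting it off by the indicator
  yields a Borel function on the whole space, as the substitution rules for
  \<open>chart_integral\<close> require.\<close>

lemma ennreal_integral_vol_std:
  fixes h :: "(nat \<Rightarrow> real) \<Rightarrow> real"
  assumes h: "continuous_on (geom_simplex {..n}) h" and nonneg: "\<And>x. x \<in> geom_simplex {..n} \<Longrightarrow> 0 \<le> h x"
  shows "ennreal (\<integral>x. h x \<partial>vol_std n) =
    chart_integral n (\<lambda>x. ennreal (indicator (geom_simplex {..n}) x * h x) * indicator (geom_simplex {..n}) x)
      / emeasure (lebesgue_prod {1..n}) (corner_simplex n)"
proof -
  have "ennreal (\<integral>x. h x \<partial>vol_std n) = (\<integral>\<^sup>+ x. ennreal (h x) \<partial>vol_std n)"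
    using integrable_vol_std[OF h] nonneg
    by (intro nn_integral_eq_integral[symmetric] AE_I2) (auto simp: space_vol_std)
  also have "\<dots> = (\<integral>\<^sup>+ x. ennreal (indicator (geom_simplex {..n}) x * h x) \<partial>vol_std n)"
    by (intro nn_integral_cong) (simp add: space_vol_std)
  also have "\<dots> = chart_integral n (\<lambda>x. ennreal (indicator (geom_simplex {..n}) x * h x) * indicator (geom_simplex {..n}) x)
      / emeasure (lebesgue_prod {1..n}) (corner_simplex n)"
    by (intro nn_integral_vol_std measurable_compose[OF continuous_on_indicator_borel[OF h] measurable_ennreal])
  finally show ?thesis .
qed

lemma permute_geom_simplex_subset:
  "\<pi> permutes {..n::nat} \<Longrightarrow> (\<lambda>x. x \<circ> \<pi>) ` geom_simplex {..n} \<subseteq> geom_simplex {..n}"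
  by (auto simp: geom_simplex_permute)

text \<open>The substitution rules concern nonnegative integrals. Adding a bound \<open>B\<close> of
  the absolute value makes \<open>h\<close> nonnegative on the simplex, and since
  \<open>vol_std\<close> has mass \<open>1\<close>, both sides grow by exactly
  \<open>B\<close>.\<close>

lemma integral_vol_std_reduce_nonneg:
  fixes h :: "(nat \<Rightarrow> real) \<Rightarrow> real" and g :: "'i \<Rightarrow> (nat \<Rightarrow> real) \<Rightarrow> nat \<Rightarrow> real"
  assumes *: "\<And>h. continuous_on (geom_simplex {..n}) h \<Longrightarrow> (\<And>x. x \<in> geom_simplex {..n} \<Longrightarrow> 0 \<le> h x) \<Longrightarrow>
      (\<integral>x. h x \<partial>vol_std n) = (\<Sum>i\<in>I. (\<integral>x. h (g i x) \<partial>vol_std n)) / real (card I)"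
    and g: "\<And>i. i \<in> I \<Longrightarrow> continuous_on (geom_simplex {..n}) (g i)"
      "\<And>i. i \<in> I \<Longrightarrow> g i ` geom_simplex {..n} \<subseteq> geom_simplex {..n}"
    and I: "finite I" "I \<noteq> {}"
    and h: "continuous_on (geom_simplex {..n}) h"
  shows "(\<integral>x. h x \<partial>vol_std n) = (\<Sum>i\<in>I. (\<integral>x. h (g i x) \<partial>vol_std n)) / real (card I)"
proof -
  interpret prob_space "vol_std n"
    by (rule prob_space_vol_std)
  have "bounded (h ` geom_simplex {..n})"
    using compact_continuous_image[OF h compact_geom_simplex_nat] compact_imp_bounded by blast
  then obtain B where B: "\<And>x. x \<in> geom_simplex {..n} \<Longrightarrow> norm (h x) \<le> B"
    by (auto simp: bounded_iff)
  have shift: "(\<integral>x. k x + B \<partial>vol_std n) = (\<integral>x. k x \<partial>vol_std n) + B"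
    if "continuous_on (geom_simplex {..n}) k" for k
    using integrable_vol_std[OF that] by (simp add: prob_space)
  have hg: "continuous_on (geom_simplex {..n}) (\<lambda>x. h (g i x))" if "i \<in> I" for i
    using continuous_on_compose2[OF h g(1)[OF that] g(2)[OF that]] .
  have "(\<integral>x. h x + B \<partial>vol_std n) = (\<Sum>i\<in>I. (\<integral>x. h (g i x) + B \<partial>vol_std n)) / real (card I)"
    using h B by (intro *[of "\<lambda>x. h x + B"] continuous_intros) (fastforce simp: abs_le_iff)+
  also have "(\<Sum>i\<in>I. (\<integral>x. h (g i x) + B \<partial>vol_std n)) = (\<Sum>i\<in>I. (\<integral>x. h (g i x) \<partial>vol_std n)) + real (card I) * B"
    using hg by (simp add: shift sum.distrib)
  finally show ?thesis
    using I by (simp add: shift[OF h] add_divide_distrib)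
qed

lemma integral_vol_std_permute:
  fixes h :: "(nat \<Rightarrow> real) \<Rightarrow> real"
  assumes \<pi>: "\<pi> permutes {..n}" and h: "continuous_on (geom_simplex {..n}) h"
  shows "(\<integral>x. h (x \<circ> \<pi>) \<partial>vol_std n) = (\<integral>x. h x \<partial>vol_std n)"
proof -
  \<comment> \<open>Invariance is written as an average over a one-element family, in order to reuse
    the reduction to nonnegative functions.\<close>
  have "(\<integral>x. h x \<partial>vol_std n) = (\<Sum>i\<in>{()}. (\<integral>x. h (x \<circ> \<pi>) \<partial>vol_std n)) / real (card {()})"
  proof (rule integral_vol_std_reduce_nonneg)
    fix h :: "(nat \<Rightarrow> real) \<Rightarrow> real"
    assume h: "continuous_on (geom_simplex {..n}) h" and nonneg: "\<And>x. x \<in> geom_simplex {..n} \<Longrightarrow> 0 \<le> h x"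
    have h\<pi>: "continuous_on (geom_simplex {..n}) (\<lambda>x. h (x \<circ> \<pi>))"
      using continuous_on_compose2[OF h continuous_on_permute permute_geom_simplex_subset[OF \<pi>]] .
    let ?F = "\<lambda>x. ennreal (indicator (geom_simplex {..n}) x * h x) * indicator (geom_simplex {..n}) x"
    have "?F \<in> borel_measurable borel"
      using measurable_compose[OF continuous_on_indicator_borel[OF h] measurable_ennreal] by measurable
    then have "chart_integral n (\<lambda>x. ?F (x \<circ> \<pi>)) = chart_integral n ?F"
      by (rule chart_integral_permute[OF \<pi>])
    then have "ennreal (\<integral>x. h (x \<circ> \<pi>) \<partial>vol_std n) = ennreal (\<integral>x. h x \<partial>vol_std n)"
      using nonneg by (simp add: ennreal_integral_vol_std[OF h] ennreal_integral_vol_std[OF h\<pi>]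
          geom_simplex_permute[OF \<pi>] indicator_def)
    moreover have "0 \<le> (\<integral>x. h (x \<circ> \<pi>) \<partial>vol_std n)" "0 \<le> (\<integral>x. h x \<partial>vol_std n)"
      using nonneg geom_simplex_permute[OF \<pi>] by (auto intro!: Bochner_Integration.integral_nonneg simp: space_vol_std)
    ultimately show "(\<integral>x. h x \<partial>vol_std n) = (\<Sum>i\<in>{()}. (\<integral>x. h (x \<circ> \<pi>) \<partial>vol_std n)) / real (card {()})"
      by simp
  qed (use h \<pi> in \<open>auto intro!: continuous_on_permute simp: geom_simplex_permute\<close>)
  then show ?thesis
    by simp
qed

text \<open>The maps composed with \<open>h\<close> parametrize the cells of the barycentric
  subdivision by the whole simplex. That all of them get the same weight is the equality of the
  volumes of the cells.\<close>

lemma integral_vol_std_subdivide: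
  fixes h :: "(nat \<Rightarrow> real) \<Rightarrow> real"
  assumes h: "continuous_on (geom_simplex {..n}) h"
  shows "(\<integral>x. h x \<partial>vol_std n) =
    (\<Sum>\<pi> | \<pi> permutes {..n}. (\<integral>x. h (flag_map n x \<circ> inv \<pi>) \<partial>vol_std n)) / fact (n + 1)"
proof -
  let ?P = "{\<pi>. \<pi> permutes {..n}}"
  have card: "card ?P = fact (n + 1)"
    by (subst card_permutations) auto
  have flag: "flag_map n x \<circ> inv \<pi> \<in> geom_simplex {..n}" if "\<pi> permutes {..n}" "x \<in> geom_simplex {..n}" for \<pi> x
    using that by (simp add: geom_simplex_permute permutes_inv flag_map_geom_simplex)
  have cont: "continuous_on A (\<lambda>x. flag_map n x \<circ> inv \<pi>)" for A and \<pi> :: "nat \<Rightarrow> nat"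
    using continuous_on_compose2[OF continuous_on_permute continuous_on_flag_map subset_UNIV] .
  have "(\<integral>x. h x \<partial>vol_std n) = (\<Sum>\<pi>\<in>?P. (\<integral>x. h (flag_map n x \<circ> inv \<pi>) \<partial>vol_std n)) / real (card ?P)"
  proof (rule integral_vol_std_reduce_nonneg)
    fix h :: "(nat \<Rightarrow> real) \<Rightarrow> real"
    assume h: "continuous_on (geom_simplex {..n}) h" and nonneg: "\<And>x. x \<in> geom_simplex {..n} \<Longrightarrow> 0 \<le> h x"
    let ?D = "geom_simplex {..n}" and ?c = "emeasure (lebesgue_prod {1..n}) (corner_simplex n)"
    have hf: "continuous_on ?D (\<lambda>x. h (flag_map n x \<circ> inv \<pi>))" if "\<pi> permutes {..n}" for \<pi>
      using continuous_on_compose2[OF h cont] flag[OF that] by blast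
    have nn: "0 \<le> (\<integral>x. h (flag_map n x \<circ> inv \<pi>) \<partial>vol_std n)" if "\<pi> permutes {..n}" for \<pi>
      using nonneg flag[OF that] by (intro Bochner_Integration.integral_nonneg) (auto simp: space_vol_std)
    let ?F = "\<lambda>x. ennreal (indicator ?D x * h x)"
    have F: "?F \<in> borel_measurable borel"
      using measurable_compose[OF continuous_on_indicator_borel[OF h] measurable_ennreal] .
    have "ennreal (\<integral>x. h x \<partial>vol_std n) = chart_integral n (\<lambda>x. ?F x * indicator ?D x) / ?c"
      by (rule ennreal_integral_vol_std[OF h nonneg])
    also have "chart_integral n (\<lambda>x. ?F x * indicator ?D x)
        = ennreal (1 / fact (n + 1)) * (\<Sum>\<pi>\<in>?P. chart_integral n (\<lambda>x. ?F (flag_map n x \<circ> inv \<pi>) * indicator ?D x))"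
      by (rule chart_integral_subdivide[OF F])
    also have "\<dots> / ?c = ennreal (1 / fact (n + 1)) *
        (\<Sum>\<pi>\<in>?P. chart_integral n (\<lambda>x. ?F (flag_map n x \<circ> inv \<pi>) * indicator ?D x) / ?c)"
      by (simp only: ennreal_times_divide[symmetric] divide_ennreal_def sum_distrib_right mult.assoc)
    also have "(\<Sum>\<pi>\<in>?P. chart_integral n (\<lambda>x. ?F (flag_map n x \<circ> inv \<pi>) * indicator ?D x) / ?c)
        = (\<Sum>\<pi>\<in>?P. ennreal (\<integral>x. h (flag_map n x \<circ> inv \<pi>) \<partial>vol_std n))"
    proof (rule sum.cong)
      fix \<pi> assume "\<pi> \<in> ?P"
      then have \<pi>: "\<pi> permutes {..n}"
        by simp
      have "ennreal (\<integral>x. h (flag_map n x \<circ> inv \<pi>) \<partial>vol_std n)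
          = chart_integral n (\<lambda>x. ennreal (indicator ?D x * h (flag_map n x \<circ> inv \<pi>)) * indicator ?D x) / ?c"
        using nonneg flag[OF \<pi>] by (intro ennreal_integral_vol_std[OF hf[OF \<pi>]]) auto
      also have "(\<lambda>x. ennreal (indicator ?D x * h (flag_map n x \<circ> inv \<pi>)) * indicator ?D x)
          = (\<lambda>x. ?F (flag_map n x \<circ> inv \<pi>) * indicator ?D x)"
        using flag[OF \<pi>] by (auto simp: indicator_def)
      finally show "chart_integral n (\<lambda>x. ?F (flag_map n x \<circ> inv \<pi>) * indicator ?D x) / ?c
          = ennreal (\<integral>x. h (flag_map n x \<circ> inv \<pi>) \<partial>vol_std n)"
        by (rule sym)
    qed simp
    also have "\<dots> = ennreal (\<Sum>\<pi>\<in>?P. (\<integral>x. h (flag_map n x \<circ> inv \<pi>) \<partial>vol_std n))"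
      using nn by (intro sum_ennreal) auto
    also have "ennreal (1 / fact (n + 1)) * \<dots>
        = ennreal ((\<Sum>\<pi>\<in>?P. (\<integral>x. h (flag_map n x \<circ> inv \<pi>) \<partial>vol_std n)) / real (card ?P))"
      using nn unfolding card by (subst ennreal_mult[symmetric]) (auto intro!: sum_nonneg simp: distrib_right)
    finally have "ennreal (\<integral>x. h x \<partial>vol_std n)
        = ennreal ((\<Sum>\<pi>\<in>?P. (\<integral>x. h (flag_map n x \<circ> inv \<pi>) \<partial>vol_std n)) / real (card ?P))" .
    moreover have "0 \<le> (\<integral>x. h x \<partial>vol_std n)"
      using nonneg by (intro Bochner_Integration.integral_nonneg) (simp add: space_vol_std)
    moreover have "0 \<le> (\<Sum>\<pi>\<in>?P. (\<integral>x. h (flag_map n x \<circ> inv \<pi>) \<partial>vol_std n)) / real (card ?P)"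
      using nn by (intro divide_nonneg_nonneg sum_nonneg) auto
    ultimately show "(\<integral>x. h x \<partial>vol_std n) = (\<Sum>\<pi>\<in>?P. (\<integral>x. h (flag_map n x \<circ> inv \<pi>) \<partial>vol_std n)) / real (card ?P)"
      by (simp only: ennreal_inj)
  next
    show "finite ?P"
      by (simp add: finite_permutations)
    show "?P \<noteq> {}"
      using permutes_id by blast
  qed (use h cont flag in auto)
  then show ?thesis
    unfolding card by (simp only: of_nat_fact)
qed

section \<open>Geometric simplicial complexes\<close>

definition chain_set :: "'v set set \<Rightarrow> bool" where
  "chain_set C \<longleftrightarrow> (\<forall>s\<in>C. \<forall>t\<in>C. s \<subseteq> t \<or> t \<subseteq> s)"

lemma chain_set_subset: "chain_set C \<Longrightarrow> D \<subseteq> C \<Longrightarrow> chain_set D"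
  by (auto simp: chain_set_def)

lemma Union_chain_mem:
  assumes "finite C" "C \<noteq> {}" "chain_set C"
  shows "\<Union>C \<in> C"
  using assms
proof (induction C rule: finite_ne_induct)
  case (insert s C)
  then have "\<Union>C \<in> C"
    using chain_set_subset[OF insert.prems] by blast
  then have "s \<subseteq> \<Union>C \<or> \<Union>C \<subseteq> s"
    using insert.prems by (auto simp: chain_set_def)
  then show ?case
    using \<open>\<Union>C \<in> C\<close> by (auto simp: Un_absorb1 Un_absorb2)
qed simp

text \<open>The points where the sums are positive form the union of the chain, which is its largest
  member; so both chains have the same largest member. Once its weights are shown to agree, it is
  removed from both chains.\<close>

lemma chain_weights_unique:
  fixes v v' :: "'v set \<Rightarrow> real"
  assumes "finite C" "finite C'" "chain_set C" "chain_set C'" "{} \<notin> C" "{} \<notin> C'"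
    and "\<And>c. c \<in> C \<Longrightarrow> 0 < v c" "\<And>c. c \<in> C' \<Longrightarrow> 0 < v' c"
    and "\<And>x. (\<Sum>c | c \<in> C \<and> x \<in> c. v c) = (\<Sum>c | c \<in> C' \<and> x \<in> c. v' c)"
  shows "C = C' \<and> (\<forall>c\<in>C. v c = v' c)"
  using assms
proof (induction "card C" arbitrary: C C')
  case 0
  have "C' = {}"
  proof (rule ccontr)
    assume "C' \<noteq> {}"
    then obtain c where c: "c \<in> C'"
      by blast
    then obtain x where "x \<in> c"
      using "0.prems"(6) by (metis ex_in_conv)
    then have "0 < (\<Sum>c | c \<in> C' \<and> x \<in> c. v' c)"
      using c 0 by (intro sum_pos) auto
    then show False
      using "0.prems"(1) "0.prems"(9)[of x] "0.hyps" by simp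
  qed
  then show ?case
    using "0.prems"(1) "0.hyps" by simp
next
  case (Suc k)
  have supp: "(0 < (\<Sum>c | c \<in> C \<and> x \<in> c. v c)) \<longleftrightarrow> x \<in> \<Union>C"
    if "finite C" "\<And>c. c \<in> C \<Longrightarrow> 0 < v c" for C and v :: "'v set \<Rightarrow> real" and x
  proof
    assume "x \<in> \<Union>C"
    then show "0 < (\<Sum>c | c \<in> C \<and> x \<in> c. v c)"
      using that by (intro sum_pos) auto
  next
    assume pos: "0 < (\<Sum>c | c \<in> C \<and> x \<in> c. v c)"
    show "x \<in> \<Union>C"
    proof (rule ccontr)
      assume "x \<notin> \<Union>C"
      then have "{c. c \<in> C \<and> x \<in> c} = {}"
        by blast
      then show False
        using pos by (simp only: sum.empty less_irrefl)
    qed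
  qed
  have U: "\<Union>C = \<Union>C'"
  proof -
    have "x \<in> \<Union>C \<longleftrightarrow> x \<in> \<Union>C'" for x
    proof -
      have "(0 < (\<Sum>c | c \<in> C \<and> x \<in> c. v c)) \<longleftrightarrow> x \<in> \<Union>C"
        by (rule supp) (use Suc.prems(1,7) in auto)
      moreover have "(0 < (\<Sum>c | c \<in> C' \<and> x \<in> c. v' c)) \<longleftrightarrow> x \<in> \<Union>C'"
        by (rule supp) (use Suc.prems(2,8) in auto)
      ultimately show ?thesis
        using Suc.prems(9)[of x] by argo
    qed
    then show ?thesis
      by blast
  qed
  define \<rho> where "\<rho> = \<Union>C"
  have "C \<noteq> {}"
    using Suc.hyps(2) by auto
  then have \<rho>: "\<rho> \<in> C" "\<rho> \<noteq> {}"
    using Union_chain_mem[OF Suc.prems(1) \<open>C \<noteq> {}\<close> Suc.prems(3)] Suc.prems(5) unfolding \<rho>_def by metis+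
  have "C' \<noteq> {}"
    using \<rho>(2) U by (auto simp: \<rho>_def)
  then have \<rho>': "\<rho> \<in> C'"
    using Union_chain_mem[OF Suc.prems(2) \<open>C' \<noteq> {}\<close> Suc.prems(4)] U unfolding \<rho>_def by metis
  \<comment> \<open>A point of \<open>\<rho>\<close> outside the next smaller member of
    \<open>C\<close> sees only the weight of \<open>\<rho>\<close> in \<open>C\<close>, but possibly
    more in \<open>C'\<close>. So each chain provides one inequality, and the roles are then
    exchanged.\<close>
  have bound: "v' \<rho> \<le> v \<rho>"
    if C: "finite C" "chain_set C" "\<And>c. c \<in> C \<Longrightarrow> 0 < v c" "\<rho> \<in> C" "\<And>c. c \<in> C \<Longrightarrow> c \<subseteq> \<rho>"
      and C': "finite C'" "\<And>c. c \<in> C' \<Longrightarrow> 0 < v' c" "\<rho> \<in> C'"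
      and eq: "\<And>x. (\<Sum>c | c \<in> C \<and> x \<in> c. v c) = (\<Sum>c | c \<in> C' \<and> x \<in> c. v' c)"
    for C C' and v v' :: "'v set \<Rightarrow> real"
  proof -
    have "\<exists>x\<in>\<rho>. x \<notin> \<Union>(C - {\<rho>})"
    proof (cases "C - {\<rho>} = {}")
      case False
      have "\<Union>(C - {\<rho>}) \<in> C - {\<rho>}"
        using C False by (intro Union_chain_mem) (auto intro: chain_set_subset)
      then show ?thesis
        using C(5) by blast
    qed (use \<rho>(2) in auto)
    then obtain x where x: "x \<in> \<rho>" "x \<notin> \<Union>(C - {\<rho>})"
      by blast
    then have "{c. c \<in> C \<and> x \<in> c} = {\<rho>}"
      using C(4) by blast
    then have "v \<rho> = (\<Sum>c | c \<in> C' \<and> x \<in> c. v' c)"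
      using eq[of x] by simp
    moreover have "v' \<rho> \<le> (\<Sum>c | c \<in> C' \<and> x \<in> c. v' c)"
      using C' x by (intro member_le_sum) (auto intro: less_imp_le)
    ultimately show ?thesis
      by simp
  qed
  have "v' \<rho> \<le> v \<rho>"
    by (rule bound[of C v C' v']) (use Suc.prems \<rho> \<rho>' in \<open>auto simp: \<rho>_def\<close>)
  moreover have "v \<rho> \<le> v' \<rho>"
    by (rule bound[of C' v' C v]) (use Suc.prems \<rho> \<rho>' U in \<open>auto simp: \<rho>_def\<close>)
  ultimately have v: "v \<rho> = v' \<rho>"
    by simp
  have "C - {\<rho>} = C' - {\<rho>} \<and> (\<forall>c\<in>C - {\<rho>}. v c = v' c)"
  proof (rule Suc.hyps(1))
    show "k = card (C - {\<rho>})"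
      using Suc.hyps(2) \<rho>(1) Suc.prems(1) by simp
    fix x
    have remove: "(\<Sum>c | c \<in> C - {\<rho>} \<and> x \<in> c. v c) = (\<Sum>c | c \<in> C \<and> x \<in> c. v c) - (if x \<in> \<rho> then v \<rho> else 0)"
      if "finite C" "\<rho> \<in> C" for C and v :: "'v set \<Rightarrow> real"
    proof (cases "x \<in> \<rho>")
      case True
      then have "{c. c \<in> C \<and> x \<in> c} = insert \<rho> {c. c \<in> C - {\<rho>} \<and> x \<in> c}"
        using that by blast
      then show ?thesis
        using True that by simp
    next
      case False
      then have "{c. c \<in> C \<and> x \<in> c} = {c. c \<in> C - {\<rho>} \<and> x \<in> c}"
        using that by blast
      then show ?thesis
        using False by simp
    qed
    show "(\<Sum>c | c \<in> C - {\<rho>} \<and> x \<in> c. v c) = (\<Sum>c | c \<in> C' - {\<rho>} \<and> x \<in> c. v' c)"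
      using Suc.prems \<rho> \<rho>' v by (simp only: remove)
  qed (use Suc.prems in \<open>auto intro: chain_set_subset\<close>)
  then show ?case
    using v \<rho>(1) \<rho>' by blast
qed

section \<open>Unique representation by positive combinations\<close>

definition combination :: "('a \<Rightarrow> real) set \<Rightarrow> (('a \<Rightarrow> real) \<Rightarrow> real) \<Rightarrow> 'a \<Rightarrow> real" where
  "combination s w = (\<lambda>v. \<Sum>x\<in>s. w x * x v)"

text \<open>The interiors of the cones over the simplices are disjoint and every cone is simplicial; in
  particular the simplices are affinely independent. Dropping the normalization of the weights
  costs nothing and simplifies the induction over subdivisions.\<close>

definition geometric_complex :: "('a \<Rightarrow> real) set set \<Rightarrow> bool" where
  "geometric_complex L \<longleftrightarrow> abstract_complex L \<and>
     (\<forall>s\<in>L. \<forall>t\<in>L. \<forall>w w'. (\<forall>x\<in>s. 0 < w x) \<and> (\<forall>x\<in>t. 0 < w' x) \<and> combination s w = combination t w'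
        \<longrightarrow> s = t \<and> (\<forall>x\<in>s. w x = w' x))"

lemma geometric_complexD:
  assumes "geometric_complex L" "s \<in> L" "t \<in> L"
    and "\<And>x. x \<in> s \<Longrightarrow> 0 < w x" "\<And>x. x \<in> t \<Longrightarrow> 0 < w' x" "combination s w = combination t w'"
  shows "s = t \<and> (\<forall>x\<in>s. w x = w' x)"
  using assms unfolding geometric_complex_def by blast

lemma geometric_complex_simplex:
  assumes "geometric_complex L" "s \<in> L"
  shows "finite s" "s \<noteq> {}" "t \<subseteq> s \<Longrightarrow> t \<noteq> {} \<Longrightarrow> t \<in> L"
  using assms unfolding geometric_complex_def abstract_complex_def by blast+

lemma barycenter_eq_combination: "barycenter s = combination s (\<lambda>_. 1 / real (card s))"
  by (simp add: barycenter_def combination_def sum_divide_distrib)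

text \<open>A barycenter is a combination with positive weights, and such a combination determines
  its simplex.\<close>

lemma inj_on_barycenter:
  assumes "geometric_complex L"
  shows "inj_on barycenter L"
proof (rule inj_onI)
  fix s t assume st: "s \<in> L" "t \<in> L" "barycenter s = barycenter t"
  have "s = t \<and> (\<forall>x\<in>s. 1 / real (card s) = 1 / real (card t))"
    using st geometric_complex_simplex[OF assms]
    by (intro geometric_complexD[OF assms]) (auto simp: barycenter_eq_combination card_gt_0_iff)
  then show "s = t"
    by blast
qed

text \<open>The weight of a barycenter is shared equally among the vertices of its simplex. The
  total share of a vertex is a sum over the chain members containing it, which is the form that
  \<open>chain_weights_unique\<close> can invert.\<close>

lemma combination_barycenters:
  assumes C: "finite C" "inj_on barycenter C" "\<And>c. c \<in> C \<Longrightarrow> finite c"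
  shows "combination (barycenter ` C) w
    = combination (\<Union>C) (\<lambda>x. \<Sum>c | c \<in> C \<and> x \<in> c. w (barycenter c) / real (card c))"
proof
  fix v
  have fin: "finite (\<Union>C)"
    using C by blast
  have "combination (barycenter ` C) w v = (\<Sum>c\<in>C. w (barycenter c) * barycenter c v)"
    by (simp add: combination_def sum.reindex[OF C(2)])
  also have "\<dots> = (\<Sum>c\<in>C. \<Sum>x\<in>c. w (barycenter c) / real (card c) * x v)"
    by (simp add: barycenter_def sum_distrib_left sum_divide_distrib)
  also have "\<dots> = (\<Sum>c\<in>C. \<Sum>x | x \<in> \<Union>C \<and> x \<in> c. w (barycenter c) / real (card c) * x v)"
    by (intro sum.cong) auto
  also have "\<dots> = (\<Sum>x\<in>\<Union>C. \<Sum>c | c \<in> C \<and> x \<in> c. w (barycenter c) / real (card c) * x v)"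
    using C(1) fin by (rule sum.swap_restrict)
  also have "\<dots> = combination (\<Union>C) (\<lambda>x. \<Sum>c | c \<in> C \<and> x \<in> c. w (barycenter c) / real (card c)) v"
    by (simp add: combination_def sum_distrib_right)
  finally show "combination (barycenter ` C) w v
      = combination (\<Union>C) (\<lambda>x. \<Sum>c | c \<in> C \<and> x \<in> c. w (barycenter c) / real (card c)) v" .
qed

lemma mem_subdivision:
  "\<tau> \<in> subdivision L \<longleftrightarrow> (\<exists>C. \<tau> = barycenter ` C \<and> C \<subseteq> L \<and> finite C \<and> C \<noteq> {} \<and> chain_set C)"
  unfolding subdivision_def chain_set_def by blast

text \<open>In terms of the old vertices, a positive combination of the barycenters of a chain is a
  positive combination over the largest member of the chain. Uniqueness in \<open>L\<close> yields
  this member and its vertex weights, from which the chain and its weights are recovered.\<close>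

lemma geometric_complex_subdivision:
  assumes L: "geometric_complex L"
  shows "geometric_complex (subdivision L)"
  unfolding geometric_complex_def
proof (intro conjI ballI allI impI)
  show "abstract_complex (subdivision L)"
    unfolding abstract_complex_def
  proof (intro ballI conjI allI impI)
    fix \<tau> assume \<tau>: "\<tau> \<in> subdivision L"
    then obtain C where C: "\<tau> = barycenter ` C" "C \<subseteq> L" "finite C" "C \<noteq> {}" "chain_set C"
      by (auto simp: mem_subdivision)
    then show "finite \<tau>" "\<tau> \<noteq> {}"
      by auto
    fix t assume t: "t \<subseteq> \<tau> \<and> t \<noteq> {}"
    then obtain D where D: "t = barycenter ` D" "D \<subseteq> C"
      using C(1) by (meson subset_imageE)
    then show "t \<in> subdivision L"
      using C t unfolding mem_subdivision by (intro exI[of _ D]) (auto intro: finite_subset chain_set_subset)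
  qed
next
  fix \<sigma> \<tau> w w'
  assume \<sigma>: "\<sigma> \<in> subdivision L" and \<tau>: "\<tau> \<in> subdivision L"
    and *: "(\<forall>x\<in>\<sigma>. 0 < w x) \<and> (\<forall>x\<in>\<tau>. 0 < w' x) \<and> combination \<sigma> w = combination \<tau> w'"
  obtain C where C: "\<sigma> = barycenter ` C" "C \<subseteq> L" "finite C" "C \<noteq> {}" "chain_set C"
    using \<sigma> by (auto simp: mem_subdivision)
  obtain D where D: "\<tau> = barycenter ` D" "D \<subseteq> L" "finite D" "D \<noteq> {}" "chain_set D"
    using \<tau> by (auto simp: mem_subdivision)
  define u where "u C w x = (\<Sum>c | c \<in> C \<and> x \<in> c. w (barycenter c) / real (card c))"
    for C w and x :: "'a \<Rightarrow> real"
  have u0: "u C w x = 0" if "x \<notin> \<Union>C" for C w x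
  proof -
    have "{c. c \<in> C \<and> x \<in> c} = {}"
      using that by blast
    then show ?thesis
      unfolding u_def by (simp only: sum.empty)
  qed
  have comb: "combination (barycenter ` C) w = combination (\<Union>C) (u C w)"
    if "C \<subseteq> L" "finite C" for C w
    unfolding u_def using that inj_on_subset[OF inj_on_barycenter[OF L]] geometric_complex_simplex[OF L]
    by (intro combination_barycenters) auto
  have pos: "0 < w (barycenter c) / real (card c)"
    if "c \<in> C" "C \<subseteq> L" "\<forall>x\<in>barycenter ` C. 0 < w x" for c C w
  proof -
    have "c \<in> L"
      using that by blast
    then show ?thesis
      using that geometric_complex_simplex(1,2)[OF L, of c] by (simp add: card_gt_0_iff)
  qed
  have upos: "0 < u C w x" if "x \<in> \<Union>C" "C \<subseteq> L" "finite C" "\<forall>x\<in>barycenter ` C. 0 < w x" for C w x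
    unfolding u_def using that pos by (intro sum_pos) auto
  have "\<Union>C \<in> L" "\<Union>D \<in> L"
    using Union_chain_mem C D by blast+
  then have UCD: "\<Union>C = \<Union>D \<and> (\<forall>x\<in>\<Union>C. u C w x = u D w' x)"
    using C D * upos comb by (intro geometric_complexD[OF L]) auto
  \<comment> \<open>\<open>chain_weights_unique\<close> asks for equality at every point; off the
    common union both sides are empty sums.\<close>
  then have "u C w x = u D w' x" for x
  proof (cases "x \<in> \<Union>C")
    case False
    then show ?thesis
      using u0[OF False] u0[of x D w'] UCD by metis
  qed (use UCD in blast)
  moreover have "{} \<notin> C" "{} \<notin> D"
    using C(2) D(2) geometric_complex_simplex(2)[OF L] by blast+
  ultimately have CD: "C = D \<and> (\<forall>c\<in>C. w (barycenter c) / real (card c) = w' (barycenter c) / real (card c))"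
    using C D * pos by (intro chain_weights_unique) (auto simp: u_def)
  moreover have "real (card c) \<noteq> 0" if "c \<in> C" for c
  proof -
    have "c \<in> L"
      using that C(2) by blast
    then show ?thesis
      using geometric_complex_simplex(1,2)[OF L, of c] by simp
  qed
  ultimately show "\<sigma> = \<tau>" "\<And>x. x \<in> \<sigma> \<Longrightarrow> w x = w' x"
    unfolding C(1) D(1) by (metis, fastforce)
qed

lemma inj_vertex_point: "inj vertex_point"
  by (auto simp: vertex_point_def inj_def fun_eq_iff indicator_def split: if_splits)

lemma geometric_complex_Sd:
  assumes K: "abstract_complex K"
  shows "geometric_complex (Sd d K)"
proof (induction d)
  case 0
  note inj = inj_vertex_point
  have abs: "abstract_complex ((`) vertex_point ` K)"
    unfolding abstract_complex_def
  proof (intro ballI conjI allI impI)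
    fix \<tau> assume "\<tau> \<in> (`) vertex_point ` K"
    then obtain s where s: "s \<in> K" "\<tau> = vertex_point ` s"
      by blast
    then show "finite \<tau>" "\<tau> \<noteq> {}"
      using K by (auto simp: abstract_complex_def)
    fix t assume t: "t \<subseteq> \<tau> \<and> t \<noteq> {}"
    then obtain r where r: "t = vertex_point ` r" "r \<subseteq> s"
      using s by (meson subset_imageE)
    moreover have "r \<noteq> {}"
      using r t by blast
    ultimately have "r \<in> K"
      using K s(1) unfolding abstract_complex_def by blast
    then show "t \<in> (`) vertex_point ` K"
      using r by blast
  qed
  have comb: "combination (vertex_point ` s) w v = (if v \<in> s then w (vertex_point v) else 0)"
    if "s \<in> K" for s w v
  proof -
    have "finite s"
      using that K by (simp add: abstract_complex_def)
    have "combination (vertex_point ` s) w v = (\<Sum>a\<in>s. if a = v then w (vertex_point v) else 0)"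
      unfolding combination_def by (subst sum.reindex[OF inj_on_subset[OF inj subset_UNIV]], intro sum.cong)
        (auto simp: vertex_point_def)
    then show ?thesis
      using \<open>finite s\<close> by simp
  qed
  have "s = t \<and> (\<forall>x\<in>vertex_point ` s. w x = w' x)"
    if "s \<in> K" "t \<in> K" and w: "\<forall>x\<in>vertex_point ` s. 0 < w x" "\<forall>x\<in>vertex_point ` t. 0 < w' x"
      and eq: "combination (vertex_point ` s) w = combination (vertex_point ` t) w'" for s t w w'
  proof -
    have *: "(if v \<in> s then w (vertex_point v) else 0) = (if v \<in> t then w' (vertex_point v) else 0)" for v
      using fun_cong[OF eq, of v, unfolded comb[OF that(1)] comb[OF that(2)]] .
    have "v \<in> s \<longleftrightarrow> v \<in> t" for v
      using *[of v] w by (auto split: if_splits)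
    then have "s = t"
      by blast
    then show ?thesis
      using * by (metis imageE)
  qed
  note main = this
  have "\<sigma> = \<tau> \<and> (\<forall>x\<in>\<sigma>. w x = w' x)"
    if st: "\<sigma> \<in> (`) vertex_point ` K" "\<tau> \<in> (`) vertex_point ` K"
      and w: "(\<forall>x\<in>\<sigma>. 0 < w x) \<and> (\<forall>x\<in>\<tau>. 0 < w' x) \<and> combination \<sigma> w = combination \<tau> w'" for \<sigma> \<tau> w w'
  proof -
    obtain s t where "s \<in> K" "\<sigma> = vertex_point ` s" "t \<in> K" "\<tau> = vertex_point ` t"
      using st by blast
    then show ?thesis
      using main[of s t w w'] w by blast
  qed
  then show ?case
    unfolding geometric_complex_def using abs by (simp add: Sd_def)
next
  case (Suc d)
  then show ?case
    by (simp add: Sd_def geometric_complex_subdivision)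
qed

section \<open>Flags\<close>

text \<open>Membership of \<open>\<rho>\<close> makes the flags of different simplices disjoint
  families: every chain in a complex is filed under its largest member.\<close>

definition flags :: "'v set \<Rightarrow> nat \<Rightarrow> 'v set set set" where
  "flags \<rho> j = {C. C \<subseteq> Pow \<rho> - {{}} \<and> \<rho> \<in> C \<and> chain_set C \<and> card C = j + 1}"

text \<open>This counts the ordered partitions of a set of \<open>i + 1\<close> elements into
  \<open>j + 1\<close> nonempty blocks: it is \<open>(j + 1)!\<close> times a Stirling number of the
  second kind.\<close>

definition flag_number :: "nat \<Rightarrow> nat \<Rightarrow> nat" where
  "flag_number i j = card (flags {..i} j)"

lemma finite_flags: "finite \<rho> \<Longrightarrow> finite (flags \<rho> j)"
  unfolding flags_def by (rule finite_subset[of _ "Pow (Pow \<rho>)"]) auto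

lemma flagsD:
  assumes "C \<in> flags \<rho> j"
  shows "finite C" "\<Union>C = \<rho>" "C \<noteq> {}" "\<rho> \<in> C" "chain_set C" "card C = j + 1" "{} \<notin> C"
proof -
  show "\<rho> \<in> C" "chain_set C" "card C = j + 1" "{} \<notin> C"
    using assms by (auto simp: flags_def)
  then show "finite C" "C \<noteq> {}"
    using card_ge_0_finite[of C] by auto
  show "\<Union>C = \<rho>"
    using assms by (auto simp: flags_def)
qed

text \<open>A bijection of the vertex sets carries flags to flags injectively. Having two vertex
  types lets the inequality be used in both directions to compare with the model
  \<open>{..i}\<close>.\<close>

lemma card_flags_le:
  fixes \<rho> :: "'v set" and \<rho>' :: "'w set"
  assumes "finite \<rho>" "finite \<rho>'" "card \<rho> = card \<rho>'"
  shows "card (flags \<rho> j) \<le> card (flags \<rho>' j)"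
proof -
  obtain \<phi> where \<phi>: "bij_betw \<phi> \<rho> \<rho>'"
    using assms finite_same_card_bij by blast
  have inj1: "inj_on ((`) \<phi>) (Pow \<rho>)"
    using \<phi> by (intro inj_on_image_Pow) (simp add: bij_betw_def)
  have inj2: "inj_on ((`) ((`) \<phi>)) (flags \<rho> j)"
    using inj_on_image_Pow[OF inj1] by (rule inj_on_subset) (auto simp: flags_def)
  have "(`) ((`) \<phi>) C \<in> flags \<rho>' j" if "C \<in> flags \<rho> j" for C
  proof -
    have C: "C \<subseteq> Pow \<rho>" "{} \<notin> C" "\<rho> \<in> C" "chain_set C" "card C = j + 1"
      using that by (auto simp: flags_def)
    have "card ((`) \<phi> ` C) = j + 1"
      using C inj_on_subset[OF inj1 C(1)] by (simp add: card_image)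
    moreover have "chain_set ((`) \<phi> ` C)"
      unfolding chain_set_def
    proof (intro ballI)
      fix s' t' assume "s' \<in> (`) \<phi> ` C" "t' \<in> (`) \<phi> ` C"
      then obtain s t where "s \<in> C" "s' = \<phi> ` s" "t \<in> C" "t' = \<phi> ` t"
        by blast
      moreover from this have "s \<subseteq> t \<or> t \<subseteq> s"
        using C(4) by (simp add: chain_set_def)
      ultimately show "s' \<subseteq> t' \<or> t' \<subseteq> s'"
        using image_mono[of s t \<phi>] image_mono[of t s \<phi>] by argo
    qed
    moreover have "\<rho>' \<in> (`) \<phi> ` C"
      using C(3) \<phi> by (metis bij_betw_imp_surj_on imageI)
    moreover have "(`) \<phi> ` C \<subseteq> Pow \<rho>' - {{}}"
      using C(1,2) bij_betw_imp_surj_on[OF \<phi>] by auto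
    ultimately show ?thesis
      by (simp add: flags_def)
  qed
  then show ?thesis
    by (intro card_inj_on_le[OF inj2] finite_flags assms) blast
qed

lemma card_flags:
  assumes "finite \<rho>" "card \<rho> = i + 1"
  shows "card (flags \<rho> j) = flag_number i j"
  unfolding flag_number_def using assms by (intro antisym card_flags_le) auto

text \<open>Cardinality is injective on a chain of finite sets, with values between \<open>1\<close>
  and \<open>card \<rho>\<close> here.\<close>

lemma card_chain_le:
  assumes "chain_set C" "finite \<rho>" "C \<subseteq> Pow \<rho>" "{} \<notin> C"
  shows "card C \<le> card \<rho>"
proof -
  have fin: "finite c" if "c \<in> C" for c
    using that assms(2,3) finite_subset by blast
  have "inj_on card C"
  proof (rule inj_onI)
    fix s t assume st: "s \<in> C" "t \<in> C" "card s = card t"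
    then have "s \<subseteq> t \<or> t \<subseteq> s"
      using assms(1) by (auto simp: chain_set_def)
    then show "s = t"
      using st fin card_subset_eq by metis
  qed
  moreover have "card ` C \<subseteq> {1..card \<rho>}"
  proof
    fix k assume "k \<in> card ` C"
    then obtain c where c: "c \<in> C" "k = card c"
      by blast
    moreover have "c \<noteq> {}" "c \<subseteq> \<rho>"
      using c assms by auto
    ultimately show "k \<in> {1..card \<rho>}"
      using fin[OF c(1)] card_mono[OF assms(2), of c] by (simp add: Suc_le_eq card_gt_0_iff)
  qed
  ultimately show ?thesis
    using card_inj_on_le[of card C "{1..card \<rho>}"] by simp
qed

lemma flags_empty:
  assumes "finite \<rho>" "card \<rho> \<le> j"
  shows "flags \<rho> j = {}"
proof (rule ccontr)
  assume "flags \<rho> j \<noteq> {}"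
  then obtain C where "C \<in> flags \<rho> j"
    by blast
  then have "C \<subseteq> Pow \<rho>" "{} \<notin> C" "chain_set C" "card C = j + 1"
    by (auto simp: flags_def)
  then show False
    using card_chain_le[of C \<rho>] assms by simp
qed

lemma flag_number_eq_0: "i < j \<Longrightarrow> flag_number i j = 0"
  by (simp add: flag_number_def flags_empty)

text \<open>A chain of maximal length gains exactly one vertex at each step, so the order in which
  the vertices appear is an enumeration. The induction removes the largest member.\<close>

lemma full_chain_enumeration:
  assumes "chain_set C" "finite \<rho>" "C \<subseteq> Pow \<rho>" "{} \<notin> C" "card C = card \<rho>" "card \<rho> = n + 1"
  shows "\<exists>\<phi>. bij_betw \<phi> {..n} \<rho> \<and> C = (\<lambda>k. \<phi> ` {..k}) ` {..n}"
  using assms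
proof (induction n arbitrary: C \<rho>)
  case 0
  then obtain a where a: "\<rho> = {a}"
    by (auto simp: card_1_singleton_iff)
  obtain c where c: "C = {c}"
    using 0 by (auto simp: card_1_singleton_iff)
  then have "C = {{a}}"
    using 0(3,4) a by auto
  then show ?case
    using a by (intro exI[of _ "\<lambda>_. a"]) (auto simp: bij_betw_def)
next
  case (Suc n)
  have finC: "finite C"
    using Suc.prems(2,3) finite_subset finite_Pow_iff by metis
  define D where "D = C - {\<rho>}"
  have D: "chain_set D" "D \<subseteq> Pow \<rho>" "{} \<notin> D" "finite D"
    using Suc.prems finC by (auto simp: D_def intro: chain_set_subset)
  have cardD: "n + 1 \<le> card D"
    using Suc.prems card_Diff1_le[of C \<rho>] finC by (simp add: D_def card_Diff_singleton_if)
  then have "D \<noteq> {}"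
    by auto
  define \<rho>' where "\<rho>' = \<Union>D"
  have \<rho>': "\<rho>' \<in> D"
    unfolding \<rho>'_def using D \<open>D \<noteq> {}\<close> by (intro Union_chain_mem) auto
  have sub: "\<rho>' \<subset> \<rho>"
    using \<rho>' D(2) by (auto simp: D_def)
  then have fin': "finite \<rho>'"
    using Suc.prems(2) finite_subset by blast
  \<comment> \<open>\<open>\<rho>'\<close> has fewer vertices than \<open>\<rho>\<close> and at
    least as many as \<open>D\<close> has members; this pins down both counts and forces
    \<open>\<rho>\<close> to belong to \<open>C\<close>.\<close>
  have "card \<rho>' < n + 2"
    using psubset_card_mono[OF Suc.prems(2) sub] Suc.prems(6) by simp
  moreover have "card D \<le> card \<rho>'"
    using D fin' by (intro card_chain_le) (auto simp: \<rho>'_def)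
  ultimately have card: "card D = n + 1" "card \<rho>' = n + 1"
    using cardD by auto
  then have "\<rho> \<in> C"
    using Suc.prems finC by (auto simp: D_def card_Diff_singleton_if split: if_splits)
  then have C: "C = insert \<rho> D"
    by (auto simp: D_def)
  obtain \<phi> where \<phi>: "bij_betw \<phi> {..n} \<rho>'" "D = (\<lambda>k. \<phi> ` {..k}) ` {..n}"
    using Suc.IH[of D \<rho>'] D fin' card by (auto simp: \<rho>'_def)
  have "card (\<rho> - \<rho>') = 1"
    using Suc.prems(6) card(2) fin' sub by (simp add: card_Diff_subset)
  then obtain a where a: "\<rho> - \<rho>' = {a}"
    by (auto simp: card_1_singleton_iff)
  define \<psi> where "\<psi> = \<phi>(Suc n := a)"
  have img: "\<psi> ` {..k} = \<phi> ` {..k}" if "k \<le> n" for k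
    using that by (auto simp: \<psi>_def image_def)
  have \<rho>: "\<rho> = insert a \<rho>'" "a \<notin> \<rho>'"
    using a sub by auto
  have im: "\<psi> ` {..Suc n} = \<rho>"
  proof -
    have "\<psi> ` {..Suc n} = insert (\<psi> (Suc n)) (\<psi> ` {..n})"
      by (simp only: atMost_Suc image_insert)
    also have "\<psi> ` {..n} = \<rho>'"
      using img[of n] \<phi>(1) by (simp add: bij_betw_def)
    finally show ?thesis
      using \<rho>(1) by (simp add: \<psi>_def)
  qed
  have "inj_on \<psi> {..Suc n}"
    using im Suc.prems(6) by (intro eq_card_imp_inj_on) auto
  then have "bij_betw \<psi> {..Suc n} \<rho>"
    using im by (simp add: bij_betw_def)
  moreover have "C = (\<lambda>k. \<psi> ` {..k}) ` {..Suc n}"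
  proof -
    have "(\<lambda>k. \<psi> ` {..k}) ` {..Suc n} = insert \<rho> ((\<lambda>k. \<psi> ` {..k}) ` {..n})"
      using im by (simp add: atMost_Suc)
    also have "(\<lambda>k. \<psi> ` {..k}) ` {..n} = D"
      unfolding \<phi>(2) by (rule image_cong[OF refl]) (simp only: atMost_iff img)
    finally show ?thesis
      using C by simp
  qed
  ultimately show ?case
    by blast
qed

text \<open>A maximal flag is an ordering of the vertices. This matches the cells in the volume
  computation, indexed by permutations, with the top simplices of the combinatorial
  subdivision.\<close>

lemma bij_betw_permutations_flags:
  assumes \<phi>: "bij_betw \<phi> {..n} \<rho>"
  shows "bij_betw (\<lambda>\<pi>. (\<lambda>k. \<phi> ` \<pi> ` {..k}) ` {..n}) {\<pi>. \<pi> permutes {..n}} (flags \<rho> n)"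
proof -
  let ?F = "\<lambda>\<pi>. (\<lambda>k. \<phi> ` \<pi> ` {..k}) ` {..n}"
  have fin: "finite \<rho>" and card\<rho>: "card \<rho> = n + 1"
    using \<phi> bij_betw_finite bij_betw_same_card by fastforce+
  have inj: "inj_on (\<lambda>i. \<phi> (\<pi> i)) {..n}" and mem: "\<phi> (\<pi> i) \<in> \<rho>" if "\<pi> permutes {..n}" "i \<le> n" for \<pi> i
  proof -
    have "bij_betw (\<phi> \<circ> \<pi>) {..n} \<rho>"
      using permutes_imp_bij[OF that(1)] \<phi> by (rule bij_betw_trans)
    then show "inj_on (\<lambda>i. \<phi> (\<pi> i)) {..n}" "\<phi> (\<pi> i) \<in> \<rho>"
      using that(2) by (auto simp: bij_betw_def comp_def)
  qed
  have card_k: "card (\<phi> ` \<pi> ` {..k}) = k + 1" if "\<pi> permutes {..n}" "k \<le> n" for \<pi> k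
    using inj_on_subset[OF inj[OF that(1) le0], of "{..k}"] that(2)
    by (simp add: image_image card_image)
  have "inj_on ?F {\<pi>. \<pi> permutes {..n}}"
  proof (rule inj_onI)
    fix \<pi> \<pi>' assume \<pi>: "\<pi> \<in> {\<pi>. \<pi> permutes {..n}}" "\<pi>' \<in> {\<pi>. \<pi> permutes {..n}}" and eq: "?F \<pi> = ?F \<pi>'"
    have img: "\<phi> ` \<pi> ` {..k} = \<phi> ` \<pi>' ` {..k}" if "k \<le> n" for k
    proof -
      have "\<phi> ` \<pi> ` {..k} \<in> ?F \<pi>'"
        using that eq by blast
      then obtain l where l: "l \<le> n" "\<phi> ` \<pi> ` {..k} = \<phi> ` \<pi>' ` {..l}"
        by blast
      then have "k = l"
        using card_k[of \<pi> k] card_k[of \<pi>' l] \<pi> that by simp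
      then show ?thesis
        using l by simp
    qed
    have "\<phi> (\<pi> k) = \<phi> (\<pi>' k)" if k: "k \<le> n" for k
    proof -
      \<comment> \<open>The \<open>k\<close>-th vertex of the ordering is what the
        \<open>k\<close>-th member of the flag adds to the preceding one. The strict initial segment
        covers \<open>k = 0\<close> as well.\<close>
      have diff: "\<phi> ` \<sigma> ` {..k} - \<phi> ` \<sigma> ` {..<k} = {\<phi> (\<sigma> k)}" if "\<sigma> permutes {..n}" for \<sigma>
      proof -
        have "\<phi> (\<sigma> k) \<noteq> \<phi> (\<sigma> i)" if "i < k" for i
          using inj_onD[OF inj[OF \<open>\<sigma> permutes {..n}\<close> le0], of i k] that k by auto
        then show ?thesis
          by (auto simp: le_less)
      qed
      have "\<phi> ` \<pi> ` {..<k} = \<phi> ` \<pi>' ` {..<k}"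
      proof (cases k)
        case (Suc l)
        then show ?thesis
          using img[of l] k by (simp add: lessThan_Suc_atMost)
      qed simp
      then have "{\<phi> (\<pi> k)} = {\<phi> (\<pi>' k)}"
        using diff[of \<pi>] diff[of \<pi>'] img[OF k] \<pi> by simp
      then show ?thesis
        by simp
    qed
    moreover have "\<pi> k \<le> n" "\<pi>' k \<le> n" if "k \<le> n" for k
      using \<pi> that permutes_in_image[of \<pi> "{..n}" k] permutes_in_image[of \<pi>' "{..n}" k] by auto
    ultimately have "\<pi> k = \<pi>' k" if "k \<le> n" for k
      using \<phi> that by (meson atMost_iff bij_betw_def inj_onD)
    moreover have "\<pi> k = \<pi>' k" if "\<not> k \<le> n" for k
      using \<pi> that permutes_not_in[of \<pi> "{..n}" k] permutes_not_in[of \<pi>' "{..n}" k] by simp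
    ultimately show "\<pi> = \<pi>'"
      by blast
  qed
  moreover have "?F ` {\<pi>. \<pi> permutes {..n}} = flags \<rho> n"
  proof
    show "?F ` {\<pi>. \<pi> permutes {..n}} \<subseteq> flags \<rho> n"
    proof
      fix C assume "C \<in> ?F ` {\<pi>. \<pi> permutes {..n}}"
      then obtain \<pi> where \<pi>: "\<pi> permutes {..n}" "C = ?F \<pi>"
        by blast
      have "inj_on (\<lambda>k. \<phi> ` \<pi> ` {..k}) {..n}"
        by (rule inj_onI) (use card_k[OF \<pi>(1)] in \<open>metis add_right_cancel atMost_iff\<close>)
      then have "card C = n + 1"
        unfolding \<pi>(2) by (simp add: card_image)
      moreover have "chain_set C"
        unfolding \<pi>(2) chain_set_def by (auto simp: image_image) (meson imageI atMost_iff le_trans linear)+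
      moreover have "\<rho> \<in> C"
      proof -
        have "\<phi> ` \<pi> ` {..n} = \<rho>"
          using \<phi> permutes_image[OF \<pi>(1)] by (simp add: bij_betw_def)
        then show ?thesis
          unfolding \<pi>(2) by blast
      qed
      moreover have "C \<subseteq> Pow \<rho> - {{}}"
        unfolding \<pi>(2) using mem[OF \<pi>(1)] by auto
      ultimately show "C \<in> flags \<rho> n"
        by (simp add: flags_def)
    qed
    show "flags \<rho> n \<subseteq> ?F ` {\<pi>. \<pi> permutes {..n}}"
    proof
      fix C assume C: "C \<in> flags \<rho> n"
      then have "C \<subseteq> Pow \<rho>" "{} \<notin> C" "chain_set C" "card C = n + 1"
        by (auto simp: flags_def)
      then obtain \<psi> where \<psi>: "bij_betw \<psi> {..n} \<rho>" "C = (\<lambda>k. \<psi> ` {..k}) ` {..n}"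
        using full_chain_enumeration[of C \<rho> n] fin card\<rho> by auto
      define \<pi> where "\<pi> i = (if i \<le> n then inv_into {..n} \<phi> (\<psi> i) else i)" for i
      have "bij_betw (inv_into {..n} \<phi> \<circ> \<psi>) {..n} {..n}"
        using \<psi>(1) bij_betw_inv_into[OF \<phi>] by (rule bij_betw_trans)
      then have "bij_betw \<pi> {..n} {..n}"
        by (rule bij_betw_cong[THEN iffD1, rotated]) (simp add: \<pi>_def)
      then have "\<pi> permutes {..n}"
        by (rule bij_imp_permutes) (simp add: \<pi>_def)
      moreover have "\<phi> (\<pi> i) = \<psi> i" if "i \<le> n" for i
      proof -
        have "\<psi> i \<in> \<phi> ` {..n}"
          using that \<phi> \<psi>(1) by (auto simp: bij_betw_def)
        then show ?thesis
          using that by (simp add: \<pi>_def f_inv_into_f)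
      qed
      then have img: "\<phi> ` \<pi> ` {..k} = \<psi> ` {..k}" if "k \<le> n" for k
        using that unfolding image_image by (intro image_cong) auto
      have "C = ?F \<pi>"
        unfolding \<psi>(2) by (rule image_cong[OF refl]) (simp only: atMost_iff img)
      ultimately show "C \<in> ?F ` {\<pi>. \<pi> permutes {..n}}"
        by blast
    qed
  qed
  ultimately show ?thesis
    by (simp add: bij_betw_def)
qed

lemma flag_number_self: "flag_number n n = fact (n + 1)"
proof -
  have "card {\<pi>. \<pi> permutes {..n}} = card (flags {..n} n)"
    by (rule bij_betw_same_card[OF bij_betw_permutations_flags[of id]]) simp
  moreover have "card {\<pi>. \<pi> permutes {..n}} = fact (n + 1)"
    by (subst card_permutations) auto
  ultimately show ?thesis
    by (simp add: flag_number_def)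
qed

section \<open>Asymptotics of face numbers\<close>

text \<open>Subtracting the fixed point \<open>\<beta> / (1 - \<alpha>)\<close> turns the recursion
  into multiplication by \<open>\<alpha>\<close> up to a vanishing error.\<close>

lemma contraction_limit:
  fixes z :: "nat \<Rightarrow> real"
  assumes \<alpha>: "0 \<le> \<alpha>" "\<alpha> < 1" and lim: "(\<lambda>d. z (Suc d) - \<alpha> * z d) \<longlonglongrightarrow> \<beta>"
  shows "z \<longlonglongrightarrow> \<beta> / (1 - \<alpha>)"
proof -
  define y where "y d = z d - \<beta> / (1 - \<alpha>)" for d
  have step: "y (Suc d) - \<alpha> * y d = (z (Suc d) - \<alpha> * z d) - \<beta>" for d
  proof -
    have "\<beta> / (1 - \<alpha>) - \<alpha> * (\<beta> / (1 - \<alpha>)) = (1 - \<alpha>) * (\<beta> / (1 - \<alpha>))"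
      by (simp only: left_diff_distrib mult_1)
    also have "\<dots> = \<beta>"
      using \<alpha>(2) by simp
    finally show ?thesis
      unfolding y_def right_diff_distrib by linarith
  qed
  have "(\<lambda>d. y (Suc d) - \<alpha> * y d) \<longlonglongrightarrow> 0"
    unfolding step using tendsto_diff[OF lim tendsto_const[of \<beta>]] by simp
  then have small: "\<forall>\<^sub>F d in sequentially. \<bar>y (Suc d) - \<alpha> * y d\<bar> < \<epsilon> * (1 - \<alpha>)" if "0 < \<epsilon>" for \<epsilon>
    using that \<alpha>(2) by (auto simp: tendsto_iff dist_real_def)
  have "y \<longlonglongrightarrow> 0"
  proof (rule LIMSEQ_I)
    fix r :: real assume "0 < r"
    define \<epsilon> where "\<epsilon> = r / 2"
    have "0 < \<epsilon>"
      using \<open>0 < r\<close> by (simp add: \<epsilon>_def)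
    then obtain D where D: "\<And>d. D \<le> d \<Longrightarrow> \<bar>y (Suc d) - \<alpha> * y d\<bar> < \<epsilon> * (1 - \<alpha>)"
      using small[of \<epsilon>] by (auto simp: eventually_sequentially)
    \<comment> \<open>An error of \<open>\<epsilon> * (1 - \<alpha>)\<close> per step is chosen
      because these errors add up along a geometric series to at most
      \<open>\<epsilon>\<close>.\<close>
    have bound: "\<bar>y (D + k)\<bar> \<le> \<epsilon> + \<alpha> ^ k * \<bar>y D\<bar>" for k
    proof (induction k)
      case 0
      then show ?case
        using \<open>0 < \<epsilon>\<close> by simp
    next
      case (Suc k)
      have "\<bar>y (D + Suc k)\<bar> \<le> \<alpha> * \<bar>y (D + k)\<bar> + \<epsilon> * (1 - \<alpha>)"
        using D[of "D + k"] \<alpha>(1) abs_triangle_ineq[of "y (D + Suc k) - \<alpha> * y (D + k)" "\<alpha> * y (D + k)"]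
        by (simp add: abs_mult)
      also have "\<alpha> * \<bar>y (D + k)\<bar> \<le> \<alpha> * (\<epsilon> + \<alpha> ^ k * \<bar>y D\<bar>)"
        using Suc \<alpha>(1) by (intro mult_left_mono)
      finally show ?case
        by (simp add: algebra_simps)
    qed
    have "(\<lambda>k. \<alpha> ^ k * \<bar>y D\<bar>) \<longlonglongrightarrow> 0"
      using LIMSEQ_power_zero[of \<alpha>] \<alpha> by (intro tendsto_mult_left_zero) auto
    then obtain k0 where k0: "\<And>k. k0 \<le> k \<Longrightarrow> \<bar>\<alpha> ^ k * \<bar>y D\<bar>\<bar> < \<epsilon>"
      using \<open>0 < \<epsilon>\<close> by (auto simp: LIMSEQ_def dist_real_def)
    show "\<exists>no. \<forall>d\<ge>no. norm (y d - 0) < r"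
    proof (intro exI allI impI)
      fix d assume "D + k0 \<le> d"
      then obtain k where k: "d = D + k" "k0 \<le> k"
        using le_Suc_ex[of D d] by auto
      show "norm (y d - 0) < r"
        using bound[of k] k0[OF k(2)] k(1) by (simp add: \<epsilon>_def)
    qed
  qed
  then show ?thesis
    using tendsto_add[OF _ tendsto_const[of "\<beta> / (1 - \<alpha>)"], of y 0] by (simp add: y_def)
qed

text \<open>The indices are treated from \<open>n\<close> downwards: once the limits for
  \<open>i > j\<close> are known, row \<open>j\<close> is a contraction with a convergent
  perturbation. The constants \<open>Q\<close> are quantified before \<open>X\<close> and
  \<open>c\<close>.\<close>

lemma triangular_recursion_limit:
  fixes a :: "nat \<Rightarrow> nat \<Rightarrow> real"
  assumes a: "\<And>i j. i < j \<Longrightarrow> a i j = 0" "\<And>j. j < n \<Longrightarrow> 0 \<le> a j j \<and> a j j < 1"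
  shows "\<exists>Q. \<forall>X c. (X n \<longlonglongrightarrow> c) \<and> (\<forall>j<n. (\<lambda>d. X j (Suc d) - (\<Sum>i\<le>n. a i j * X i d)) \<longlonglongrightarrow> 0)
    \<longrightarrow> (\<forall>j\<le>n. X j \<longlonglongrightarrow> Q j * c)"
proof -
  define hyp where "hyp X c \<longleftrightarrow> (X n \<longlonglongrightarrow> c) \<and> (\<forall>j<n. (\<lambda>d. X j (Suc d) - (\<Sum>i\<le>n. a i j * X i d)) \<longlonglongrightarrow> 0)"
    for X c
  have "\<exists>q. \<forall>X c. hyp X c \<longrightarrow> X j \<longlonglongrightarrow> q * c" if "j \<le> n" for j
    using that
  proof (induction "n - j" arbitrary: j rule: less_induct)
    case less
    show ?case
    proof (cases "j = n")
      case True
      then show ?thesis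
        by (intro exI[of _ 1]) (simp add: hyp_def)
    next
      case False
      then have j: "j < n"
        using less.prems by simp
      have "\<forall>i\<in>{j<..n}. \<exists>q. \<forall>X c. hyp X c \<longrightarrow> X i \<longlonglongrightarrow> q * c"
        using less.hyps j by auto
      then obtain Q where Q: "\<And>i X c. i \<in> {j<..n} \<Longrightarrow> hyp X c \<Longrightarrow> X i \<longlonglongrightarrow> Q i * c"
        by metis
      \<comment> \<open>The factor of \<open>c\<close> is the solution \<open>q\<close> of the
        limiting equation \<open>q = a j j * q + (\<Sum>i\<in>{j<..n}. a i j * Q i)\<close>.\<close>
      have "X j \<longlonglongrightarrow> (\<Sum>i\<in>{j<..n}. a i j * Q i) / (1 - a j j) * c" if X: "hyp X c" for X c
      proof -
        have split: "(\<Sum>i\<le>n. a i j * X i d) = a j j * X j d + (\<Sum>i\<in>{j<..n}. a i j * X i d)" for d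
        proof -
          have "(\<Sum>i\<le>n. a i j * X i d) = (\<Sum>i\<in>{j..n}. a i j * X i d)"
            using a(1) by (intro sum.mono_neutral_right) auto
          then show ?thesis
            using j by (simp add: sum.head)
        qed
        have "(\<lambda>d. X j (Suc d) - (\<Sum>i\<le>n. a i j * X i d) + (\<Sum>i\<in>{j<..n}. a i j * X i d))
            \<longlonglongrightarrow> 0 + (\<Sum>i\<in>{j<..n}. a i j * (Q i * c))"
          using X j Q by (intro tendsto_intros) (auto simp: hyp_def)
        then have "(\<lambda>d. X j (Suc d) - a j j * X j d) \<longlonglongrightarrow> (\<Sum>i\<in>{j<..n}. a i j * Q i) * c"
          unfolding split by (simp add: sum_distrib_right mult.assoc)
        then have "X j \<longlonglongrightarrow> (\<Sum>i\<in>{j<..n}. a i j * Q i) * c / (1 - a j j)"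
          using a(2)[OF j] by (intro contraction_limit) auto
        then show ?thesis
          by simp
      qed
      then show ?thesis
        by blast
    qed
  qed
  then have "\<forall>j\<in>{..n}. \<exists>q. \<forall>X c. hyp X c \<longrightarrow> X j \<longlonglongrightarrow> q * c"
    by simp
  then obtain Q where "\<forall>j\<in>{..n}. \<forall>X c. hyp X c \<longrightarrow> X j \<longlonglongrightarrow> Q j * c"
    by metis
  then show ?thesis
    unfolding hyp_def by (intro exI[of _ Q]) simp
qed

section \<open>The universal limits of the face numbers\<close>

definition flag_ratio :: "nat \<Rightarrow> nat \<Rightarrow> nat \<Rightarrow> real" where
  "flag_ratio n i j = real (flag_number i j) / fact (n + 1)"

text \<open>One family is chosen before any sequence is given, so that the same numbers serve the
  face densities of a complex and the barycenter sums of a test function.\<close>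

definition face_limit :: "nat \<Rightarrow> nat \<Rightarrow> real" where
  "face_limit n = (SOME Q. \<forall>X c. (X n \<longlonglongrightarrow> c) \<and>
     (\<forall>j<n. (\<lambda>d. X j (Suc d) - (\<Sum>i\<le>n. flag_ratio n i j * X i d)) \<longlonglongrightarrow> 0)
     \<longrightarrow> (\<forall>j\<le>n. X j \<longlonglongrightarrow> Q j * c))"

lemma face_limit:
  fixes X :: "nat \<Rightarrow> nat \<Rightarrow> real"
  assumes "X n \<longlonglongrightarrow> c"
    and "\<And>j. j < n \<Longrightarrow> (\<lambda>d. X j (Suc d) - (\<Sum>i\<le>n. flag_ratio n i j * X i d)) \<longlonglongrightarrow> 0"
    and "j \<le> n"
  shows "X j \<longlonglongrightarrow> face_limit n j * c"
proof -
  have "\<exists>Q. \<forall>X c. (X n \<longlonglongrightarrow> c) \<and> (\<forall>j<n. (\<lambda>d. X j (Suc d) - (\<Sum>i\<le>n. flag_ratio n i j * X i d)) \<longlonglongrightarrow> 0)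
    \<longrightarrow> (\<forall>j\<le>n. X j \<longlonglongrightarrow> Q j * c)"
  proof (rule triangular_recursion_limit)
    show "flag_ratio n i j = 0" if "i < j" for i j
      using that by (simp add: flag_ratio_def flag_number_eq_0)
    fix j assume "j < n"
    then have "(fact (j + 1) :: real) < fact (n + 1)"
      by (intro fact_less_mono) auto
    then show "0 \<le> flag_ratio n j j \<and> flag_ratio n j j < 1"
      unfolding flag_ratio_def flag_number_self by (simp del: fact_Suc)
  qed
  from someI_ex[OF this, folded face_limit_def] show ?thesis
    using assms by blast
qed

text \<open>Injectivity of \<open>barycenter\<close> on the complex recovers the chain from its set
  of barycenters, and the union of the chain then recovers \<open>\<rho>\<close>.\<close>

lemma sum_subdivision:
  fixes g :: "('a \<Rightarrow> real) set \<Rightarrow> 'b::comm_monoid_add"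
  assumes L: "geometric_complex L" "finite L"
  shows "(\<Sum>\<tau>\<in>simplices (subdivision L) j. g \<tau>) = (\<Sum>\<rho>\<in>L. \<Sum>C\<in>flags \<rho> j. g (barycenter ` C))"
proof -
  have sub: "C \<subseteq> L" if "\<rho> \<in> L" "C \<in> flags \<rho> j" for \<rho> C
    using that geometric_complex_simplex(3)[OF L(1), of \<rho>] by (auto simp: flags_def)
  have finf: "\<forall>\<rho>\<in>L. finite (flags \<rho> j)"
    using finite_flags geometric_complex_simplex(1)[OF L(1)] by blast
  have "bij_betw (\<lambda>(\<rho>, C). barycenter ` C) (Sigma L (\<lambda>\<rho>. flags \<rho> j)) (simplices (subdivision L) j)"
    unfolding bij_betw_def
  proof
    show "inj_on (\<lambda>(\<rho>, C). barycenter ` C) (Sigma L (\<lambda>\<rho>. flags \<rho> j))"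
    proof (rule inj_onI, clarify)
      fix \<rho> C \<rho>' C' assume *: "\<rho> \<in> L" "C \<in> flags \<rho> j" "\<rho>' \<in> L" "C' \<in> flags \<rho>' j" "barycenter ` C = barycenter ` C'"
      have "C = C'"
        using inj_on_image_eq_iff[OF inj_on_barycenter[OF L(1)] sub[OF *(1,2)] sub[OF *(3,4)]] *(5) by simp
      then show "\<rho> = \<rho>' \<and> C = C'"
        using flagsD(2)[OF *(2)] flagsD(2)[OF *(4)] by simp
    qed
    show "(\<lambda>(\<rho>, C). barycenter ` C) ` Sigma L (\<lambda>\<rho>. flags \<rho> j) = simplices (subdivision L) j"
    proof
      show "(\<lambda>(\<rho>, C). barycenter ` C) ` Sigma L (\<lambda>\<rho>. flags \<rho> j) \<subseteq> simplices (subdivision L) j"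
      proof clarify
        fix \<rho> C assume *: "\<rho> \<in> L" "C \<in> flags \<rho> j"
        have "barycenter ` C \<in> subdivision L"
          unfolding mem_subdivision using sub[OF *] flagsD[OF *(2)] by blast
        moreover have "card (barycenter ` C) = j + 1"
          using card_image[OF inj_on_subset[OF inj_on_barycenter[OF L(1)] sub[OF *]]] flagsD(6)[OF *(2)] by simp
        ultimately show "barycenter ` C \<in> simplices (subdivision L) j"
          by (simp add: simplices_def)
      qed
      show "simplices (subdivision L) j \<subseteq> (\<lambda>(\<rho>, C). barycenter ` C) ` Sigma L (\<lambda>\<rho>. flags \<rho> j)"
      proof
        fix \<tau> assume "\<tau> \<in> simplices (subdivision L) j"
        then obtain C where C: "\<tau> = barycenter ` C" "C \<subseteq> L" "finite C" "C \<noteq> {}" "chain_set C" "card \<tau> = j + 1"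
          by (auto simp: simplices_def mem_subdivision)
        have "card C = j + 1"
          using card_image[OF inj_on_subset[OF inj_on_barycenter[OF L(1)] C(2)]] C(1,6) by simp
        moreover have "\<Union>C \<in> C"
          using C by (intro Union_chain_mem)
        moreover have "{} \<notin> C"
          using C(2) geometric_complex_simplex(2)[OF L(1)] by blast
        ultimately have "C \<in> flags (\<Union>C) j" "\<Union>C \<in> L"
          using C by (auto simp: flags_def)
        then show "\<tau> \<in> (\<lambda>(\<rho>, C). barycenter ` C) ` Sigma L (\<lambda>\<rho>. flags \<rho> j)"
          using C(1) by force
      qed
    qed
  qed
  then have "(\<Sum>\<tau>\<in>simplices (subdivision L) j. g \<tau>) = (\<Sum>(\<rho>, C)\<in>Sigma L (\<lambda>\<rho>. flags \<rho> j). g (barycenter ` C))"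
    by (simp add: sum.reindex_bij_betw[symmetric] case_prod_unfold)
  also have "\<dots> = (\<Sum>\<rho>\<in>L. \<Sum>C\<in>flags \<rho> j. g (barycenter ` C))"
    using L(2) finf by (rule sum.Sigma[symmetric])
  finally show ?thesis .
qed

lemma Sd_Suc: "Sd (Suc d) K = subdivision (Sd d K)"
  by (simp add: Sd_def)

lemma finite_Sd: "finite K \<Longrightarrow> finite (Sd d K)"
proof (induction d)
  case (Suc d)
  have "subdivision (Sd d K) \<subseteq> (`) barycenter ` Pow (Sd d K)"
    by (auto simp: mem_subdivision)
  then show ?case
    using Suc finite_subset unfolding Sd_Suc by blast
qed (simp add: Sd_def)

text \<open>The vertices of a new simplex come from a chain below an old simplex, and such a chain
  has no more members than that simplex has vertices.\<close>

lemma card_Sd_le: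
  assumes K: "abstract_complex K" and dim: "\<forall>s\<in>K. card s \<le> m" and "\<tau> \<in> Sd d K"
  shows "card \<tau> \<le> m"
  using assms(3)
proof (induction d arbitrary: \<tau>)
  case 0
  then obtain s where s: "s \<in> K" "\<tau> = vertex_point ` s"
    by (auto simp: Sd_def)
  then have "card \<tau> \<le> card s"
    using K by (auto simp: abstract_complex_def intro!: card_image_le)
  then show ?case
    using dim s by fastforce
next
  case (Suc d)
  then obtain C where C: "\<tau> = barycenter ` C" "C \<subseteq> Sd d K" "finite C" "C \<noteq> {}" "chain_set C"
    by (auto simp: Sd_Suc mem_subdivision)
  note geo = geometric_complex_simplex[OF geometric_complex_Sd[OF K]]
  have U: "\<Union>C \<in> Sd d K"
    using Union_chain_mem[OF C(3,4,5)] C(2) by blast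
  have "{} \<notin> C"
    using C(2) geo(2) by blast
  have "card \<tau> \<le> card C"
    using C by (simp add: card_image_le)
  also have "\<dots> \<le> card (\<Union>C)"
    using C(5) geo(1)[OF U] \<open>{} \<notin> C\<close> by (intro card_chain_le) auto
  also have "\<dots> \<le> m"
    by (rule Suc.IH[OF U])
  finally show ?case .
qed

lemma sum_Sd_by_dimension:
  fixes F :: "('a \<Rightarrow> real) set \<Rightarrow> 'b::comm_monoid_add"
  assumes K: "abstract_complex K" "finite K" "\<forall>s\<in>K. card s \<le> n + 1"
  shows "(\<Sum>\<rho>\<in>Sd d K. F \<rho>) = (\<Sum>i\<le>n. \<Sum>\<rho>\<in>simplices (Sd d K) i. F \<rho>)"
proof -
  have card: "card \<rho> - 1 \<le> n \<and> card \<rho> = card \<rho> - 1 + 1" if "\<rho> \<in> Sd d K" for \<rho>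
  proof -
    have "0 < card \<rho>"
      using geometric_complex_simplex(1,2)[OF geometric_complex_Sd[OF K(1)] that] by (simp add: card_gt_0_iff)
    then show ?thesis
      using card_Sd_le[OF K(1,3) that] by simp
  qed
  have "(\<Sum>\<rho>\<in>Sd d K. F \<rho>) = (\<Sum>i\<le>n. \<Sum>\<rho> | \<rho> \<in> Sd d K \<and> card \<rho> - 1 = i. F \<rho>)"
    using finite_Sd[OF K(2)] card by (intro sum.group[symmetric]) auto
  also have "\<dots> = (\<Sum>i\<le>n. \<Sum>\<rho>\<in>simplices (Sd d K) i. F \<rho>)"
    using card by (intro sum.cong) (force simp: simplices_def)+
  finally show ?thesis .
qed

lemma sum_Sd_Suc:
  fixes g :: "('a \<Rightarrow> real) set \<Rightarrow> 'b::comm_monoid_add"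
  assumes K: "abstract_complex K" "finite K" "\<forall>s\<in>K. card s \<le> n + 1"
  shows "(\<Sum>\<tau>\<in>simplices (Sd (Suc d) K) j. g \<tau>)
    = (\<Sum>i\<le>n. \<Sum>\<rho>\<in>simplices (Sd d K) i. \<Sum>C\<in>flags \<rho> j. g (barycenter ` C))"
  unfolding Sd_Suc sum_subdivision[OF geometric_complex_Sd[OF K(1)] finite_Sd[OF K(2)]]
  by (rule sum_Sd_by_dimension[OF K])

lemma card_flags_Sd:
  assumes "abstract_complex K" "\<rho> \<in> simplices (Sd d K) i"
  shows "card (flags \<rho> j) = flag_number i j"
  using assms geometric_complex_simplex(1)[OF geometric_complex_Sd[OF assms(1)], of \<rho> d]
  by (intro card_flags) (auto simp: simplices_def)

lemma face_number_Sd_Suc: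
  assumes K: "abstract_complex K" "finite K" "\<forall>s\<in>K. card s \<le> n + 1"
  shows "real (face_number (Sd (Suc d) K) j) = (\<Sum>i\<le>n. real (flag_number i j) * real (face_number (Sd d K) i))"
proof -
  have "real (face_number (Sd (Suc d) K) j) = (\<Sum>\<tau>\<in>simplices (Sd (Suc d) K) j. 1)"
    by (simp add: face_number_def)
  also have "\<dots> = (\<Sum>i\<le>n. \<Sum>\<rho>\<in>simplices (Sd d K) i. real (card (flags \<rho> j)))"
    unfolding sum_Sd_Suc[OF K] by simp
  also have "\<dots> = (\<Sum>i\<le>n. \<Sum>\<rho>\<in>simplices (Sd d K) i. real (flag_number i j))"
    using card_flags_Sd[OF K(1)] by (intro sum.cong) auto
  also have "\<dots> = (\<Sum>i\<le>n. real (flag_number i j) * real (face_number (Sd d K) i))"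
    by (simp add: face_number_def mult.commute)
  finally show ?thesis .
qed

definition face_density :: "nat \<Rightarrow> 'a set set \<Rightarrow> nat \<Rightarrow> nat \<Rightarrow> real" where
  "face_density n K j d = real (face_number (Sd d K) j) / fact (n + 1) ^ d"

lemma face_density_Suc:
  assumes K: "abstract_complex K" "finite K" "\<forall>s\<in>K. card s \<le> n + 1"
  shows "face_density n K j (Suc d) = (\<Sum>i\<le>n. flag_ratio n i j * face_density n K i d)"
  unfolding face_density_def face_number_Sd_Suc[OF K] flag_ratio_def
  by (simp add: sum_divide_distrib mult_ac del: fact_Suc)

lemma simplices_Sd_0: "simplices (Sd 0 K) j = (`) vertex_point ` simplices K j"
  by (auto simp: simplices_def Sd_def card_image inj_on_subset[OF inj_vertex_point subset_UNIV])

lemma face_number_Sd_0: "face_number (Sd 0 K) j = face_number K j"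
  unfolding face_number_def simplices_Sd_0
  using inj_on_subset[OF inj_on_image_Pow[OF inj_vertex_point]] by (intro card_image) auto

text \<open>In the row \<open>j = n\<close> only \<open>i = n\<close> survives, with coefficient
  \<open>(n + 1)! / (n + 1)! = 1\<close>.\<close>

lemma face_density_top:
  assumes K: "abstract_complex K" "finite K" "\<forall>s\<in>K. card s \<le> n + 1"
  shows "face_density n K n d = real (face_number K n)"
proof (induction d)
  case (Suc d)
  have "face_density n K n (Suc d) = (\<Sum>i\<le>n. flag_ratio n i n * face_density n K i d)"
    by (rule face_density_Suc[OF K])
  also have "\<dots> = (\<Sum>i\<le>n. if i = n then face_density n K n d else 0)"
    by (intro sum.cong) (auto simp: flag_ratio_def flag_number_self flag_number_eq_0 simp del: fact_Suc)
  finally show ?case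
    using Suc by simp
qed (simp add: face_density_def face_number_Sd_0)

lemma face_density_limit:
  assumes K: "abstract_complex K" "finite K" "\<forall>s\<in>K. card s \<le> n + 1" and "j \<le> n"
  shows "face_density n K j \<longlonglongrightarrow> face_limit n j * real (face_number K n)"
proof (rule face_limit[where X = "face_density n K"])
  have "face_density n K n = (\<lambda>_. real (face_number K n))"
    using face_density_top[OF K] by blast
  then show "face_density n K n \<longlonglongrightarrow> real (face_number K n)"
    by simp
qed (use \<open>j \<le> n\<close> in \<open>simp_all add: face_density_Suc[OF K]\<close>)

lemma std_complex:
  shows "finite (std_complex n)" "abstract_complex (std_complex n)" "\<forall>s\<in>std_complex n. card s \<le> n + 1"
    and "simplices (std_complex n) n = {{..n}}"
proof -
  show "finite (std_complex n)"
    by (rule finite_subset[of _ "Pow {..n}"]) (auto simp: std_complex_def)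
  show "abstract_complex (std_complex n)"
    by (auto simp: abstract_complex_def std_complex_def intro: finite_subset)
  show "\<forall>s\<in>(std_complex n). card s \<le> n + 1"
    using card_mono[of "{..n}"] by (fastforce simp: std_complex_def)
  show "simplices (std_complex n) n = {{..n}}"
  proof
    show "simplices (std_complex n) n \<subseteq> {{..n}}"
    proof
      fix s assume "s \<in> simplices (std_complex n) n"
      then have "s \<subseteq> {..n}" "card s = card {..n}"
        by (auto simp: simplices_def std_complex_def)
      then have "s = {..n}"
        by (rule card_subset_eq[OF finite_atMost])
      then show "s \<in> {{..n}}"
        by simp
    qed
  qed (auto simp: simplices_def std_complex_def)
qed

text \<open>The limit measure is scaled by \<open>ennreal\<close> of a coefficient, which would
  truncate a negative value. The sign is read off from the face densities of the standard
  simplex.\<close>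

lemma face_limit_nonneg:
  assumes "j \<le> n"
  shows "0 \<le> face_limit n j"
proof -
  have "face_density n (std_complex n) j \<longlonglongrightarrow> face_limit n j"
    using face_density_limit[OF std_complex(2,1,3) assms] by (simp add: face_number_def std_complex(4))
  then show ?thesis
    by (rule LIMSEQ_le_const) (simp add: face_density_def)
qed

lemma q_limit_eq_face_limit:
  assumes "j \<le> n"
  shows "q_limit j n = face_limit n j"
  unfolding q_limit_def
proof (rule the_equality, intro allI impI)
  fix L :: "nat set set"
  assume L: "abstract_complex L \<and> finite L \<and> complex_of_dim n L"
  then have "face_density n L j \<longlonglongrightarrow> face_limit n j * real (face_number L n)"
    using assms by (intro face_density_limit) (auto simp: complex_of_dim_def)
  moreover have "real (face_number L n) \<noteq> 0"
    using L by (auto simp: complex_of_dim_def face_number_def simplices_def)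
  ultimately have "(\<lambda>d. face_density n L j d / real (face_number L n)) \<longlonglongrightarrow> face_limit n j"
    using tendsto_divide[of "face_density n L j" _ _ "\<lambda>_. real (face_number L n)"] by fastforce
  then show "(\<lambda>d. real (face_number (Sd d L) j) / (fact (n + 1) ^ d * real (face_number L n))) \<longlonglongrightarrow> face_limit n j"
    by (simp add: face_density_def del: fact_Suc)
next
  fix q assume q: "\<forall>L :: nat set set. abstract_complex L \<and> finite L \<and> complex_of_dim n L \<longrightarrow>
     (\<lambda>d. real (face_number (Sd d L) j) / (fact (n + 1) ^ d * real (face_number L n))) \<longlonglongrightarrow> q"
  \<comment> \<open>A single complex with one top simplex is enough to force the value of the
    \<open>THE\<close> description.\<close>
  let ?L = "std_complex n"
  note fin = std_complex(1) and abs = std_complex(2) and le = std_complex(3) and top = std_complex(4)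
  have "complex_of_dim n ?L"
    using le top by (simp add: complex_of_dim_def)
  then have "(\<lambda>d. real (face_number (Sd d ?L) j) / (fact (n + 1) ^ d * real (face_number ?L n))) \<longlonglongrightarrow> q"
    using q fin abs by blast
  moreover have "face_number ?L n = 1"
    by (simp add: face_number_def top)
  ultimately have "face_density n ?L j \<longlonglongrightarrow> q"
    by (simp add: face_density_def[abs_def] del: fact_Suc)
  moreover have "face_density n ?L j \<longlonglongrightarrow> face_limit n j"
    using face_density_limit[OF abs fin le assms] \<open>face_number ?L n = 1\<close> by simp
  ultimately show "q = face_limit n j"
    by (rule LIMSEQ_unique)
qed

section \<open>Mesh of iterated subdivisions\<close>

text \<open>The convex hull of a finite vertex set, written with explicit weights.\<close>

definition point_hull :: "('a \<Rightarrow> real) set \<Rightarrow> ('a \<Rightarrow> real) set" where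
  "point_hull \<rho> = {combination \<rho> w | w. (\<forall>p\<in>\<rho>. 0 \<le> w p) \<and> (\<Sum>p\<in>\<rho>. w p) = 1}"

lemma point_hullI:
  "(\<And>p. p \<in> \<rho> \<Longrightarrow> 0 \<le> w p) \<Longrightarrow> (\<Sum>p\<in>\<rho>. w p) = 1 \<Longrightarrow> combination \<rho> w \<in> point_hull \<rho>"
  by (auto simp: point_hull_def)

lemma barycenter_in_point_hull:
  assumes "finite \<rho>" "c \<subseteq> \<rho>" "c \<noteq> {}"
  shows "barycenter c \<in> point_hull \<rho>"
proof -
  have fin: "finite c"
    using assms finite_subset by blast
  let ?w = "\<lambda>p. if p \<in> c then 1 / real (card c) else 0"
  have sum: "(\<Sum>p\<in>\<rho>. ?w p * g p) = (\<Sum>p\<in>c. g p) / real (card c)" for g :: "_ \<Rightarrow> real"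
  proof -
    have "(\<Sum>p\<in>\<rho>. ?w p * g p) = (\<Sum>p\<in>c. ?w p * g p)"
      using assms by (intro sum.mono_neutral_right) auto
    then show ?thesis
      by (simp add: sum_divide_distrib)
  qed
  have "barycenter c = combination \<rho> ?w"
    unfolding combination_def sum by (simp add: barycenter_def)
  moreover have "(\<Sum>p\<in>\<rho>. ?w p) = 1"
    using sum[of "\<lambda>_. 1"] fin assms(3) by simp
  ultimately show ?thesis
    using point_hullI[of \<rho> ?w] by simp
qed

lemma mem_point_hull: "finite \<rho> \<Longrightarrow> p \<in> \<rho> \<Longrightarrow> p \<in> point_hull \<rho>"
  using barycenter_in_point_hull[of \<rho> "{p}"] by (simp add: barycenter_def)

lemma point_hull_mono:
  assumes fin: "finite \<rho>" and sub: "t \<subseteq> point_hull \<rho>"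
  shows "point_hull t \<subseteq> point_hull \<rho>"
proof
  fix x assume "x \<in> point_hull t"
  then obtain w where w: "x = combination t w" "\<And>p. p \<in> t \<Longrightarrow> 0 \<le> w p" "(\<Sum>p\<in>t. w p) = 1"
    by (auto simp: point_hull_def)
  have "\<forall>p\<in>t. \<exists>u. p = combination \<rho> u \<and> (\<forall>q\<in>\<rho>. 0 \<le> u q) \<and> (\<Sum>q\<in>\<rho>. u q) = 1"
    using sub by (auto simp: point_hull_def)
  then obtain U where U: "\<And>p. p \<in> t \<Longrightarrow> p = combination \<rho> (U p)"
      "\<And>p q. p \<in> t \<Longrightarrow> q \<in> \<rho> \<Longrightarrow> 0 \<le> U p q" "\<And>p. p \<in> t \<Longrightarrow> (\<Sum>q\<in>\<rho>. U p q) = 1"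
    by metis
  define u where "u q = (\<Sum>p\<in>t. w p * U p q)" for q
  have "x = combination \<rho> u"
  proof
    fix v
    have "x v = (\<Sum>p\<in>t. w p * combination \<rho> (U p) v)"
      unfolding w(1) combination_def[of t] using U(1) by (intro sum.cong) auto
    also have "\<dots> = (\<Sum>p\<in>t. \<Sum>q\<in>\<rho>. w p * U p q * q v)"
      by (simp add: combination_def sum_distrib_left mult.assoc)
    also have "\<dots> = (\<Sum>q\<in>\<rho>. \<Sum>p\<in>t. w p * U p q * q v)"
      by (rule sum.swap)
    also have "\<dots> = combination \<rho> u v"
      by (simp add: combination_def u_def sum_distrib_right)
    finally show "x v = combination \<rho> u v" .
  qed
  moreover have "(\<Sum>q\<in>\<rho>. u q) = 1"
  proof -
    have "(\<Sum>q\<in>\<rho>. u q) = (\<Sum>p\<in>t. \<Sum>q\<in>\<rho>. w p * U p q)"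
      unfolding u_def by (rule sum.swap)
    also have "\<dots> = (\<Sum>p\<in>t. w p)"
      using U(3) by (simp add: sum_distrib_left[symmetric])
    finally show ?thesis
      using w(3) by simp
  qed
  moreover have "0 \<le> u q" if "q \<in> \<rho>" for q
    unfolding u_def using w(2) U(2) that by (intro sum_nonneg) auto
  ultimately show "x \<in> point_hull \<rho>"
    using point_hullI[of \<rho> u] by simp
qed

lemma point_hull_subset_geom_simplex:
  assumes s: "finite s" and \<rho>: "\<rho> \<subseteq> geom_simplex s"
  shows "point_hull \<rho> \<subseteq> geom_simplex s"
proof
  fix x assume "x \<in> point_hull \<rho>"
  then obtain w where w: "x = combination \<rho> w" "\<And>p. p \<in> \<rho> \<Longrightarrow> 0 \<le> w p" "(\<Sum>p\<in>\<rho>. w p) = 1"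
    by (auto simp: point_hull_def)
  have nonneg: "0 \<le> p v" and zero: "v \<notin> s \<Longrightarrow> p v = 0" and one: "(\<Sum>v\<in>s. p v) = 1" if "p \<in> \<rho>" for p v
    using that \<rho> by (auto simp: geom_simplex_def)
  have "0 \<le> x v" for v
    unfolding w(1) combination_def using w(2) nonneg by (intro sum_nonneg) simp
  moreover have "x v = 0" if "v \<notin> s" for v
    unfolding w(1) combination_def using zero[OF _ that] by (intro sum.neutral) simp
  moreover have "(\<Sum>v\<in>s. x v) = 1"
  proof -
    have "(\<Sum>v\<in>s. x v) = (\<Sum>p\<in>\<rho>. \<Sum>v\<in>s. w p * p v)"
      unfolding w(1) combination_def by (rule sum.swap)
    also have "\<dots> = (\<Sum>p\<in>\<rho>. w p)"
      using one by (simp add: sum_distrib_left[symmetric])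
    finally show ?thesis
      using w(3) by simp
  qed
  ultimately show "x \<in> geom_simplex s"
    by (simp add: geom_simplex_def)
qed

text \<open>If all vertices have coordinate within \<open>\<delta>\<close> of a number, so has every
  convex combination. This is applied twice: to \<open>y\<close> and a vertex, then to
  \<open>x\<close> and \<open>y\<close>.\<close>

lemma point_hull_diameter:
  assumes osc: "\<And>p q. p \<in> \<rho> \<Longrightarrow> q \<in> \<rho> \<Longrightarrow> \<bar>p v - q v\<bar> \<le> \<delta>"
    and x: "x \<in> point_hull \<rho>" and y: "y \<in> point_hull \<rho>"
  shows "\<bar>x v - y v\<bar> \<le> \<delta>"
proof -
  have step: "\<bar>x v - b\<bar> \<le> \<delta>" if x: "x \<in> point_hull \<rho>" and b: "\<And>p. p \<in> \<rho> \<Longrightarrow> \<bar>p v - b\<bar> \<le> \<delta>" for x b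
  proof -
    obtain w where w: "x = combination \<rho> w" "\<And>p. p \<in> \<rho> \<Longrightarrow> 0 \<le> w p" "(\<Sum>p\<in>\<rho>. w p) = 1"
      using x by (auto simp: point_hull_def)
    have "x v - b = (\<Sum>p\<in>\<rho>. w p * p v) - (\<Sum>p\<in>\<rho>. w p) * b"
      using w(1,3) by (simp add: combination_def)
    also have "\<dots> = (\<Sum>p\<in>\<rho>. w p * (p v - b))"
      by (simp add: sum_distrib_right right_diff_distrib sum_subtractf)
    finally have "\<bar>x v - b\<bar> \<le> (\<Sum>p\<in>\<rho>. \<bar>w p * (p v - b)\<bar>)"
      using sum_abs[of "\<lambda>p. w p * (p v - b)" \<rho>] by simp
    also have "\<dots> \<le> (\<Sum>p\<in>\<rho>. w p * \<delta>)"
      using w(2) b by (intro sum_mono) (auto simp: abs_mult intro!: mult_left_mono)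
    also have "\<dots> = \<delta>"
      using w(3) by (simp add: sum_distrib_right[symmetric])
    finally show ?thesis .
  qed
  have "\<bar>y v - p v\<bar> \<le> \<delta>" if "p \<in> \<rho>" for p
    using step[OF y, of "p v"] osc that by blast
  then have "\<bar>p v - y v\<bar> \<le> \<delta>" if "p \<in> \<rho>" for p
    using that by (metis abs_minus_commute)
  then show ?thesis
    using step[OF x, of "y v"] by blast
qed

text \<open>The deviations from the barycenter of \<open>c\<close> cancel over \<open>c\<close>.
  With \<open>k = card c'\<close>, the difference is therefore \<open>1 / k\<close> times a sum of
  at most \<open>k - 1\<close> terms of size at most \<open>\<delta>\<close>, and
  \<open>(k - 1) / k\<close> increases with \<open>k\<close>.\<close>

lemma barycenter_chain_diff:
  assumes \<rho>: "finite \<rho>" "card \<rho> \<le> n + 1"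
    and osc: "\<And>p q. p \<in> \<rho> \<Longrightarrow> q \<in> \<rho> \<Longrightarrow> \<bar>p v - q v\<bar> \<le> \<delta>"
    and c: "c \<subseteq> c'" "c' \<subseteq> \<rho>" "c \<noteq> {}"
  shows "\<bar>barycenter c' v - barycenter c v\<bar> \<le> real n / (real n + 1) * \<delta>"
proof -
  define b where "b = barycenter c v"
  have fin: "finite c'" "finite c"
    using \<rho>(1) c finite_subset by metis+
  then have card: "0 < card c" "card c \<le> card c'" "card c' \<le> n + 1"
    using c \<rho> card_mono[of c' c] card_mono[of \<rho> c'] by (auto simp: card_gt_0_iff)
  have \<delta>: "0 \<le> \<delta>"
  proof -
    obtain p where "p \<in> \<rho>"
      using c by blast
    then show ?thesis
      using osc[of p p] by simp
  qed
  have b0: "(\<Sum>x\<in>c. x v - b) = 0"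
    using card(1) by (simp add: sum_subtractf b_def barycenter_def)
  have "real (card c') * (barycenter c' v - b) = (\<Sum>x\<in>c'. x v - b)"
    using card by (simp add: sum_subtractf barycenter_def right_diff_distrib)
  also have "\<dots> = (\<Sum>x\<in>c' - c. x v - b)"
    using sum.subset_diff[OF c(1) fin(1), of "\<lambda>x. x v - b"] b0 by simp
  finally have eq: "real (card c') * (barycenter c' v - b) = (\<Sum>x\<in>c' - c. x v - b)" .
  have "\<bar>\<Sum>x\<in>c' - c. x v - b\<bar> \<le> (\<Sum>x\<in>c' - c. \<bar>x v - b\<bar>)"
    by (rule sum_abs)
  also have "\<dots> \<le> (\<Sum>x\<in>c' - c. \<delta>)"
  proof (rule sum_mono)
    fix x assume "x \<in> c' - c"
    then have "x \<in> point_hull \<rho>"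
      using c(2) by (intro mem_point_hull[OF \<rho>(1)]) blast
    moreover have "barycenter c \<in> point_hull \<rho>"
      using c by (intro barycenter_in_point_hull[OF \<rho>(1)]) auto
    ultimately show "\<bar>x v - b\<bar> \<le> \<delta>"
      unfolding b_def using point_hull_diameter[of \<rho> v \<delta>] osc by blast
  qed
  also have "\<dots> = real (card c' - card c) * \<delta>"
    using fin c(1) by (simp add: card_Diff_subset)
  also have "\<dots> \<le> (real (card c') - 1) * \<delta>"
    using card \<delta> by (intro mult_right_mono) (auto simp: of_nat_diff)
  finally have "real (card c') * \<bar>barycenter c' v - b\<bar> \<le> (real (card c') - 1) * \<delta>"
    unfolding eq[symmetric] by (simp add: abs_mult)
  then have "\<bar>barycenter c' v - b\<bar> \<le> (real (card c') - 1) / real (card c') * \<delta>"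
    using card by (simp add: field_simps)
  also have "\<dots> \<le> real n / (real n + 1) * \<delta>"
  proof (rule mult_right_mono[OF _ \<delta>])
    have "(real (card c') - 1) / real (card c') = 1 - 1 / real (card c')"
      using card by (simp add: field_simps)
    also have "\<dots> \<le> 1 - 1 / (real n + 1)"
      using card by (intro diff_left_mono divide_left_mono) auto
    also have "\<dots> = real n / (real n + 1)"
      by (simp add: field_simps)
    finally show "(real (card c') - 1) / real (card c') \<le> real n / (real n + 1)" .
  qed
  finally show ?thesis
    by (simp add: b_def)
qed

text \<open>Initially all coordinates of vertices are \<open>0\<close> or \<open>1\<close>. Two
  vertices of a new simplex are barycenters of nested faces of one old simplex, so each subdivision
  contributes a factor \<open>n / (n + 1)\<close>, uniformly in the coordinate.\<close>

lemma mesh_Sd: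
  assumes K: "abstract_complex K" "\<forall>s\<in>K. card s \<le> n + 1"
    and "\<rho> \<in> Sd d K" "p \<in> \<rho>" "q \<in> \<rho>"
  shows "\<bar>p v - q v\<bar> \<le> (real n / (real n + 1)) ^ d"
  using assms(3-5)
proof (induction d arbitrary: \<rho> p q)
  case 0
  then show ?case
    by (auto simp: Sd_def vertex_point_def indicator_def)
next
  case (Suc d)
  then obtain C where C: "\<rho> = barycenter ` C" "C \<subseteq> Sd d K" "finite C" "C \<noteq> {}" "chain_set C"
    by (auto simp: Sd_Suc mem_subdivision)
  note geo = geometric_complex_simplex[OF geometric_complex_Sd[OF K(1)]]
  have U: "\<Union>C \<in> Sd d K"
    using Union_chain_mem[OF C(3,4,5)] C(2) by blast
  obtain c c' where c: "p = barycenter c" "q = barycenter c'" "c \<in> C" "c' \<in> C"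
    using Suc.prems C(1) by blast
  have ne: "c \<noteq> {}" "c' \<noteq> {}"
    using c C(2) geo(2) by blast+
  have "c \<subseteq> c' \<or> c' \<subseteq> c"
    using c C(5) by (auto simp: chain_set_def)
  then have "\<bar>p v - q v\<bar> \<le> real n / (real n + 1) * (real n / (real n + 1)) ^ d"
  proof
    assume "c \<subseteq> c'"
    then have "\<bar>q v - p v\<bar> \<le> real n / (real n + 1) * (real n / (real n + 1)) ^ d"
      unfolding c(1,2) using ne c
      by (intro barycenter_chain_diff[of "\<Union>C"] geo(1)[OF U] card_Sd_le[OF K U] Suc.IH[OF U]) auto
    then show ?thesis
      by (simp add: abs_minus_commute)
  next
    assume "c' \<subseteq> c"
    then show ?thesis
      unfolding c(1,2) using ne c
      by (intro barycenter_chain_diff[of "\<Union>C"] geo(1)[OF U] card_Sd_le[OF K U] Suc.IH[OF U]) auto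
  qed
  then show ?case
    by simp
qed

section \<open>Carriers, affine coordinates and small oscillation\<close>

definition faces :: "'v set \<Rightarrow> 'v set set" where
  "faces s = {t. t \<subseteq> s \<and> t \<noteq> {}}"

lemma abstract_complex_faces: "finite s \<Longrightarrow> abstract_complex (faces s)"
  by (auto simp: abstract_complex_def faces_def intro: finite_subset)

lemma Sd_mono: "K \<subseteq> L \<Longrightarrow> Sd d K \<subseteq> Sd d L"
proof (induction d)
  case (Suc d)
  then have sub: "Sd d K \<subseteq> Sd d L"
    by blast
  show ?case
  proof
    fix \<tau> assume "\<tau> \<in> Sd (Suc d) K"
    then obtain C where "\<tau> = barycenter ` C" "C \<subseteq> Sd d K" "finite C" "C \<noteq> {}" "chain_set C"
      by (auto simp: Sd_Suc mem_subdivision)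
    then show "\<tau> \<in> Sd (Suc d) L"
      unfolding Sd_Suc mem_subdivision using sub by blast
  qed
qed (auto simp: Sd_def)

text \<open>A simplex carrying the union of the chain carries the new simplex, since all members of
  the chain are faces of that union.\<close>

lemma Sd_carrier:
  assumes K: "abstract_complex K" and "\<rho> \<in> Sd d K"
  shows "\<exists>s\<in>K. \<rho> \<in> Sd d (faces s)"
  using assms(2)
proof (induction d arbitrary: \<rho>)
  case 0
  then obtain s where "s \<in> K" "\<rho> = vertex_point ` s"
    by (auto simp: Sd_def)
  moreover have "s \<noteq> {}"
    using K \<open>s \<in> K\<close> by (auto simp: abstract_complex_def)
  ultimately show ?case
    by (auto simp: Sd_def faces_def)
next
  case (Suc d)
  then obtain C where C: "\<rho> = barycenter ` C" "C \<subseteq> Sd d K" "finite C" "C \<noteq> {}" "chain_set C"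
    by (auto simp: Sd_Suc mem_subdivision)
  have "\<Union>C \<in> Sd d K"
    using Union_chain_mem[OF C(3,4,5)] C(2) by blast
  then obtain s where s: "s \<in> K" "\<Union>C \<in> Sd d (faces s)"
    using Suc.IH by blast
  then have "finite s"
    using K by (simp add: abstract_complex_def)
  have "C \<subseteq> Sd d (faces s)"
  proof
    fix c assume c: "c \<in> C"
    then have "c \<noteq> {}"
      using C(2) geometric_complex_simplex(2)[OF geometric_complex_Sd[OF K]] by blast
    then show "c \<in> Sd d (faces s)"
      using c geometric_complex_simplex(3)[OF geometric_complex_Sd[OF abstract_complex_faces[OF \<open>finite s\<close>]] s(2)]
      by blast
  qed
  then have "\<rho> \<in> Sd (Suc d) (faces s)"
    unfolding Sd_Suc mem_subdivision using C by blast
  then show ?case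
    using s(1) by blast
qed

lemma Sd_faces_subset:
  assumes "finite s" "\<rho> \<in> Sd d (faces s)"
  shows "\<rho> \<subseteq> geom_simplex s"
  using assms(2)
proof (induction d arbitrary: \<rho>)
  case 0
  then obtain t where t: "t \<subseteq> s" "\<rho> = vertex_point ` t"
    by (auto simp: Sd_def faces_def)
  have "vertex_point a \<in> geom_simplex s" if "a \<in> s" for a
    using that assms(1) by (auto simp: geom_simplex_def vertex_point_def indicator_def)
  then show ?case
    using t by blast
next
  case (Suc d)
  then obtain C where C: "\<rho> = barycenter ` C" "C \<subseteq> Sd d (faces s)"
    by (auto simp: Sd_Suc mem_subdivision)
  have "barycenter c \<in> geom_simplex s" if "c \<in> C" for c
  proof -
    have c: "c \<in> Sd d (faces s)"
      using that C(2) by blast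
    then have "barycenter c \<in> point_hull c"
      using geometric_complex_simplex(1,2)[OF geometric_complex_Sd[OF abstract_complex_faces[OF assms(1)]] c]
      by (intro barycenter_in_point_hull) auto
    then show ?thesis
      using point_hull_subset_geom_simplex[OF assms(1) Suc.IH[OF c]] by blast
  qed
  then show ?case
    using C(1) by blast
qed

text \<open>The metric on sequences weights the coordinates by powers of \<open>1 / 2\<close>, and
  these weights sum to \<open>2\<close>.\<close>

lemma dist_nat_fun_le:
  fixes x y :: "nat \<Rightarrow> real"
  assumes "\<And>i. \<bar>x i - y i\<bar> \<le> \<delta>"
  shows "dist x y \<le> 2 * \<delta>"
proof -
  have "(\<Sum>n. (1 / 2) ^ n * min (dist (x (from_nat n)) (y (from_nat n))) 1) \<le> (\<Sum>n. (1 / 2) ^ n * \<delta>)"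
  proof (rule suminf_le)
    show "(1 / 2) ^ n * min (dist (x (from_nat n)) (y (from_nat n))) 1 \<le> (1 / 2) ^ n * \<delta>" for n :: nat
      using assms[of "from_nat n"] by (intro mult_left_mono) (auto simp: dist_real_def min_le_iff_disj)
    show "summable (\<lambda>n. (1 / 2) ^ n * min (dist (x (from_nat n)) (y (from_nat n))) 1)"
      by (rule summable_comparison_test'[of "\<lambda>n. (1/2)^n"]) (auto simp: summable_geometric_iff)
    show "summable (\<lambda>n. (1 / 2 :: real) ^ n * \<delta>)"
      by (intro summable_mult2) (simp add: summable_geometric_iff)
  qed
  also have "(\<Sum>n. (1 / 2) ^ n * \<delta>) = (\<Sum>n. (1 / 2) ^ n) * \<delta>"
    by (intro suminf_mult2[symmetric]) (simp add: summable_geometric_iff)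
  also have "\<dots> = 2 * \<delta>"
    by (simp add: suminf_geometric)
  finally show ?thesis
    by (simp add: dist_fun_def)
qed

text \<open>Unlike in \<open>affine_extension\<close>, the vertices may go to arbitrary points, as
  they must for the simplices of a subdivision.\<close>

definition affine_map :: "nat \<Rightarrow> (nat \<Rightarrow> 'a \<Rightarrow> real) \<Rightarrow> (nat \<Rightarrow> real) \<Rightarrow> 'a \<Rightarrow> real" where
  "affine_map n \<psi> x = (\<lambda>v. \<Sum>i\<le>n. x i * \<psi> i v)"

lemma affine_extension_eq: "affine_extension n \<phi> = affine_map n (\<lambda>i. vertex_point (\<phi> i))"
  by (simp add: affine_extension_def affine_map_def fun_eq_iff)

lemma continuous_on_affine_map: "continuous_on A (affine_map n \<psi>)"
  unfolding affine_map_def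
  by (intro continuous_on_coordinatewise_then_product continuous_intros
      continuous_on_subset[OF continuous_on_product_coordinates]) auto

lemma affine_map_in_point_hull:
  assumes \<psi>: "bij_betw \<psi> {..n} \<rho>" and x: "x \<in> geom_simplex {..n}"
  shows "affine_map n \<psi> x \<in> point_hull \<rho>"
proof -
  define w where "w p = x (inv_into {..n} \<psi> p)" for p
  have w: "w (\<psi> i) = x i" if "i \<le> n" for i
    using \<psi> that by (simp add: w_def bij_betw_def inv_into_f_f)
  have sum: "(\<Sum>p\<in>\<rho>. w p * g p) = (\<Sum>i\<le>n. x i * g (\<psi> i))" for g :: "_ \<Rightarrow> real"
    using w by (subst sum.reindex_bij_betw[OF \<psi>, symmetric]) simp
  have "affine_map n \<psi> x = combination \<rho> w"
    unfolding combination_def affine_map_def sum ..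
  moreover have "(\<Sum>p\<in>\<rho>. w p) = 1"
    using sum[of "\<lambda>_. 1"] x by (simp add: geom_simplex_def)
  moreover have "0 \<le> w p" for p
    using x by (simp add: w_def geom_simplex_def)
  ultimately show ?thesis
    using point_hullI[of \<rho> w] by simp
qed

text \<open>For uncountable \<open>'a\<close> the product topology is not metrizable. The simplex is
  therefore transported to the standard one over \<open>nat\<close>, where compactness gives uniform
  continuity for a metric.\<close>

lemma uniformly_continuous_geom_simplex:
  fixes f :: "('a \<Rightarrow> real) \<Rightarrow> real"
  assumes s: "finite s" "s \<noteq> {}" and f: "continuous_on (geom_simplex s) f" and "0 < \<epsilon>"
  shows "\<exists>\<delta>>0. \<forall>x\<in>geom_simplex s. \<forall>y\<in>geom_simplex s. (\<forall>v. \<bar>x v - y v\<bar> \<le> \<delta>) \<longrightarrow> \<bar>f x - f y\<bar> < \<epsilon>"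
proof -
  obtain m where m: "card s = Suc m"
    using s by (metis card_eq_0_iff not0_implies_Suc)
  then obtain e where e: "bij_betw e {..m} s"
    using finite_same_card_bij[OF finite_atMost s(1), of m] by auto
  \<comment> \<open>\<open>Z\<close> reads off barycentric coordinates in the order
    \<open>e\<close>, and \<open>A\<close> rebuilds the point from them.\<close>
  define A where "A = affine_map m (\<lambda>i. vertex_point (e i))"
  define Z where "Z x i = (if i \<le> m then x (e i) else 0)" for x :: "'a \<Rightarrow> real" and i
  have sumZ: "(\<Sum>i\<le>m. Z x i * g (e i)) = (\<Sum>v\<in>s. x v * g v)" for x and g :: "'a \<Rightarrow> real"
    by (simp add: Z_def sum.reindex_bij_betw[OF e, of "\<lambda>v. x v * g v", symmetric])
  have Z: "Z x \<in> geom_simplex {..m}" if "x \<in> geom_simplex s" for x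
    using that sumZ[of x "\<lambda>_. 1"] by (auto simp: geom_simplex_def Z_def)
  have AZ: "A (Z x) = x" if "x \<in> geom_simplex s" for x
  proof
    fix v
    have "A (Z x) v = (\<Sum>a\<in>s. x a * vertex_point a v)"
      unfolding A_def affine_map_def by (rule sumZ)
    also have "\<dots> = (\<Sum>a\<in>s. if a = v then x v else 0)"
      by (intro sum.cong) (auto simp: vertex_point_def)
    also have "\<dots> = x v"
      using s that by (simp add: geom_simplex_def)
    finally show "A (Z x) v = x v" .
  qed
  have Ain: "A z \<in> geom_simplex s" if "z \<in> geom_simplex {..m}" for z
  proof -
    note vp = inj_vertex_point
    have "bij_betw (vertex_point \<circ> e) {..m} (vertex_point ` s)"
      using e by (rule bij_betw_trans) (simp add: bij_betw_def inj_on_subset[OF vp subset_UNIV])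
    then have "A z \<in> point_hull (vertex_point ` s)"
      unfolding A_def using that by (intro affine_map_in_point_hull) (simp_all add: comp_def)
    moreover have "vertex_point ` s \<subseteq> geom_simplex s"
      using s by (intro Sd_faces_subset[where d = 0]) (auto simp: Sd_def faces_def)
    ultimately show ?thesis
      using point_hull_subset_geom_simplex[OF s(1)] by blast
  qed
  have "continuous_on (geom_simplex {..m}) (\<lambda>z. f (A z))"
    by (rule continuous_on_compose2[OF f continuous_on_affine_map[of _ m "\<lambda>i. vertex_point (e i)", folded A_def]])
      (use Ain in blast)
  then have "uniformly_continuous_on (geom_simplex {..m}) (\<lambda>z. f (A z))"
    using compact_uniformly_continuous compact_geom_simplex_nat by blast
  then obtain \<eta> where \<eta>: "0 < \<eta>"
    "\<And>z z'. z \<in> geom_simplex {..m} \<Longrightarrow> z' \<in> geom_simplex {..m} \<Longrightarrow> dist z' z < \<eta> \<Longrightarrow> dist (f (A z')) (f (A z)) < \<epsilon>"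
    using \<open>0 < \<epsilon>\<close> unfolding uniformly_continuous_on_def by metis
  show ?thesis
  \<comment> \<open>Coordinates within \<open>\<eta> / 3\<close> give distance at most
    \<open>2 * \<eta> / 3\<close>, which is strictly less than \<open>\<eta>\<close>.\<close>
  proof (intro exI[of _ "\<eta> / 3"] conjI ballI impI)
    fix x y assume xy: "x \<in> geom_simplex s" "y \<in> geom_simplex s" "\<forall>v. \<bar>x v - y v\<bar> \<le> \<eta> / 3"
    have "dist (Z x) (Z y) \<le> 2 * (\<eta> / 3)"
      using xy(3) \<eta>(1) by (intro dist_nat_fun_le) (simp add: Z_def)
    then have "dist (f (A (Z x))) (f (A (Z y))) < \<epsilon>"
      using \<eta>(1) by (intro \<eta>(2) Z xy) simp
    then show "\<bar>f x - f y\<bar> < \<epsilon>"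
      using xy by (simp add: AZ dist_real_def)
  qed (use \<eta>(1) in simp)
qed

text \<open>Every closed simplex has its own modulus of continuity. Only the finitely many simplices
  in \<open>K0\<close> impose a condition on \<open>d\<close>, because \<open>f\<close> vanishes
  identically on the others.\<close>

lemma small_oscillation_Sd:
  fixes f :: "('a \<Rightarrow> real) \<Rightarrow> real"
  assumes K: "abstract_complex K" "\<forall>s\<in>K. card s \<le> n + 1"
    and f: "\<And>s. s \<in> K \<Longrightarrow> continuous_on (geom_simplex s) f"
    and K0: "finite K0" "\<And>s x. s \<in> K \<Longrightarrow> x \<in> geom_simplex s \<Longrightarrow> f x \<noteq> 0 \<Longrightarrow> s \<in> K0"
    and "0 < \<epsilon>"
  shows "\<forall>\<^sub>F d in sequentially. \<forall>\<rho>\<in>Sd d K. \<forall>x\<in>point_hull \<rho>. \<forall>y\<in>point_hull \<rho>. \<bar>f x - f y\<bar> < \<epsilon>"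
proof -
  have simplex: "finite s" "s \<noteq> {}" if "s \<in> K" for s
    using that K(1) by (auto simp: abstract_complex_def)
  have "\<forall>s\<in>K. \<exists>\<delta>>0. \<forall>x\<in>geom_simplex s. \<forall>y\<in>geom_simplex s. (\<forall>v. \<bar>x v - y v\<bar> \<le> \<delta>) \<longrightarrow> \<bar>f x - f y\<bar> < \<epsilon>"
    using uniformly_continuous_geom_simplex[OF simplex f \<open>0 < \<epsilon>\<close>] by blast
  then obtain \<delta> where \<delta>: "\<And>s. s \<in> K \<Longrightarrow> 0 < \<delta> s"
    "\<And>s x y. s \<in> K \<Longrightarrow> x \<in> geom_simplex s \<Longrightarrow> y \<in> geom_simplex s \<Longrightarrow> (\<forall>v. \<bar>x v - y v\<bar> \<le> \<delta> s) \<Longrightarrow> \<bar>f x - f y\<bar> < \<epsilon>"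
    by metis
  have "(\<lambda>d. (real n / (real n + 1)) ^ d) \<longlonglongrightarrow> 0"
    by (rule LIMSEQ_power_zero) simp
  then have "\<forall>\<^sub>F d in sequentially. (real n / (real n + 1)) ^ d < \<delta> s" if "s \<in> K" for s
    using \<delta>(1)[OF that] by (rule order_tendstoD(2))
  then have "\<forall>\<^sub>F d in sequentially. \<forall>s\<in>K0 \<inter> K. (real n / (real n + 1)) ^ d < \<delta> s"
    using K0(1) by (intro eventually_ball_finite) auto
  then show ?thesis
  proof eventually_elim
    case (elim d)
    show ?case
    proof (intro ballI)
      fix \<rho> x y assume *: "\<rho> \<in> Sd d K" "x \<in> point_hull \<rho>" "y \<in> point_hull \<rho>"
      obtain s where s: "s \<in> K" "\<rho> \<in> Sd d (faces s)"
        using Sd_carrier[OF K(1) *(1)] by blast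
      have xy: "x \<in> geom_simplex s" "y \<in> geom_simplex s"
        using * point_hull_subset_geom_simplex[OF simplex(1)[OF s(1)] Sd_faces_subset[OF simplex(1)[OF s(1)] s(2)]] by blast+
      have osc: "\<bar>x v - y v\<bar> \<le> (real n / (real n + 1)) ^ d" for v
        using mesh_Sd[OF K *(1)] *(2,3) by (rule point_hull_diameter)
      show "\<bar>f x - f y\<bar> < \<epsilon>"
      proof (cases "f x = 0 \<and> f y = 0")
        case False
        then have "s \<in> K0"
          using K0(2)[OF s(1)] xy by blast
        then have "(real n / (real n + 1)) ^ d < \<delta> s"
          using elim s(1) by blast
        then have "\<bar>x v - y v\<bar> \<le> \<delta> s" for v
          using osc[of v] by linarith
        then show ?thesis
          using \<delta>(2)[OF s(1) xy] by blast
      qed (use \<open>0 < \<epsilon>\<close> in simp)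
    qed
  qed
qed

section \<open>Averages over barycenters\<close>

text \<open>The average of \<open>f\<close> over the simplex spanned by \<open>\<rho>\<close>. For
  continuous \<open>f\<close> it is independent of the chosen enumeration by
  \<open>simplex_mean_eq\<close>.\<close>

definition simplex_mean :: "nat \<Rightarrow> (('a \<Rightarrow> real) \<Rightarrow> real) \<Rightarrow> ('a \<Rightarrow> real) set \<Rightarrow> real" where
  "simplex_mean n f \<rho> = (\<integral>x. f (affine_map n (SOME \<psi>. bij_betw \<psi> {..n} \<rho>) x) \<partial>vol_std n)"

lemma affine_map_permute:
  assumes "\<pi> permutes {..n}"
  shows "affine_map n (\<lambda>i. \<psi> (\<pi> i)) x = affine_map n \<psi> (x \<circ> inv \<pi>)"
proof
  fix v
  have "(\<Sum>i\<le>n. x i * \<psi> (\<pi> i) v) = (\<Sum>i\<le>n. x (inv \<pi> (\<pi> i)) * \<psi> (\<pi> i) v)"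
    using permutes_inverses(2)[OF assms] by simp
  also have "\<dots> = (\<Sum>j\<le>n. x (inv \<pi> j) * \<psi> j v)"
    using permutes_imp_bij[OF assms] by (rule sum.reindex_bij_betw)
  finally show "affine_map n (\<lambda>i. \<psi> (\<pi> i)) x v = affine_map n \<psi> (x \<circ> inv \<pi>) v"
    by (simp add: affine_map_def)
qed

lemma affine_map_cong: "(\<And>i. i \<le> n \<Longrightarrow> \<psi> i = \<psi>' i) \<Longrightarrow> affine_map n \<psi> x = affine_map n \<psi>' x"
  by (simp add: affine_map_def)

lemma continuous_on_affine_compose:
  assumes f: "continuous_on (point_hull \<rho>) f" and \<psi>: "bij_betw \<psi> {..n} \<rho>"
  shows "continuous_on (geom_simplex {..n}) (\<lambda>x. f (affine_map n \<psi> x))"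
  by (rule continuous_on_compose2[OF f continuous_on_affine_map])
    (use affine_map_in_point_hull[OF \<psi>] in blast)

text \<open>Two enumerations of the vertices differ by a permutation of \<open>{..n}\<close>, under
  which the normalized volume is invariant.\<close>

lemma simplex_mean_eq:
  assumes f: "continuous_on (point_hull \<rho>) f" and \<psi>: "bij_betw \<psi> {..n} \<rho>"
  shows "simplex_mean n f \<rho> = (\<integral>x. f (affine_map n \<psi> x) \<partial>vol_std n)"
proof -
  define \<psi>0 where "\<psi>0 = (SOME \<psi>. bij_betw \<psi> {..n} \<rho>)"
  have \<psi>0: "bij_betw \<psi>0 {..n} \<rho>"
    unfolding \<psi>0_def using someI[where P = "\<lambda>\<psi>. bij_betw \<psi> {..n} \<rho>", OF \<psi>] .
  define \<pi> where "\<pi> i = (if i \<le> n then inv_into {..n} \<psi>0 (\<psi> i) else i)" for i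
  have "bij_betw (inv_into {..n} \<psi>0 \<circ> \<psi>) {..n} {..n}"
    using \<psi> bij_betw_inv_into[OF \<psi>0] by (rule bij_betw_trans)
  then have "bij_betw \<pi> {..n} {..n}"
    by (rule bij_betw_cong[THEN iffD1, rotated]) (simp add: \<pi>_def)
  then have \<pi>: "\<pi> permutes {..n}"
    by (rule bij_imp_permutes) (simp add: \<pi>_def)
  have "\<psi>0 (\<pi> i) = \<psi> i" if "i \<le> n" for i
  proof -
    have "\<psi> i \<in> \<psi>0 ` {..n}"
      using that \<psi> \<psi>0 by (auto simp: bij_betw_def)
    then show ?thesis
      using that by (simp add: \<pi>_def f_inv_into_f)
  qed
  then have "affine_map n \<psi> x = affine_map n \<psi>0 (x \<circ> inv \<pi>)" for x
    unfolding affine_map_permute[OF \<pi>, symmetric] by (intro affine_map_cong) simp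
  then have "(\<integral>x. f (affine_map n \<psi> x) \<partial>vol_std n) = (\<integral>x. f (affine_map n \<psi>0 (x \<circ> inv \<pi>)) \<partial>vol_std n)"
    by simp
  also have "\<dots> = (\<integral>x. f (affine_map n \<psi>0 x) \<partial>vol_std n)"
    by (rule integral_vol_std_permute[OF permutes_inv[OF \<pi>] continuous_on_affine_compose[OF f \<psi>0]])
  finally show ?thesis
    by (simp add: simplex_mean_def \<psi>0_def)
qed

text \<open>This joins the coordinate formula to the geometry: precomposition with
  \<open>flag_map\<close> parametrizes the cell that belongs to the flag of initial
  segments.\<close>

lemma affine_map_flag_map:
  assumes \<phi>: "inj_on \<phi> {..n}"
  shows "affine_map n \<phi> (flag_map n x) = affine_map n (\<lambda>k. barycenter (\<phi> ` {..k})) x"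
proof
  fix v
  have "affine_map n \<phi> (flag_map n x) v = (\<Sum>j\<le>n. \<Sum>k=j..n. x k / (real k + 1) * \<phi> j v)"
    by (simp add: affine_map_def flag_map_def sum_distrib_right)
  also have "\<dots> = (\<Sum>k\<le>n. \<Sum>j\<le>k. x k / (real k + 1) * \<phi> j v)"
    by (rule sum_triangle)
  also have "\<dots> = (\<Sum>k\<le>n. x k * barycenter (\<phi> ` {..k}) v)"
  proof (rule sum.cong)
    fix k assume "k \<in> {..n}"
    then have inj: "inj_on \<phi> {..k}"
      by (intro inj_on_subset[OF \<phi>]) auto
    then have "barycenter (\<phi> ` {..k}) v = (\<Sum>j\<le>k. \<phi> j v) / (real k + 1)"
      by (simp add: barycenter_def sum.reindex card_image add.commute)
    then show "(\<Sum>j\<le>k. x k / (real k + 1) * \<phi> j v) = x k * barycenter (\<phi> ` {..k}) v"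
      by (simp add: sum_distrib_left sum_divide_distrib)
  qed simp
  finally show "affine_map n \<phi> (flag_map n x) v = affine_map n (\<lambda>k. barycenter (\<phi> ` {..k})) x v"
    by (simp add: affine_map_def)
qed

text \<open>The cells in \<open>integral_vol_std_subdivide\<close> are indexed by permutations;
  passing to maximal flags makes them the top simplices of the subdivision.\<close>

lemma simplex_mean_subdivide:
  assumes L: "geometric_complex L" and \<rho>: "\<rho> \<in> simplices L n" and f: "continuous_on (point_hull \<rho>) f"
  shows "simplex_mean n f \<rho> = (\<Sum>C\<in>flags \<rho> n. simplex_mean n f (barycenter ` C)) / fact (n + 1)"
proof -
  have \<rho>L: "\<rho> \<in> L" and card: "card \<rho> = n + 1"
    using \<rho> by (auto simp: simplices_def)
  have fin: "finite \<rho>"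
    using geometric_complex_simplex(1)[OF L \<rho>L] .
  obtain \<phi> where \<phi>: "bij_betw \<phi> {..n} \<rho>"
    using finite_same_card_bij[OF finite_atMost fin, of n] card by auto
  let ?C = "\<lambda>\<pi>. (\<lambda>k. \<phi> ` \<pi> ` {..k}) ` {..n}"
  have flag_mean: "(\<integral>x. f (affine_map n \<phi> (flag_map n x \<circ> inv \<pi>)) \<partial>vol_std n) = simplex_mean n f (barycenter ` ?C \<pi>)"
    if \<pi>: "\<pi> permutes {..n}" for \<pi>
  proof -
    let ?\<psi> = "\<lambda>k. barycenter (\<phi> ` \<pi> ` {..k})"
    have C: "?C \<pi> \<in> flags \<rho> n"
      using bij_betw_permutations_flags[OF \<phi>] \<pi> by (auto simp: bij_betw_def)
    have CL: "?C \<pi> \<subseteq> L"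
      using C geometric_complex_simplex(3)[OF L \<rho>L] unfolding flags_def by blast
    have img: "?\<psi> ` {..n} = barycenter ` ?C \<pi>"
      by (simp add: image_image)
    have "card (?\<psi> ` {..n}) = n + 1"
      unfolding img using card_image[OF inj_on_subset[OF inj_on_barycenter[OF L] CL]] flagsD(6)[OF C] by simp
    then have "inj_on ?\<psi> {..n}"
      by (intro eq_card_imp_inj_on) auto
    then have \<psi>: "bij_betw ?\<psi> {..n} (barycenter ` ?C \<pi>)"
      unfolding bij_betw_def img by simp
    have "point_hull (barycenter ` ?C \<pi>) \<subseteq> point_hull \<rho>"
    proof (rule point_hull_mono[OF fin], clarify)
      fix k assume "k \<le> n"
      then have "\<phi> ` \<pi> ` {..k} \<in> ?C \<pi>"
        by blast
      moreover have "?C \<pi> \<subseteq> Pow \<rho> - {{}}"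
        using C unfolding flags_def by blast
      ultimately show "barycenter (\<phi> ` \<pi> ` {..k}) \<in> point_hull \<rho>"
        by (intro barycenter_in_point_hull[OF fin]) blast+
    qed
    then have cont: "continuous_on (point_hull (barycenter ` ?C \<pi>)) f"
      by (rule continuous_on_subset[OF f])
    have inj: "inj_on (\<lambda>i. \<phi> (\<pi> i)) {..n}"
      using bij_betw_trans[OF permutes_imp_bij[OF \<pi>] \<phi>] by (simp add: bij_betw_def comp_def)
    have "affine_map n \<phi> (flag_map n x \<circ> inv \<pi>) = affine_map n ?\<psi> x" for x
      using affine_map_flag_map[OF inj, of x] affine_map_permute[OF \<pi>, of \<phi> "flag_map n x"]
      by (simp add: image_image)
    then show ?thesis
      using simplex_mean_eq[OF cont \<psi>] by simp
  qed
  have "simplex_mean n f \<rho> = (\<integral>x. f (affine_map n \<phi> x) \<partial>vol_std n)"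
    by (rule simplex_mean_eq[OF f \<phi>])
  also have "\<dots> = (\<Sum>\<pi> | \<pi> permutes {..n}. (\<integral>x. f (affine_map n \<phi> (flag_map n x \<circ> inv \<pi>)) \<partial>vol_std n)) / fact (n + 1)"
    by (rule integral_vol_std_subdivide[OF continuous_on_affine_compose[OF f \<phi>]])
  also have "(\<Sum>\<pi> | \<pi> permutes {..n}. (\<integral>x. f (affine_map n \<phi> (flag_map n x \<circ> inv \<pi>)) \<partial>vol_std n))
      = (\<Sum>\<pi> | \<pi> permutes {..n}. simplex_mean n f (barycenter ` ?C \<pi>))"
    by (intro sum.cong flag_mean) auto
  also have "\<dots> = (\<Sum>C\<in>flags \<rho> n. simplex_mean n f (barycenter ` C))"
    by (rule sum.reindex_bij_betw[OF bij_betw_permutations_flags[OF \<phi>]])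
  finally show ?thesis .
qed

lemma simplex_mean_close:
  assumes \<rho>: "finite \<rho>" "card \<rho> = n + 1" and f: "continuous_on (point_hull \<rho>) f"
    and osc: "\<And>x y. x \<in> point_hull \<rho> \<Longrightarrow> y \<in> point_hull \<rho> \<Longrightarrow> \<bar>f x - f y\<bar> \<le> \<epsilon>"
    and y: "y \<in> point_hull \<rho>"
  shows "\<bar>simplex_mean n f \<rho> - f y\<bar> \<le> \<epsilon>"
proof -
  interpret prob_space "vol_std n"
    by (rule prob_space_vol_std)
  obtain \<phi> where \<phi>: "bij_betw \<phi> {..n} \<rho>"
    using finite_same_card_bij[OF finite_atMost \<rho>(1), of n] \<rho>(2) by auto
  let ?h = "\<lambda>x. f (affine_map n \<phi> x)"
  have h: "integrable (vol_std n) ?h"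
    by (rule integrable_vol_std[OF continuous_on_affine_compose[OF f \<phi>]])
  have "simplex_mean n f \<rho> - f y = (\<integral>x. ?h x - f y \<partial>vol_std n)"
    using h by (simp add: simplex_mean_eq[OF f \<phi>] prob_space)
  also have "\<bar>\<dots>\<bar> \<le> (\<integral>x. \<bar>?h x - f y\<bar> \<partial>vol_std n)"
    by (rule integral_abs_bound)
  also have "\<dots> \<le> (\<integral>x. \<epsilon> \<partial>vol_std n)"
    using h osc[OF affine_map_in_point_hull[OF \<phi>] y] by (intro integral_mono) (auto simp: space_vol_std)
  also have "\<dots> = \<epsilon>"
    by (simp add: prob_space)
  finally show ?thesis .
qed

lemma ex_small_factor:
  fixes r M :: real
  assumes "0 < r"
  shows "\<exists>\<epsilon>>0. \<bar>M\<bar> * \<epsilon> < r"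
proof (intro exI conjI)
  have pos: "0 < \<bar>M\<bar> + 1"
    by simp
  then show "0 < r / (\<bar>M\<bar> + 1)"
    using assms by simp
  have "\<bar>M\<bar> * r < r * (\<bar>M\<bar> + 1)"
    using assms by (simp add: distrib_left mult.commute)
  then show "\<bar>M\<bar> * (r / (\<bar>M\<bar> + 1)) < r"
    using pos by (simp add: pos_divide_less_eq)
qed

text \<open>Locating every simplex of the finer subdivision at the barycenter of the simplex whose interior
  contains it turns the face counting recursion into one for the barycenter sums; the error is
  controlled by the oscillation of \<open>f\<close>.\<close>

lemma barycenter_sum_limit:
  assumes K: "abstract_complex K" "finite K" "\<forall>s\<in>K. card s \<le> n + 1" and j: "j \<le> n"
    and f: "\<And>s. s \<in> K \<Longrightarrow> continuous_on (geom_simplex s) f"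
  shows "(\<lambda>d. (\<Sum>\<tau>\<in>simplices (Sd d K) j. f (barycenter \<tau>)) / fact (n + 1) ^ d)
    \<longlonglongrightarrow> face_limit n j * (\<Sum>\<rho>\<in>simplices (Sd 0 K) n. simplex_mean n f \<rho>)"
proof -
  define c :: real where "c = fact (n + 1)"
  have c: "0 < c"
    unfolding c_def by (rule fact_gt_zero)
  define G where "G j d = (\<Sum>\<tau>\<in>simplices (Sd d K) j. f (barycenter \<tau>)) / c ^ d" for j d
  define T where "T d = (\<Sum>\<rho>\<in>simplices (Sd d K) n. simplex_mean n f \<rho>) / c ^ d" for d
  have geo: "geometric_complex (Sd d K)" for d
    by (rule geometric_complex_Sd[OF K(1)])
  note simplex = geometric_complex_simplex[OF geo]
  have hull_cont: "continuous_on (point_hull \<rho>) f" if \<rho>: "\<rho> \<in> Sd d K" for \<rho> d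
  proof -
    obtain s where s: "s \<in> K" "\<rho> \<in> Sd d (faces s)"
      using Sd_carrier[OF K(1) \<rho>] by blast
    then have "finite s"
      using K(1) by (simp add: abstract_complex_def)
    then show ?thesis
      by (intro continuous_on_subset[OF f[OF s(1)]] point_hull_subset_geom_simplex Sd_faces_subset[OF _ s(2)])
  qed
  have density: "face_density n K i d = real (card (simplices (Sd d K) i)) / c ^ d" for i d
    by (simp add: face_density_def face_number_def c_def)
  have ratio: "flag_ratio n i j = real (flag_number i j) / c" for i j
    by (simp only: flag_ratio_def c_def)
  have bounded: "\<exists>B. \<forall>d. face_density n K i d \<le> B" if "i \<le> n" for i
  proof -
    have "Bseq (face_density n K i)"
      using face_density_limit[OF K that] by (intro convergent_imp_Bseq convergentI)
    then show ?thesis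
      by (auto simp: Bseq_def abs_le_iff)
  qed
  have osc: "\<forall>\<^sub>F d in sequentially. \<forall>\<rho>\<in>Sd d K. \<forall>x\<in>point_hull \<rho>. \<forall>y\<in>point_hull \<rho>. \<bar>f x - f y\<bar> < \<epsilon>"
    if "0 < \<epsilon>" for \<epsilon>
    by (rule small_oscillation_Sd[OF K(1,3) f K(2) _ that]) auto
  \<comment> \<open>The mean over a top simplex is the average of the means over its
    \<open>(n + 1)!\<close> cells, and lower simplices have no flags of this length. So
    \<open>T\<close> is constant in \<open>d\<close>: it is the exact integral that
    \<open>G n\<close> approximates.\<close>
  have T: "T d = (\<Sum>\<rho>\<in>simplices (Sd 0 K) n. simplex_mean n f \<rho>)" for d
  proof (induction d)
    case (Suc d)
    have "(\<Sum>\<rho>\<in>simplices (Sd (Suc d) K) n. simplex_mean n f \<rho>)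
        = (\<Sum>i\<le>n. \<Sum>\<rho>\<in>simplices (Sd d K) i. \<Sum>C\<in>flags \<rho> n. simplex_mean n f (barycenter ` C))"
      by (rule sum_Sd_Suc[OF K])
    also have "\<dots> = (\<Sum>i\<le>n. if i = n then c * (\<Sum>\<rho>\<in>simplices (Sd d K) n. simplex_mean n f \<rho>) else 0)"
    proof (rule sum.cong)
      fix i assume i: "i \<in> {..n}"
      show "(\<Sum>\<rho>\<in>simplices (Sd d K) i. \<Sum>C\<in>flags \<rho> n. simplex_mean n f (barycenter ` C))
          = (if i = n then c * (\<Sum>\<rho>\<in>simplices (Sd d K) n. simplex_mean n f \<rho>) else 0)"
      proof (cases "i = n")
        case True
        have "c * simplex_mean n f \<rho> = (\<Sum>C\<in>flags \<rho> n. simplex_mean n f (barycenter ` C))"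
          if "\<rho> \<in> simplices (Sd d K) n" for \<rho>
        proof -
          have "\<rho> \<in> Sd d K"
            using that by (simp add: simplices_def)
          then have "simplex_mean n f \<rho> = (\<Sum>C\<in>flags \<rho> n. simplex_mean n f (barycenter ` C)) / c"
            unfolding c_def by (intro simplex_mean_subdivide[OF geo that] hull_cont)
          then show ?thesis
            using c by simp
        qed
        then show ?thesis
          using True by (simp add: sum_distrib_left)
      next
        case False
        have "flags \<rho> n = {}" if "\<rho> \<in> simplices (Sd d K) i" for \<rho>
          using that i False simplex(1)[of \<rho> d] by (intro flags_empty) (auto simp: simplices_def)
        then show ?thesis
          using False by simp
      qed
    qed simp
    also have "\<dots> = c * (\<Sum>\<rho>\<in>simplices (Sd d K) n. simplex_mean n f \<rho>)"
      by simp
    finally show ?case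
      using Suc c by (simp add: T_def)
  qed (simp add: T_def)
  \<comment> \<open>Replacing a mean by the value at the barycenter costs at most the oscillation of
    \<open>f\<close>, and the normalized number of top simplices stays bounded.\<close>
  have "(\<lambda>d. G n d - T d) \<longlonglongrightarrow> 0"
  proof (rule LIMSEQ_I)
    fix r :: real assume "0 < r"
    obtain B where B: "\<And>d. face_density n K n d \<le> B"
      using bounded[of n] by blast
    obtain \<epsilon> where \<epsilon>: "0 < \<epsilon>" "\<bar>B\<bar> * \<epsilon> < r"
      using ex_small_factor[OF \<open>0 < r\<close>] by blast
    obtain D where D: "\<And>d \<rho> x y. D \<le> d \<Longrightarrow> \<rho> \<in> Sd d K \<Longrightarrow> x \<in> point_hull \<rho> \<Longrightarrow> y \<in> point_hull \<rho> \<Longrightarrow> \<bar>f x - f y\<bar> < \<epsilon>"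
      using osc[OF \<epsilon>(1)] unfolding eventually_sequentially by blast
    have "norm (G n d - T d - 0) < r" if d: "D \<le> d" for d
    proof -
      have close: "\<bar>f (barycenter \<rho>) - simplex_mean n f \<rho>\<bar> \<le> \<epsilon>" if \<rho>: "\<rho> \<in> simplices (Sd d K) n" for \<rho>
      proof -
        have *: "\<rho> \<in> Sd d K" "card \<rho> = n + 1"
          using \<rho> by (auto simp: simplices_def)
        have "\<bar>simplex_mean n f \<rho> - f (barycenter \<rho>)\<bar> \<le> \<epsilon>"
          using D[OF d *(1)] * simplex(1,2)[OF *(1)]
          by (intro simplex_mean_close hull_cont[OF *(1)] barycenter_in_point_hull) (auto intro: less_imp_le)
        then show ?thesis
          by (simp add: abs_minus_commute)
      qed
      have "\<bar>G n d - T d\<bar> = \<bar>\<Sum>\<rho>\<in>simplices (Sd d K) n. f (barycenter \<rho>) - simplex_mean n f \<rho>\<bar> / c ^ d"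
        using c by (simp add: G_def T_def sum_subtractf diff_divide_distrib[symmetric])
      also have "\<dots> \<le> (\<Sum>\<rho>\<in>simplices (Sd d K) n. \<epsilon>) / c ^ d"
        using c close by (intro divide_right_mono order.trans[OF sum_abs] sum_mono) auto
      also have "\<dots> = face_density n K n d * \<epsilon>"
        by (simp add: density)
      also have "\<dots> \<le> \<bar>B\<bar> * \<epsilon>"
        using B[of d] \<epsilon>(1) by (intro mult_right_mono) auto
      finally show ?thesis
        using \<epsilon>(2) by simp
    qed
    then show "\<exists>no. \<forall>d\<ge>no. norm (G n d - T d - 0) < r"
      by blast
  qed
  then have top: "G n \<longlonglongrightarrow> (\<Sum>\<rho>\<in>simplices (Sd 0 K) n. simplex_mean n f \<rho>)"
    unfolding T by (rule LIM_zero_cancel)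
  have rec: "(\<lambda>d. G j (Suc d) - (\<Sum>i\<le>n. flag_ratio n i j * G i d)) \<longlonglongrightarrow> 0" for j
  proof (rule LIMSEQ_I)
    fix r :: real assume "0 < r"
    have "\<forall>i\<in>{..n}. \<exists>B. \<forall>d. face_density n K i d \<le> B"
      using bounded by blast
    then obtain B where B: "\<And>i d. i \<le> n \<Longrightarrow> face_density n K i d \<le> B i"
      by (metis atMost_iff)
    \<comment> \<open>\<open>M\<close> bounds the normalized number of the flags summed over, hence
      the total factor by which the oscillation is multiplied.\<close>
    define M where "M = (\<Sum>i\<le>n. flag_ratio n i j * B i)"
    obtain \<epsilon> where \<epsilon>: "0 < \<epsilon>" "\<bar>M\<bar> * \<epsilon> < r"
      using ex_small_factor[OF \<open>0 < r\<close>] by blast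
    obtain D where D: "\<And>d \<rho> x y. D \<le> d \<Longrightarrow> \<rho> \<in> Sd d K \<Longrightarrow> x \<in> point_hull \<rho> \<Longrightarrow> y \<in> point_hull \<rho> \<Longrightarrow> \<bar>f x - f y\<bar> < \<epsilon>"
      using osc[OF \<epsilon>(1)] unfolding eventually_sequentially by blast
    have "norm (G j (Suc d) - (\<Sum>i\<le>n. flag_ratio n i j * G i d) - 0) < r" if d: "D \<le> d" for d
    proof -
      \<comment> \<open>Both points lie in the hull of \<open>\<rho>\<close>: the first is a convex
        combination of barycenters of faces of \<open>\<rho>\<close>.\<close>
      have close: "\<bar>f (barycenter (barycenter ` C)) - f (barycenter \<rho>)\<bar> \<le> \<epsilon>"
        if \<rho>: "\<rho> \<in> Sd d K" and C: "C \<in> flags \<rho> j" for \<rho> C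
      proof -
        have "barycenter ` C \<subseteq> point_hull \<rho>"
          using C simplex(1)[OF \<rho>] by (auto simp: flags_def intro!: barycenter_in_point_hull)
        then have "barycenter (barycenter ` C) \<in> point_hull \<rho>"
          using flagsD(1,3)[OF C] point_hull_mono[OF simplex(1)[OF \<rho>]] barycenter_in_point_hull[of "barycenter ` C" "barycenter ` C"]
          by blast
        moreover have "barycenter \<rho> \<in> point_hull \<rho>"
          using simplex(1,2)[OF \<rho>] by (intro barycenter_in_point_hull) auto
        ultimately show ?thesis
          using D[OF d \<rho>] by (simp add: less_imp_le)
      qed
      have const: "(\<Sum>\<rho>\<in>simplices (Sd d K) i. \<Sum>C\<in>flags \<rho> j. g \<rho>) = real (flag_number i j) * (\<Sum>\<rho>\<in>simplices (Sd d K) i. g \<rho>)"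
        for i and g :: "_ \<Rightarrow> real"
        using card_flags_Sd[OF K(1)] by (simp add: sum_distrib_left)
      have "G j (Suc d) = (\<Sum>i\<le>n. \<Sum>\<rho>\<in>simplices (Sd d K) i. \<Sum>C\<in>flags \<rho> j. f (barycenter (barycenter ` C))) / c ^ Suc d"
        unfolding G_def by (subst sum_Sd_Suc[OF K]) simp
      moreover have "(\<Sum>i\<le>n. flag_ratio n i j * G i d)
          = (\<Sum>i\<le>n. \<Sum>\<rho>\<in>simplices (Sd d K) i. \<Sum>C\<in>flags \<rho> j. f (barycenter \<rho>)) / c ^ Suc d"
        unfolding const by (simp add: ratio G_def sum_divide_distrib[of _ "{..n}"] mult_ac)
      ultimately have "\<bar>G j (Suc d) - (\<Sum>i\<le>n. flag_ratio n i j * G i d)\<bar>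
          = \<bar>\<Sum>i\<le>n. \<Sum>\<rho>\<in>simplices (Sd d K) i. \<Sum>C\<in>flags \<rho> j. f (barycenter (barycenter ` C)) - f (barycenter \<rho>)\<bar> / c ^ Suc d"
        using c by (simp add: sum_subtractf diff_divide_distrib[symmetric] abs_divide)
      also have "\<dots> \<le> (\<Sum>i\<le>n. \<Sum>\<rho>\<in>simplices (Sd d K) i. \<Sum>C\<in>flags \<rho> j. \<epsilon>) / c ^ Suc d"
        using c close
        by (intro divide_right_mono order.trans[OF sum_abs] sum_mono) (auto simp: simplices_def)
      also have "\<dots> = (\<Sum>i\<le>n. flag_ratio n i j * face_density n K i d) * \<epsilon>"
        unfolding const
        unfolding sum_distrib_right by (simp add: ratio density sum_divide_distrib[of _ "{..n}"] mult_ac)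
      also have "\<dots> \<le> M * \<epsilon>"
        unfolding M_def using B \<epsilon>(1)
        by (intro mult_right_mono sum_mono mult_left_mono) (auto simp: flag_ratio_def)
      also have "\<dots> \<le> \<bar>M\<bar> * \<epsilon>"
        using \<epsilon>(1) by (intro mult_right_mono) auto
      finally show ?thesis
        using \<epsilon>(2) by simp
    qed
    then show "\<exists>no. \<forall>d\<ge>no. norm (G j (Suc d) - (\<Sum>i\<le>n. flag_ratio n i j * G i d) - 0) < r"
      by blast
  qed
  have "G j \<longlonglongrightarrow> face_limit n j * (\<Sum>\<rho>\<in>simplices (Sd 0 K) n. simplex_mean n f \<rho>)"
    by (rule face_limit[OF top rec j])
  then show ?thesis
    unfolding G_def c_def .
qed

section \<open>Integration on complexes\<close>

text \<open>Indicators are handled by the defining formula. For increasing limits, the sum over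
  \<open>I\<close> is itself an integral, so monotone convergence exchanges it with the
  supremum.\<close>

lemma nn_integral_sum_measure:
  assumes sets: "\<And>i. i \<in> I \<Longrightarrow> sets (\<mu> i) = sets B" and f: "f \<in> borel_measurable B"
  shows "(\<integral>\<^sup>+ x. f x \<partial>sum_measure B I \<mu>) = (\<integral>\<^sup>+ i. (\<integral>\<^sup>+ x. f x \<partial>\<mu> i) \<partial>count_space I)"
  using f
proof induction
  case (cong f g)
  have "space (\<mu> i) = space B" if "i \<in> I" for i
    using sets_eq_imp_space_eq[OF sets[OF that]] .
  then have "(\<integral>\<^sup>+ i. (\<integral>\<^sup>+ x. f x \<partial>\<mu> i) \<partial>count_space I) = (\<integral>\<^sup>+ i. (\<integral>\<^sup>+ x. g x \<partial>\<mu> i) \<partial>count_space I)"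
    using cong.hyps by (intro nn_integral_cong) auto
  moreover have "(\<integral>\<^sup>+ x. f x \<partial>sum_measure B I \<mu>) = (\<integral>\<^sup>+ x. g x \<partial>sum_measure B I \<mu>)"
    using cong.hyps by (intro nn_integral_cong) (auto simp: space_sum_measure)
  ultimately show ?case
    using cong.IH by simp
next
  case (set A)
  have "(\<integral>\<^sup>+ i. (\<integral>\<^sup>+ x. indicator A x \<partial>\<mu> i) \<partial>count_space I) = (\<integral>\<^sup>+ i. emeasure (\<mu> i) A \<partial>count_space I)"
    using set sets by (intro nn_integral_cong) simp
  moreover have "(\<integral>\<^sup>+ x. indicator A x \<partial>sum_measure B I \<mu>) = emeasure (sum_measure B I \<mu>) A"
    using set by (intro nn_integral_indicator) (simp add: sets_sum_measure)
  ultimately show ?case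
    using emeasure_sum_measure[OF sets set] by simp
next
  case (mult f c)
  have "f \<in> borel_measurable (\<mu> i)" if "i \<in> I" for i
    using mult.hyps(2) measurable_cong_sets[OF sets[OF that] refl] by blast
  then have "(\<integral>\<^sup>+ i. (\<integral>\<^sup>+ x. c * f x \<partial>\<mu> i) \<partial>count_space I) = (\<integral>\<^sup>+ i. c * (\<integral>\<^sup>+ x. f x \<partial>\<mu> i) \<partial>count_space I)"
    by (intro nn_integral_cong nn_integral_cmult) simp
  moreover have "f \<in> borel_measurable (sum_measure B I \<mu>)"
    using mult.hyps(2) measurable_cong_sets[OF sets_sum_measure refl] by blast
  ultimately show ?case
    using mult.IH by (simp add: nn_integral_cmult)
next
  case (add f g)
  have "f \<in> borel_measurable (\<mu> i)" "g \<in> borel_measurable (\<mu> i)" if "i \<in> I" for i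
    using add.hyps(1,3) measurable_cong_sets[OF sets[OF that] refl] by blast+
  then have "(\<integral>\<^sup>+ i. (\<integral>\<^sup>+ x. g x + f x \<partial>\<mu> i) \<partial>count_space I)
      = (\<integral>\<^sup>+ i. (\<integral>\<^sup>+ x. g x \<partial>\<mu> i) + (\<integral>\<^sup>+ x. f x \<partial>\<mu> i) \<partial>count_space I)"
    by (intro nn_integral_cong nn_integral_add) simp_all
  moreover have "f \<in> borel_measurable (sum_measure B I \<mu>)" "g \<in> borel_measurable (sum_measure B I \<mu>)"
    using add.hyps(1,3) measurable_cong_sets[OF sets_sum_measure refl] by blast+
  ultimately show ?case
    using add.IH by (simp add: nn_integral_add)
next
  case (seq U)
  have \<mu>: "U k \<in> borel_measurable (\<mu> i)" if "i \<in> I" for i k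
    using seq.hyps(1) measurable_cong_sets[OF sets[OF that] refl] by blast
  have sm: "U k \<in> borel_measurable (sum_measure B I \<mu>)" for k
    using seq.hyps(1) measurable_cong_sets[OF sets_sum_measure refl] by blast
  have "(\<integral>\<^sup>+ x. (SUP k. U k) x \<partial>sum_measure B I \<mu>) = (SUP k. (\<integral>\<^sup>+ x. U k x \<partial>sum_measure B I \<mu>))"
    using nn_integral_monotone_convergence_SUP[OF \<open>incseq U\<close> sm] by (simp add: image_comp)
  also have "\<dots> = (SUP k. (\<integral>\<^sup>+ i. (\<integral>\<^sup>+ x. U k x \<partial>\<mu> i) \<partial>count_space I))"
    using seq.IH by simp
  also have "\<dots> = (\<integral>\<^sup>+ i. (SUP k. (\<integral>\<^sup>+ x. U k x \<partial>\<mu> i)) \<partial>count_space I)"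
    using \<open>incseq U\<close>
    by (intro nn_integral_monotone_convergence_SUP[symmetric])
      (auto simp: incseq_def le_fun_def intro!: nn_integral_mono)
  also have "\<dots> = (\<integral>\<^sup>+ i. (\<integral>\<^sup>+ x. (SUP k. U k) x \<partial>\<mu> i) \<partial>count_space I)"
    using nn_integral_monotone_convergence_SUP[OF \<open>incseq U\<close> \<mu>]
    by (intro nn_integral_cong) (simp add: image_comp)
  finally show ?case .
qed

text \<open>Sums over a locally finite complex may be infinite, but \<open>f\<close> is seen by the
  summands in the finite set \<open>J\<close> only, so that integrability reduces to finitely many
  measures.\<close>

lemma integral_sum_measure:
  fixes f :: "'x \<Rightarrow> real"
  assumes sets: "\<And>i. i \<in> I \<Longrightarrow> sets (\<mu> i) = sets B" and f: "f \<in> borel_measurable B"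
    and J: "finite J" "J \<subseteq> I" "\<And>i. i \<in> J \<Longrightarrow> integrable (\<mu> i) f"
    and null: "\<And>i. i \<in> I - J \<Longrightarrow> (\<integral>\<^sup>+ x. ennreal \<bar>f x\<bar> \<partial>\<mu> i) = 0"
  shows "integrable (sum_measure B I \<mu>) f"
    and "integral\<^sup>L (sum_measure B I \<mu>) f = (\<Sum>i\<in>J. integral\<^sup>L (\<mu> i) f)"
proof -
  \<comment> \<open>Stated for \<open>g\<close> below the absolute value of \<open>f\<close>, to be
    used for both \<open>f\<close> and \<open>- f\<close>; \<open>ennreal\<close> cuts off the
    negative values, which leaves the positive and negative parts of \<open>f\<close>.\<close>
  have sum: "(\<integral>\<^sup>+ x. ennreal (g x) \<partial>sum_measure B I \<mu>) = (\<Sum>i\<in>J. \<integral>\<^sup>+ x. ennreal (g x) \<partial>\<mu> i)"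
    if g: "g \<in> borel_measurable B" "\<And>x. g x \<le> \<bar>f x\<bar>" for g :: "'x \<Rightarrow> real"
  proof -
    have "(\<integral>\<^sup>+ x. ennreal (g x) \<partial>\<mu> i) = 0" if "i \<in> I - J" for i
    proof -
      have "(\<integral>\<^sup>+ x. ennreal (g x) \<partial>\<mu> i) \<le> (\<integral>\<^sup>+ x. ennreal \<bar>f x\<bar> \<partial>\<mu> i)"
        using g(2) by (intro nn_integral_mono ennreal_leI)
      then show ?thesis
        using null[OF that] by simp
    qed
    then show ?thesis
      using g(1) J(1,2) by (subst nn_integral_sum_measure[OF sets]) (auto intro!: nn_integral_count_space')
  qed
  have pos: "(\<integral>\<^sup>+ x. ennreal (f x) \<partial>sum_measure B I \<mu>) = (\<Sum>i\<in>J. \<integral>\<^sup>+ x. ennreal (f x) \<partial>\<mu> i)"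
    and neg: "(\<integral>\<^sup>+ x. ennreal (- f x) \<partial>sum_measure B I \<mu>) = (\<Sum>i\<in>J. \<integral>\<^sup>+ x. ennreal (- f x) \<partial>\<mu> i)"
    using f by (auto intro!: sum)
  have fin: "(\<integral>\<^sup>+ x. ennreal (f x) \<partial>\<mu> i) < top" "(\<integral>\<^sup>+ x. ennreal (- f x) \<partial>\<mu> i) < top" if "i \<in> J" for i
    using J(3)[OF that] by (auto simp: real_integrable_def less_top)
  have "f \<in> borel_measurable (sum_measure B I \<mu>)"
    using f measurable_cong_sets[OF sets_sum_measure refl] by blast
  then show int: "integrable (sum_measure B I \<mu>) f"
    using fin J(1) by (auto simp: real_integrable_def pos neg less_top[symmetric])
  show "integral\<^sup>L (sum_measure B I \<mu>) f = (\<Sum>i\<in>J. integral\<^sup>L (\<mu> i) f)"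
    using fin J(3)
    by (simp add: real_lebesgue_integral_def[OF int] pos neg enn2real_sum real_lebesgue_integral_def sum_subtractf)
qed

lemma integral_scale_measure:
  fixes f :: "'x \<Rightarrow> real"
  assumes f: "integrable M f" and r: "0 \<le> r"
  shows "integrable (scale_measure (ennreal r) M) f"
    and "integral\<^sup>L (scale_measure (ennreal r) M) f = r * integral\<^sup>L M f"
proof -
  have "f \<in> borel_measurable M"
    using f by simp
  then have nn: "(\<integral>\<^sup>+ x. ennreal (f x) \<partial>scale_measure (ennreal r) M) = ennreal r * (\<integral>\<^sup>+ x. ennreal (f x) \<partial>M)"
    "(\<integral>\<^sup>+ x. ennreal (- f x) \<partial>scale_measure (ennreal r) M) = ennreal r * (\<integral>\<^sup>+ x. ennreal (- f x) \<partial>M)"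
    by (auto intro!: nn_integral_scale_measure)
  have "f \<in> borel_measurable (scale_measure (ennreal r) M)"
    using \<open>f \<in> borel_measurable M\<close> measurable_cong_sets[OF sets_scale_measure refl] by blast
  then show int: "integrable (scale_measure (ennreal r) M) f"
    using f by (auto simp: real_integrable_def nn ennreal_mult_eq_top_iff)
  show "integral\<^sup>L (scale_measure (ennreal r) M) f = r * integral\<^sup>L M f"
    using r by (simp add: real_lebesgue_integral_def[OF int] real_lebesgue_integral_def[OF f] nn enn2real_mult right_diff_distrib)
qed

lemma integrable_return:
  fixes f :: "'x \<Rightarrow> real"
  assumes "f \<in> borel_measurable M" "x \<in> space M"
  shows "integrable (return M x) f"
  unfolding real_integrable_def using assms by (auto simp: nn_integral_return)

lemma affine_extension_geom_simplex:
  assumes "finite s" "bij_betw \<phi> {..n} s" "x \<in> geom_simplex {..n}"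
  shows "affine_extension n \<phi> x \<in> geom_simplex s"
proof -
  note vp = inj_vertex_point
  have "bij_betw (\<lambda>i. vertex_point (\<phi> i)) {..n} (vertex_point ` s)"
    using bij_betw_trans[OF assms(2) bij_betw_imageI[OF inj_on_subset[OF vp subset_UNIV] refl]]
    by (simp add: comp_def)
  then have "affine_extension n \<phi> x \<in> point_hull (vertex_point ` s)"
    unfolding affine_extension_eq using assms(3) by (rule affine_map_in_point_hull)
  moreover have "vertex_point ` s \<subseteq> geom_simplex s"
    using assms(1) by (auto simp: geom_simplex_def vertex_point_def indicator_def)
  ultimately show ?thesis
    using point_hull_subset_geom_simplex[OF assms(1)] by blast
qed

lemma simplex_iso_bij:
  assumes "finite s" "card s = n + 1"
  shows "\<exists>\<phi>. bij_betw \<phi> {..n} s \<and> simplex_iso n s = affine_extension n \<phi>"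
proof -
  have "\<exists>\<phi>. bij_betw \<phi> {..n} s"
    using finite_same_card_bij[OF finite_atMost assms(1), of n] assms(2) by simp
  from someI_ex[OF this] show ?thesis
    unfolding simplex_iso_def by blast
qed

text \<open>Both measurable structures come from weak topologies, so preimages of open sets are
  tested on every face of the standard simplex.\<close>

lemma simplex_iso_measurable:
  assumes K: "abstract_complex K" and s: "s \<in> simplices K n"
  shows "simplex_iso n s \<in> measurable (vol_std n) (borel_complex K)"
proof (rule measurable_into_borel_complex)
  have sK: "s \<in> K" "card s = n + 1"
    using s by (auto simp: simplices_def)
  have fin: "finite s"
    using K sK(1) by (simp add: abstract_complex_def)
  obtain \<phi> where \<phi>: "bij_betw \<phi> {..n} s" "simplex_iso n s = affine_extension n \<phi>"
    using simplex_iso_bij[OF fin sK(2)] by blast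
  have into: "simplex_iso n s x \<in> geom_simplex s" if "x \<in> geom_simplex {..n}" for x
    unfolding \<phi>(2) using fin \<phi>(1) that by (rule affine_extension_geom_simplex)
  then show "simplex_iso n s \<in> space (vol_std n) \<rightarrow> realization K"
    using sK(1) by (auto simp: space_vol_std realization_def)
  fix U assume U: "openin (complex_topology K) U"
  then have Us: "openin (top_of_set (geom_simplex s)) (U \<inter> geom_simplex s)"
    using sK(1) by (simp add: openin_complex_topology)
  have "openin (complex_topology (std_complex n)) (simplex_iso n s -` U \<inter> space (vol_std n))"
    unfolding openin_complex_topology
  proof
    show "simplex_iso n s -` U \<inter> space (vol_std n) \<subseteq> realization (std_complex n)"
      by (simp add: space_vol_std realization_std_complex)
    show "\<forall>t\<in>std_complex n. openin (top_of_set (geom_simplex t)) (simplex_iso n s -` U \<inter> space (vol_std n) \<inter> geom_simplex t)"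
    proof
      fix t assume "t \<in> std_complex n"
      then have t: "geom_simplex t \<subseteq> geom_simplex {..n}"
        using realization_std_complex[of n] by (auto simp: realization_def)
      have "openin (top_of_set (geom_simplex t)) (geom_simplex t \<inter> simplex_iso n s -` (U \<inter> geom_simplex s))"
        using into t unfolding \<phi>(2) affine_extension_eq
        by (intro continuous_openin_preimage[OF continuous_on_affine_map _ Us]) auto
      also have "geom_simplex t \<inter> simplex_iso n s -` (U \<inter> geom_simplex s)
          = simplex_iso n s -` U \<inter> space (vol_std n) \<inter> geom_simplex t"
        using into t by (auto simp: space_vol_std)
      finally show "openin (top_of_set (geom_simplex t)) (simplex_iso n s -` U \<inter> space (vol_std n) \<inter> geom_simplex t)" .
    qed
  qed
  then show "simplex_iso n s -` U \<inter> space (vol_std n) \<in> sets (vol_std n)"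
    unfolding sets_vol_std by (rule openin_sets_borel_complex)
qed

text \<open>\<open>L\<close> plays the part of a finite subcomplex outside which \<open>f\<close>
  vanishes. The result is phrased with \<open>Sd 0 L\<close>, whose simplices consist of vertex
  points, to match the limit in \<open>barycenter_sum_limit\<close>.\<close>

lemma integral_vol_complex:
  fixes f :: "('a \<Rightarrow> real) \<Rightarrow> real"
  assumes K: "abstract_complex K" and f: "continuous_map (complex_topology K) euclideanreal f"
    and L: "finite L" "L \<subseteq> K" "\<And>s x. s \<in> K - L \<Longrightarrow> x \<in> geom_simplex s \<Longrightarrow> f x = 0"
  shows "integrable (vol_complex n K) f"
    and "integral\<^sup>L (vol_complex n K) f = (\<Sum>\<rho>\<in>simplices (Sd 0 L) n. simplex_mean n f \<rho>)"
proof -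
  let ?\<mu> = "\<lambda>s. distr (vol_std n) (borel_complex K) (simplex_iso n s)"
  have fm: "f \<in> borel_measurable (borel_complex K)"
    using f by (rule continuous_map_measurable_borel_complex)
  have fc: "continuous_on (geom_simplex s) f" if "s \<in> K" for s
    using f that by (simp add: continuous_map_complex_topology_iff)
  have simplex: "s \<in> K" "finite s" "card s = n + 1" if "s \<in> simplices K n" for s
    using that K by (auto simp: simplices_def abstract_complex_def)
  have into: "simplex_iso n s x \<in> geom_simplex s" if "s \<in> simplices K n" "x \<in> geom_simplex {..n}" for s x
    using simplex_iso_bij[OF simplex(2,3)[OF that(1)]] affine_extension_geom_simplex[OF simplex(2)[OF that(1)] _ that(2)]
    by metis
  note vp = inj_vertex_point
  have mean: "integrable (?\<mu> s) f" "integral\<^sup>L (?\<mu> s) f = simplex_mean n f (vertex_point ` s)"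
    if s: "s \<in> simplices K n" for s
  proof -
    obtain \<phi> where \<phi>: "bij_betw \<phi> {..n} s" "simplex_iso n s = affine_extension n \<phi>"
      using simplex_iso_bij[OF simplex(2,3)[OF s]] by blast
    have bij: "bij_betw (\<lambda>i. vertex_point (\<phi> i)) {..n} (vertex_point ` s)"
      using bij_betw_trans[OF \<phi>(1) bij_betw_imageI[OF inj_on_subset[OF vp subset_UNIV] refl]]
      by (simp add: comp_def)
    have "vertex_point ` s \<subseteq> geom_simplex s"
      using simplex(2)[OF s] by (auto simp: geom_simplex_def vertex_point_def indicator_def)
    then have cont: "continuous_on (point_hull (vertex_point ` s)) f"
      by (intro continuous_on_subset[OF fc[OF simplex(1)[OF s]]] point_hull_subset_geom_simplex simplex(2)[OF s])
    note iso = simplex_iso_measurable[OF K s]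
    have "integrable (vol_std n) (\<lambda>x. f (simplex_iso n s x))"
      unfolding \<phi>(2) affine_extension_eq by (rule integrable_vol_std[OF continuous_on_affine_compose[OF cont bij]])
    then show "integrable (?\<mu> s) f"
      using integrable_distr_eq[OF iso fm] by simp
    show "integral\<^sup>L (?\<mu> s) f = simplex_mean n f (vertex_point ` s)"
      using integral_distr[OF iso fm] simplex_mean_eq[OF cont bij] by (simp add: \<phi>(2) affine_extension_eq)
  qed
  have null: "(\<integral>\<^sup>+ x. ennreal \<bar>f x\<bar> \<partial>?\<mu> s) = 0" if s: "s \<in> simplices K n - simplices L n" for s
  proof -
    have sK: "s \<in> simplices K n" "s \<in> K - L"
      using s by (auto simp: simplices_def)
    have "(\<integral>\<^sup>+ x. ennreal \<bar>f x\<bar> \<partial>?\<mu> s) = (\<integral>\<^sup>+ x. ennreal \<bar>f (simplex_iso n s x)\<bar> \<partial>vol_std n)"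
      using fm by (intro nn_integral_distr[OF simplex_iso_measurable[OF K sK(1)]]) simp
    also have "\<dots> = (\<integral>\<^sup>+ x. 0 \<partial>vol_std n)"
      using L(3)[OF sK(2) into[OF sK(1)]] by (intro nn_integral_cong) (simp add: space_vol_std)
    finally show ?thesis
      by simp
  qed
  have J: "finite (simplices L n)" "simplices L n \<subseteq> simplices K n"
    using L(1,2) by (auto simp: simplices_def)
  have sets: "\<And>s. s \<in> simplices K n \<Longrightarrow> sets (?\<mu> s) = sets (borel_complex K)"
    by simp
  show "integrable (vol_complex n K) f"
    unfolding vol_complex_def using mean(1) J(2) by (intro integral_sum_measure(1)[OF sets fm J _ null]) auto
  have "integral\<^sup>L (vol_complex n K) f = (\<Sum>s\<in>simplices L n. integral\<^sup>L (?\<mu> s) f)"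
    unfolding vol_complex_def using mean(1) J(2) by (intro integral_sum_measure(2)[OF sets fm J _ null]) auto
  also have "\<dots> = (\<Sum>s\<in>simplices L n. simplex_mean n f (vertex_point ` s))"
    using mean(2) J(2) by (intro sum.cong) auto
  also have "\<dots> = (\<Sum>\<rho>\<in>simplices (Sd 0 L) n. simplex_mean n f \<rho>)"
    unfolding simplices_Sd_0 using inj_on_subset[OF inj_on_image_Pow[OF vp]] by (subst sum.reindex) auto
  finally show "integral\<^sup>L (vol_complex n K) f = (\<Sum>\<rho>\<in>simplices (Sd 0 L) n. simplex_mean n f \<rho>)" .
qed

section \<open>Links\<close>

text \<open>Finiteness guards against the default value \<open>0\<close> of an infinite sum in
  \<open>face_poly\<close>.\<close>

lemma coeff_face_poly:
  assumes "finite {p. simplices X p \<noteq> {}}"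
  shows "coeff (face_poly X) l = real (face_number X l)"
proof -
  have "coeff (face_poly X) l = (\<Sum>p | simplices X p \<noteq> {}. if p = l then real (face_number X l) else 0)"
    unfolding face_poly_def coeff_sum by (intro sum.cong) auto
  also have "\<dots> = real (face_number X l)"
    using assms by (auto simp: face_number_def)
  finally show ?thesis .
qed

text \<open>A simplex of the link is what a coface has besides \<open>\<sigma>\<close>.
  Cardinalities \<open>p + 1\<close> and \<open>l + 1\<close> add up to \<open>p + l + 2\<close>,
  hence the dimension \<open>p + l + 1\<close>.\<close>

lemma bij_betw_link_cofaces:
  assumes L: "geometric_complex L" and \<sigma>: "\<sigma> \<in> simplices L p"
  shows "bij_betw (\<lambda>t. \<sigma> \<union> t) (simplices (link \<sigma> L) l) {\<tau> \<in> simplices L (p + l + 1). \<sigma> \<subseteq> \<tau>}"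
proof -
  have \<sigma>L: "\<sigma> \<in> L" "card \<sigma> = p + 1" and fin\<sigma>: "finite \<sigma>"
    using \<sigma> geometric_complex_simplex(1)[OF L] by (auto simp: simplices_def)
  show ?thesis
    unfolding bij_betw_def
  proof
    show "inj_on (\<lambda>t. \<sigma> \<union> t) (simplices (link \<sigma> L) l)"
      by (rule inj_onI) (auto simp: simplices_def link_def)
    show "(\<lambda>t. \<sigma> \<union> t) ` simplices (link \<sigma> L) l = {\<tau> \<in> simplices L (p + l + 1). \<sigma> \<subseteq> \<tau>}"
    proof
      show "(\<lambda>t. \<sigma> \<union> t) ` simplices (link \<sigma> L) l \<subseteq> {\<tau> \<in> simplices L (p + l + 1). \<sigma> \<subseteq> \<tau>}"
      proof clarify
        fix t assume "t \<in> simplices (link \<sigma> L) l"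
        then obtain u where t: "t \<in> L" "\<sigma> \<inter> t = {}" "card t = l + 1" "u \<in> L" "\<sigma> \<union> t \<subseteq> u"
          by (auto simp: simplices_def link_def)
        have "\<sigma> \<union> t \<in> L"
          using geometric_complex_simplex(3)[OF L t(4,5)] geometric_complex_simplex(2)[OF L \<sigma>L(1)] by blast
        moreover have "card (\<sigma> \<union> t) = p + l + 2"
          using card_Un_disjoint[OF fin\<sigma> geometric_complex_simplex(1)[OF L t(1)] t(2)] \<sigma>L(2) t(3) by simp
        ultimately show "\<sigma> \<union> t \<in> simplices L (p + l + 1) \<and> \<sigma> \<subseteq> \<sigma> \<union> t"
          by (simp add: simplices_def)
      qed
      show "{\<tau> \<in> simplices L (p + l + 1). \<sigma> \<subseteq> \<tau>} \<subseteq> (\<lambda>t. \<sigma> \<union> t) ` simplices (link \<sigma> L) l"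
      proof
        fix \<tau> assume "\<tau> \<in> {\<tau> \<in> simplices L (p + l + 1). \<sigma> \<subseteq> \<tau>}"
        then have \<tau>: "\<tau> \<in> L" "card \<tau> = p + l + 2" "\<sigma> \<subseteq> \<tau>"
          by (auto simp: simplices_def)
        have "card (\<tau> - \<sigma>) = l + 1"
          using \<tau> \<sigma>L(2) fin\<sigma> by (simp add: card_Diff_subset)
        moreover from this have "\<tau> - \<sigma> \<noteq> {}"
          by (metis card.empty Suc_eq_plus1 nat.distinct(1))
        then have "\<tau> - \<sigma> \<in> L"
          by (intro geometric_complex_simplex(3)[OF L \<tau>(1)] Diff_subset)
        ultimately have "\<tau> - \<sigma> \<in> simplices (link \<sigma> L) l"
          using \<tau>(1,3) by (auto simp: simplices_def link_def)
        then show "\<tau> \<in> (\<lambda>t. \<sigma> \<union> t) ` simplices (link \<sigma> L) l"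
          using \<tau>(3) by (metis (no_types, lifting) Diff_partition image_eqI)
      qed
    qed
  qed
qed

text \<open>Cofaces have dimension at most \<open>n\<close>, so only finitely many degrees occur and
  \<open>coeff_face_poly\<close> applies.\<close>

lemma coeff_face_poly_link:
  assumes L: "geometric_complex L" "\<And>\<tau>. \<tau> \<in> L \<Longrightarrow> card \<tau> \<le> n + 1" and \<sigma>: "\<sigma> \<in> simplices L p"
  shows "coeff (face_poly (link \<sigma> L)) l = real (card {\<tau> \<in> simplices L (p + l + 1). \<sigma> \<subseteq> \<tau>})"
proof -
  have "l \<le> n" if l: "simplices (link \<sigma> L) l \<noteq> {}" for l
  proof -
    have "{\<tau> \<in> simplices L (p + l + 1). \<sigma> \<subseteq> \<tau>} \<noteq> {}"
      using bij_betw_imp_surj_on[OF bij_betw_link_cofaces[OF L(1) \<sigma>, of l]] l by (metis image_is_empty)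
    then show ?thesis
      using L(2) by (force simp: simplices_def)
  qed
  then have "finite {l. simplices (link \<sigma> L) l \<noteq> {}}"
    by (intro finite_subset[OF _ finite_atMost[of n]]) auto
  then show ?thesis
    using bij_betw_same_card[OF bij_betw_link_cofaces[OF L(1) \<sigma>]] by (simp add: coeff_face_poly face_number_def)
qed

lemma simplices_empty:
  assumes "\<And>\<tau>. \<tau> \<in> L \<Longrightarrow> card \<tau> \<le> n + 1" "n < j"
  shows "simplices L j = {}"
  using assms by (force simp: simplices_def)

text \<open>The open stars of the vertices cover the realization, so finitely many of them cover the
  support. A simplex containing a point of such a star has the vertex of the star among its own, and
  local finiteness bounds the number of these simplices.\<close>

lemma compactly_supported_finite:
  assumes lf: "locally_finite_complex K"
    and supp: "compactly_supported (complex_topology K) f"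
  shows "\<exists>K0. finite K0 \<and> K0 \<subseteq> K \<and> (\<forall>s\<in>K. \<forall>x\<in>geom_simplex s. f x \<noteq> 0 \<longrightarrow> s \<in> K0)"
proof -
  let ?X = "complex_topology K"
  let ?C = "?X closure_of {x \<in> topspace ?X. f x \<noteq> 0}"
  define star where "star v = {x \<in> realization K. 0 < x v}" for v
  have star_open: "openin ?X (star v)" for v
    unfolding openin_complex_topology
  proof
    show "\<forall>s\<in>K. openin (top_of_set (geom_simplex s)) (star v \<inter> geom_simplex s)"
    proof
      fix s assume s: "s \<in> K"
      have "open {x :: 'a \<Rightarrow> real. 0 < x v}"
        by (intro open_Collect_less continuous_on_const continuous_on_product_coordinates)
      then have "openin (top_of_set (geom_simplex s)) (geom_simplex s \<inter> {x. 0 < x v})"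
        by (rule openin_open_Int)
      moreover have "star v \<inter> geom_simplex s = geom_simplex s \<inter> {x. 0 < x v}"
        using s by (auto simp: star_def realization_def)
      ultimately show "openin (top_of_set (geom_simplex s)) (star v \<inter> geom_simplex s)"
        by simp
    qed
  qed (auto simp: star_def)
  have cover: "realization K \<subseteq> \<Union>(range star)"
  proof
    fix x assume x: "x \<in> realization K"
    then obtain s where s: "x \<in> geom_simplex s"
      by (auto simp: realization_def)
    have "\<exists>v. 0 < x v"
    proof (rule ccontr)
      assume "\<not> (\<exists>v. 0 < x v)"
      then have "x v = 0" for v
        using s by (simp add: geom_simplex_def less_eq_real_def)
      then show False
        using s by (simp add: geom_simplex_def)
    qed
    then show "x \<in> \<Union>(range star)"
      using x by (auto simp: star_def)
  qed
  have "compactin ?X ?C"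
    using supp by (simp add: compactly_supported_def)
  moreover have "?C \<subseteq> \<Union>(range star)"
    using closure_of_subset_topspace[of ?X] cover unfolding topspace_complex_topology by blast
  ultimately obtain \<F> where \<F>: "finite \<F>" "\<F> \<subseteq> range star" "?C \<subseteq> \<Union>\<F>"
    using compactinD[of ?X ?C "range star"] star_open by blast
  then obtain V where V: "finite V" "\<F> = star ` V"
    by (meson finite_subset_image)
  define K0 where "K0 = (\<Union>v\<in>V. {s \<in> K. v \<in> s})"
  have "finite K0"
    using V(1) lf by (simp add: K0_def locally_finite_complex_def)
  moreover have "s \<in> K0" if s: "s \<in> K" "x \<in> geom_simplex s" "f x \<noteq> 0" for s x
  proof -
    have "x \<in> topspace ?X"
      using s by (auto simp: topspace_complex_topology realization_def)
    then have "x \<in> {x \<in> topspace ?X. f x \<noteq> 0}"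
      using s(3) by simp
    then have "x \<in> ?C"
      using closure_of_subset[of "{x \<in> topspace ?X. f x \<noteq> 0}" ?X] by blast
    then obtain v where v: "v \<in> V" "0 < x v"
      using \<F>(3) V(2) by (auto simp: star_def)
    then have "v \<in> s"
      using s(2) by (auto simp: geom_simplex_def)
    then show ?thesis
      using v(1) s(1) by (auto simp: K0_def)
  qed
  ultimately show ?thesis
    by (intro exI[of _ K0]) (auto simp: K0_def)
qed

section \<open>Sums weighted by the number of cofaces, and the conclusion\<close>

lemma face_number_std_complex: "face_number (std_complex m) p = (m + 1) choose (p + 1)"
proof -
  have "simplices (std_complex m) p = {s. s \<subseteq> {..m} \<and> card s = p + 1}"
    by (auto simp: simplices_def std_complex_def)
  then show ?thesis
    by (simp add: face_number_def n_subsets)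
qed

text \<open>Incidences between \<open>p\<close>-simplices and \<open>m\<close>-simplices are counted
  from the side of \<open>\<tau>\<close>, each of which has as many \<open>p\<close>-faces as the
  standard \<open>m\<close>-simplex. Moving the value of \<open>f\<close> from a face to
  \<open>\<tau>\<close> costs at most its oscillation.\<close>

lemma coface_sum_limit:
  fixes f :: "('a \<Rightarrow> real) \<Rightarrow> real"
  assumes K: "abstract_complex K" "finite K" "\<forall>s\<in>K. card s \<le> n + 1" and m: "m \<le> n"
    and f: "\<And>s. s \<in> K \<Longrightarrow> continuous_on (geom_simplex s) f"
  shows "(\<lambda>d. (\<Sum>\<sigma>\<in>simplices (Sd d K) p. real (card {\<tau> \<in> simplices (Sd d K) m. \<sigma> \<subseteq> \<tau>}) * f (barycenter \<sigma>)) / fact (n + 1) ^ d)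
    \<longlonglongrightarrow> face_limit n m * real ((m + 1) choose (p + 1)) * (\<Sum>\<rho>\<in>simplices (Sd 0 K) n. simplex_mean n f \<rho>)"
proof -
  define c :: real where "c = fact (n + 1)"
  have c: "0 < c"
    unfolding c_def by (rule fact_gt_zero)
  define b where "b = real ((m + 1) choose (p + 1))"
  define G where "G d = (\<Sum>\<tau>\<in>simplices (Sd d K) m. f (barycenter \<tau>)) / c ^ d" for d
  define H where "H d = (\<Sum>\<sigma>\<in>simplices (Sd d K) p. real (card {\<tau> \<in> simplices (Sd d K) m. \<sigma> \<subseteq> \<tau>}) * f (barycenter \<sigma>)) / c ^ d" for d
  note simplex = geometric_complex_simplex[OF geometric_complex_Sd[OF K(1)]]
  have fin: "finite (simplices (Sd d K) j)" for d j
    using finite_Sd[OF K(2)] by (auto simp: simplices_def)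
  have H: "H d = (\<Sum>\<tau>\<in>simplices (Sd d K) m. \<Sum>\<sigma> | \<sigma> \<subseteq> \<tau> \<and> card \<sigma> = p + 1. f (barycenter \<sigma>)) / c ^ d" for d
  proof -
    have "(\<Sum>\<sigma>\<in>simplices (Sd d K) p. real (card {\<tau> \<in> simplices (Sd d K) m. \<sigma> \<subseteq> \<tau>}) * f (barycenter \<sigma>))
        = (\<Sum>\<sigma>\<in>simplices (Sd d K) p. \<Sum>\<tau> | \<tau> \<in> simplices (Sd d K) m \<and> \<sigma> \<subseteq> \<tau>. f (barycenter \<sigma>))"
      by simp
    also have "\<dots> = (\<Sum>\<tau>\<in>simplices (Sd d K) m. \<Sum>\<sigma> | \<sigma> \<in> simplices (Sd d K) p \<and> \<sigma> \<subseteq> \<tau>. f (barycenter \<sigma>))"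
      by (rule sum.swap_restrict[OF fin fin])
    also have "\<dots> = (\<Sum>\<tau>\<in>simplices (Sd d K) m. \<Sum>\<sigma> | \<sigma> \<subseteq> \<tau> \<and> card \<sigma> = p + 1. f (barycenter \<sigma>))"
    proof (intro sum.cong refl)
      fix \<tau> assume "\<tau> \<in> simplices (Sd d K) m"
      then have \<tau>: "\<tau> \<in> Sd d K"
        by (simp add: simplices_def)
      show "{\<sigma>. \<sigma> \<in> simplices (Sd d K) p \<and> \<sigma> \<subseteq> \<tau>} = {\<sigma>. \<sigma> \<subseteq> \<tau> \<and> card \<sigma> = p + 1}"
      proof -
        have "\<sigma> \<in> Sd d K" if "\<sigma> \<subseteq> \<tau>" "card \<sigma> = p + 1" for \<sigma>
          using that by (intro simplex(3)[OF \<tau>]) auto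
        then show ?thesis
          by (auto simp: simplices_def)
      qed
    qed
    finally show ?thesis
      by (simp add: H_def)
  qed
  have density: "face_density n K m d = real (card (simplices (Sd d K) m)) / c ^ d" for d
    by (simp only: face_density_def face_number_def c_def)
  have G: "G \<longlonglongrightarrow> face_limit n m * (\<Sum>\<rho>\<in>simplices (Sd 0 K) n. simplex_mean n f \<rho>)"
    unfolding G_def c_def by (rule barycenter_sum_limit[OF K m f])
  have "Bseq (face_density n K m)"
    using face_density_limit[OF K m] by (intro convergent_imp_Bseq convergentI)
  then obtain B where B: "\<And>d. face_density n K m d \<le> B"
    by (auto simp: Bseq_def abs_le_iff)
  have "(\<lambda>d. H d - b * G d) \<longlonglongrightarrow> 0"
  proof (rule LIMSEQ_I)
    fix r :: real assume "0 < r"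
    obtain \<epsilon> where \<epsilon>: "0 < \<epsilon>" "\<bar>b * B\<bar> * \<epsilon> < r"
      using ex_small_factor[OF \<open>0 < r\<close>] by blast
    have "\<forall>\<^sub>F d in sequentially. \<forall>\<rho>\<in>Sd d K. \<forall>x\<in>point_hull \<rho>. \<forall>y\<in>point_hull \<rho>. \<bar>f x - f y\<bar> < \<epsilon>"
      by (rule small_oscillation_Sd[OF K(1,3) f K(2) _ \<epsilon>(1)]) auto
    then obtain D where D: "\<And>d \<rho> x y. D \<le> d \<Longrightarrow> \<rho> \<in> Sd d K \<Longrightarrow> x \<in> point_hull \<rho> \<Longrightarrow> y \<in> point_hull \<rho> \<Longrightarrow> \<bar>f x - f y\<bar> < \<epsilon>"
      unfolding eventually_sequentially by blast
    have "norm (H d - b * G d - 0) < r" if d: "D \<le> d" for d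
    proof -
      have inner: "\<bar>(\<Sum>\<sigma> | \<sigma> \<subseteq> \<tau> \<and> card \<sigma> = p + 1. f (barycenter \<sigma>)) - b * f (barycenter \<tau>)\<bar> \<le> b * \<epsilon>"
        if \<tau>: "\<tau> \<in> simplices (Sd d K) m" for \<tau>
      proof -
        have \<tau>': "\<tau> \<in> Sd d K" "card \<tau> = m + 1"
          using \<tau> by (auto simp: simplices_def)
        have card: "real (card {\<sigma>. \<sigma> \<subseteq> \<tau> \<and> card \<sigma> = p + 1}) = b"
          using n_subsets[OF simplex(1)[OF \<tau>'(1)], of "p + 1"] \<tau>'(2) by (simp add: b_def)
        have close: "\<bar>f (barycenter \<sigma>) - f (barycenter \<tau>)\<bar> \<le> \<epsilon>" if "\<sigma> \<subseteq> \<tau>" "card \<sigma> = p + 1" for \<sigma>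
        proof -
          have "\<sigma> \<noteq> {}"
            using that(2) by auto
          then have "barycenter \<sigma> \<in> point_hull \<tau>" "barycenter \<tau> \<in> point_hull \<tau>"
            using that(1) simplex(1,2)[OF \<tau>'(1)] by (auto intro!: barycenter_in_point_hull)
          then show ?thesis
            using D[OF d \<tau>'(1)] by (simp add: less_imp_le)
        qed
        have "(\<Sum>\<sigma> | \<sigma> \<subseteq> \<tau> \<and> card \<sigma> = p + 1. f (barycenter \<sigma>)) - b * f (barycenter \<tau>)
            = (\<Sum>\<sigma> | \<sigma> \<subseteq> \<tau> \<and> card \<sigma> = p + 1. f (barycenter \<sigma>) - f (barycenter \<tau>))"
          using card by (simp add: sum_subtractf)
        also have "\<bar>\<dots>\<bar> \<le> (\<Sum>\<sigma> | \<sigma> \<subseteq> \<tau> \<and> card \<sigma> = p + 1. \<epsilon>)"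
          using close by (intro order.trans[OF sum_abs] sum_mono) auto
        also have "\<dots> = b * \<epsilon>"
          using card by simp
        finally show ?thesis .
      qed
      have "H d - b * G d = (\<Sum>\<tau>\<in>simplices (Sd d K) m.
          (\<Sum>\<sigma> | \<sigma> \<subseteq> \<tau> \<and> card \<sigma> = p + 1. f (barycenter \<sigma>)) - b * f (barycenter \<tau>)) / c ^ d"
        unfolding H G_def by (simp add: sum_subtractf sum_distrib_left diff_divide_distrib)
      also have "\<bar>\<dots>\<bar> \<le> (\<Sum>\<tau>\<in>simplices (Sd d K) m. b * \<epsilon>) / c ^ d"
        unfolding abs_divide using c inner
        by (intro frac_le order.trans[OF sum_abs] sum_mono) (auto simp: b_def \<epsilon>(1) less_imp_le)
      also have "\<dots> = b * face_density n K m d * \<epsilon>"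
        by (simp add: density)
      also have "\<dots> \<le> b * B * \<epsilon>"
        using B[of d] \<epsilon>(1) by (intro mult_right_mono mult_left_mono) (auto simp: b_def)
      also have "\<dots> \<le> \<bar>b * B\<bar> * \<epsilon>"
        using \<epsilon>(1) by (intro mult_right_mono) auto
      finally show ?thesis
        using \<epsilon>(2) by simp
    qed
    then show "\<exists>no. \<forall>d\<ge>no. norm (H d - b * G d - 0) < r"
      by blast
  qed
  from tendsto_add[OF this tendsto_mult_left[OF G, of b]]
  have "H \<longlonglongrightarrow> b * (face_limit n m * (\<Sum>\<rho>\<in>simplices (Sd 0 K) n. simplex_mean n f \<rho>))"
    by simp
  then show ?thesis
    unfolding H_def b_def c_def by (simp add: mult_ac del: fact_Suc)
qed

lemma barycenter_Sd_in_geom_simplex: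
  assumes K: "abstract_complex K" and \<rho>: "\<rho> \<in> Sd d K"
  shows "\<exists>s\<in>K. \<rho> \<in> Sd d (faces s) \<and> (\<forall>\<sigma>. \<sigma> \<subseteq> \<rho> \<and> \<sigma> \<noteq> {} \<longrightarrow> barycenter \<sigma> \<in> geom_simplex s)"
proof -
  obtain s where s: "s \<in> K" "\<rho> \<in> Sd d (faces s)"
    using Sd_carrier[OF K \<rho>] by blast
  then have fin: "finite s"
    using K by (simp add: abstract_complex_def)
  have "point_hull \<rho> \<subseteq> geom_simplex s"
    by (rule point_hull_subset_geom_simplex[OF fin Sd_faces_subset[OF fin s(2)]])
  then show ?thesis
    using s barycenter_in_point_hull[OF geometric_complex_simplex(1)[OF geometric_complex_Sd[OF K] \<rho>]] by blast
qed

theorem theorem5: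
  fixes K :: "'a set set" and n p :: nat
  assumes "abstract_complex K"
    and "locally_finite_complex K"
    and "complex_of_dim n K"
    and "p < n"
  shows "poly_weakly_converges (complex_topology K) (n - p - 1)
           (\<lambda>d. link_measure n d p K)
           (poly_times_measure
              (\<Sum>l\<le>n - p - 1.
                 monom (q_limit (p + l + 1) n * real (face_number (std_complex (p + l + 1)) p)) l)
              (vol_complex n K))"
proof -
  note K = assms(1)
  have dim: "\<forall>s\<in>K. card s \<le> n + 1"
    using assms(3) by (simp add: complex_of_dim_def)
  note geo = geometric_complex_Sd[OF K]
  have card_Sd: "card \<tau> \<le> n + 1" if "\<tau> \<in> Sd d K" for \<tau> d
    using card_Sd_le[OF K dim that] .
  let ?q = "\<Sum>l\<le>n - p - 1. monom (q_limit (p + l + 1) n * real (face_number (std_complex (p + l + 1)) p)) l"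
  have q: "coeff ?q l = (if l \<le> n - p - 1 then face_limit n (p + l + 1) * real ((p + l + 2) choose (p + 1)) else 0)" for l
  proof -
    have "coeff ?q l = (\<Sum>k\<le>n - p - 1. if k = l then q_limit (p + l + 1) n * real (face_number (std_complex (p + l + 1)) p) else 0)"
      unfolding coeff_sum by (intro sum.cong) auto
    then show ?thesis
      using assms(4) by (simp add: q_limit_eq_face_limit face_number_std_complex)
  qed
  let ?w = "\<lambda>d \<sigma> l. coeff (face_poly (link \<sigma> (Sd d K))) l"
  let ?\<nu> = "\<lambda>d l \<sigma>. poly_times_measure (face_poly (link \<sigma> (Sd d K))) (return (borel_complex K) (barycenter \<sigma>)) l"
  have w: "?w d \<sigma> l = real (card {\<tau> \<in> simplices (Sd d K) (p + l + 1). \<sigma> \<subseteq> \<tau>})" if "\<sigma> \<in> simplices (Sd d K) p" for d \<sigma> l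
    by (rule coeff_face_poly_link[OF geo card_Sd that])
  have \<nu>_sets: "sets (?\<nu> d l \<sigma>) = sets (borel_complex K)" for d l \<sigma>
    by (simp add: poly_times_measure_def)
  have deg_M: "poly_measure_degree_le (n - p - 1) (link_measure n d p K)" for d
    unfolding poly_measure_degree_le_def
  proof (intro allI impI)
    fix l assume l: "n - p - 1 < l"
    have "simplices (Sd d K) (p + l + 1) = {}"
      using l by (intro simplices_empty[where n = n] card_Sd[of _ d]) auto
    then have "?w d \<sigma> l = 0" if "\<sigma> \<in> simplices (Sd d K) p" for \<sigma>
      using w[OF that] by simp
    then have "(\<integral>\<^sup>+ \<sigma>. emeasure (?\<nu> d l \<sigma>) (realization K) \<partial>count_space (simplices (Sd d K) p))
        = (\<integral>\<^sup>+ \<sigma>. 0 \<partial>count_space (simplices (Sd d K) p))"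
      by (intro nn_integral_cong) (simp add: poly_times_measure_def)
    moreover have "realization K \<in> sets (borel_complex K)"
      using sets.top[of "borel_complex K"] by simp
    ultimately show "emeasure (link_measure n d p K l) (space (link_measure n d p K l)) = 0"
      using \<nu>_sets
      by (simp add: link_measure_def weighted_gamma_def space_scale_measure space_sum_measure emeasure_sum_measure)
  qed
  have deg_N: "poly_measure_degree_le (n - p - 1) (poly_times_measure ?q (vol_complex n K))"
    unfolding poly_measure_degree_le_def poly_times_measure_def by (simp only: q) auto
  have main: "integrable (poly_times_measure ?q (vol_complex n K) l) f"
      "integrable (link_measure n d p K l) f"
      "(\<lambda>d. integral\<^sup>L (link_measure n d p K l) f) \<longlonglongrightarrow> integral\<^sup>L (poly_times_measure ?q (vol_complex n K) l) f"
    if f: "continuous_map (complex_topology K) euclideanreal f"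
      and supp: "compactly_supported (complex_topology K) f" for f l d
  proof -
    have fm: "f \<in> borel_measurable (borel_complex K)"
      using f by (rule continuous_map_measurable_borel_complex)
    have fc: "continuous_on (geom_simplex s) f" if "s \<in> K" for s
      using f that by (simp add: continuous_map_complex_topology_iff)
    obtain K0 where K0: "finite K0" "K0 \<subseteq> K" "\<And>s x. s \<in> K \<Longrightarrow> x \<in> geom_simplex s \<Longrightarrow> f x \<noteq> 0 \<Longrightarrow> s \<in> K0"
      using compactly_supported_finite[OF assms(2) supp] by blast
    \<comment> \<open>\<open>K0\<close> need not be closed under faces, so its closure is taken to
      obtain a finite complex.\<close>
    define L where "L = (\<Union>s\<in>K0. faces s)"
    have finite_K: "finite s" "s \<noteq> {}" if "s \<in> K" for s
      using that K by (auto simp: abstract_complex_def)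
    have L: "finite L" "L \<subseteq> K" "K0 \<subseteq> L" "abstract_complex L"
    proof -
      have "faces s \<subseteq> Pow s" for s :: "'a set"
        by (auto simp: faces_def)
      then have "finite (faces s)" if "s \<in> K0" for s
        using that K0(2) finite_K finite_subset finite_Pow_iff by (metis subsetD)
      then show "finite L"
        using K0(1) by (simp add: L_def)
      show "L \<subseteq> K"
        using K K0(2) unfolding L_def faces_def abstract_complex_def by blast
      show "K0 \<subseteq> L"
        using K0(2) finite_K(2) by (auto simp: L_def faces_def)
      show "abstract_complex L"
        unfolding abstract_complex_def
      proof (intro ballI conjI allI impI)
        fix s assume s: "s \<in> L"
        then show "finite s" "s \<noteq> {}"
          using \<open>L \<subseteq> K\<close> finite_K by blast+
        fix t assume "t \<subseteq> s \<and> t \<noteq> {}"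
        then show "t \<in> L"
          using s unfolding L_def faces_def by blast
      qed
    qed
    have dimL: "\<forall>s\<in>L. card s \<le> n + 1"
      using dim L(2) by blast
    have Sd_sub: "Sd d L \<subseteq> Sd d K" for d
      by (rule Sd_mono[OF L(2)])
    \<comment> \<open>If \<open>f\<close> is nonzero at the barycenter of a face of
      \<open>\<tau>\<close>, every simplex of \<open>K\<close> that carries \<open>\<tau>\<close>
      and contains this point lies in \<open>K0\<close>. Hence such a \<open>\<sigma>\<close> has
      the same cofaces in the subdivisions of \<open>K\<close> and of \<open>L\<close>.\<close>
    have Sd_supp: "\<tau> \<in> Sd d L" if \<tau>: "\<tau> \<in> Sd d K" "\<sigma> \<subseteq> \<tau>" "\<sigma> \<noteq> {}" "f (barycenter \<sigma>) \<noteq> 0" for \<sigma> \<tau> d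
    proof -
      obtain s where s: "s \<in> K" "\<tau> \<in> Sd d (faces s)" "barycenter \<sigma> \<in> geom_simplex s"
        using barycenter_Sd_in_geom_simplex[OF K \<tau>(1)] \<tau>(2,3) by blast
      then have "s \<in> K0"
        using K0(3) \<tau>(4) by blast
      then have "faces s \<subseteq> L"
        by (auto simp: L_def)
      then show ?thesis
        using Sd_mono s(2) by blast
    qed
    have ne: "\<sigma> \<noteq> {}" "\<sigma> \<in> Sd d K" if "\<sigma> \<in> simplices (Sd d K) p" for \<sigma> d
      using that by (auto simp: simplices_def)
    have bary: "barycenter \<sigma> \<in> space (borel_complex K)" if "\<sigma> \<in> simplices (Sd d K) p" for \<sigma> d
      using barycenter_Sd_in_geom_simplex[OF K ne(2)[OF that]] ne(1)[OF that] by (auto simp: realization_def)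
    let ?J = "\<lambda>d. simplices (Sd d L) p"
    have J: "finite (?J d)" "?J d \<subseteq> simplices (Sd d K) p" for d
      using finite_Sd[OF L(1), of d] Sd_sub[of d] by (auto simp: simplices_def)
    have \<nu>: "integrable (?\<nu> d l \<sigma>) f" "integral\<^sup>L (?\<nu> d l \<sigma>) f = ?w d \<sigma> l * f (barycenter \<sigma>)"
      if \<sigma>: "\<sigma> \<in> simplices (Sd d K) p" for d \<sigma>
    proof -
      have "0 \<le> ?w d \<sigma> l"
        using w[OF \<sigma>] by simp
      then show "integrable (?\<nu> d l \<sigma>) f" "integral\<^sup>L (?\<nu> d l \<sigma>) f = ?w d \<sigma> l * f (barycenter \<sigma>)"
        using integral_scale_measure[OF integrable_return[OF fm bary[OF \<sigma>]]] integral_return[OF bary[OF \<sigma>] fm]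
        by (simp_all add: poly_times_measure_def)
    qed
    have null: "(\<integral>\<^sup>+ x. ennreal \<bar>f x\<bar> \<partial>?\<nu> d l \<sigma>) = 0" if \<sigma>: "\<sigma> \<in> simplices (Sd d K) p - ?J d" for d \<sigma>
    proof -
      have \<sigma>K: "\<sigma> \<in> simplices (Sd d K) p" "\<sigma> \<notin> Sd d L"
        using \<sigma> by (auto simp: simplices_def)
      then have "f (barycenter \<sigma>) = 0"
        using Sd_supp[OF ne(2)[OF \<sigma>K(1)] subset_refl ne(1)[OF \<sigma>K(1)]] by blast
      moreover have "(\<lambda>x. ennreal \<bar>f x\<bar>) \<in> borel_measurable (borel_complex K)"
        using fm by measurable
      ultimately show ?thesis
        using bary[OF \<sigma>K(1)]
        by (simp add: poly_times_measure_def nn_integral_scale_measure nn_integral_return)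
    qed
    have sum_meas: "integrable (sum_measure (borel_complex K) (simplices (Sd d K) p) (\<lambda>\<sigma>. ?\<nu> d l \<sigma>)) f"
      "integral\<^sup>L (sum_measure (borel_complex K) (simplices (Sd d K) p) (\<lambda>\<sigma>. ?\<nu> d l \<sigma>)) f
        = (\<Sum>\<sigma>\<in>?J d. integral\<^sup>L (?\<nu> d l \<sigma>) f)" for d
      using \<nu>(1) J(2) by (intro integral_sum_measure[OF \<nu>_sets fm J _ null]; blast)+
    have "integrable (link_measure n d p K l) f"
      and int: "integral\<^sup>L (link_measure n d p K l) f
        = 1 / fact (n + 1) ^ d * (\<Sum>\<sigma>\<in>?J d. integral\<^sup>L (?\<nu> d l \<sigma>) f)" for d
      unfolding link_measure_def weighted_gamma_def
      using integral_scale_measure[OF sum_meas(1)[of d], where r = "1 / fact (n + 1) ^ d"] sum_meas(2)[of d]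
      by simp_all
    then show "integrable (link_measure n d p K l) f"
      by blast
    have link_int: "integral\<^sup>L (link_measure n d p K l) f
        = (\<Sum>\<sigma>\<in>simplices (Sd d L) p. real (card {\<tau> \<in> simplices (Sd d L) (p + l + 1). \<sigma> \<subseteq> \<tau>}) * f (barycenter \<sigma>)) / fact (n + 1) ^ d" for d
    proof -
      have "integral\<^sup>L (?\<nu> d l \<sigma>) f = real (card {\<tau> \<in> simplices (Sd d L) (p + l + 1). \<sigma> \<subseteq> \<tau>}) * f (barycenter \<sigma>)"
        if "\<sigma> \<in> ?J d" for \<sigma>
      \<comment> \<open>At the boundary of \<open>L\<close> a simplex may have more cofaces in the
        subdivision of \<open>K\<close>, but there the count is multiplied by
        \<open>0\<close>.\<close>
      proof (cases "f (barycenter \<sigma>) = 0")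
        case True
        then show ?thesis
          using \<nu>(2)[OF subsetD[OF J(2) that]] by simp
      next
        case False
        have \<sigma>: "\<sigma> \<in> simplices (Sd d K) p"
          using that J(2) by blast
        have "{\<tau> \<in> simplices (Sd d K) (p + l + 1). \<sigma> \<subseteq> \<tau>} = {\<tau> \<in> simplices (Sd d L) (p + l + 1). \<sigma> \<subseteq> \<tau>}"
          using Sd_supp[OF _ _ ne(1)[OF \<sigma>] False] Sd_sub by (auto simp: simplices_def)
        then show ?thesis
          using \<nu>(2)[OF \<sigma>] w[OF \<sigma>] by simp
      qed
      then show ?thesis
        unfolding int by simp
    qed
    have vol: "integrable (vol_complex n K) f"
      "integral\<^sup>L (vol_complex n K) f = (\<Sum>\<rho>\<in>simplices (Sd 0 L) n. simplex_mean n f \<rho>)"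
      using integral_vol_complex[OF K f L(1,2)] K0(3) L(3) by blast+
    have q_nonneg: "0 \<le> coeff ?q l"
      unfolding q using face_limit_nonneg[of "p + l + 1" n] assms(4) by simp
    show "integrable (poly_times_measure ?q (vol_complex n K) l) f"
      unfolding poly_times_measure_def by (rule integral_scale_measure(1)[OF vol(1) q_nonneg])
    have N: "integral\<^sup>L (poly_times_measure ?q (vol_complex n K) l) f
        = coeff ?q l * (\<Sum>\<rho>\<in>simplices (Sd 0 L) n. simplex_mean n f \<rho>)"
      unfolding poly_times_measure_def vol(2)[symmetric] by (rule integral_scale_measure(2)[OF vol(1) q_nonneg])
    show "(\<lambda>d. integral\<^sup>L (link_measure n d p K l) f) \<longlonglongrightarrow> integral\<^sup>L (poly_times_measure ?q (vol_complex n K) l) f"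
    proof (cases "l \<le> n - p - 1")
      case True
      have "p + l + 1 \<le> n"
        using True assms(4) by simp
      from coface_sum_limit[OF L(4,1) dimL this, of f p] fc L(2)
      show ?thesis
        unfolding N q link_int using True by auto
    next
      case False
      \<comment> \<open>Beyond the degree bound \<open>p + l + 1\<close> exceeds \<open>n\<close>,
        so both sides vanish.\<close>
      have "simplices (Sd d L) (p + l + 1) = {}" for d
        using Sd_sub by (intro simplices_empty[where n = n] card_Sd[of _ d]) (use False in auto)
      then show ?thesis
        unfolding N q link_int using False by simp
    qed
  qed
  show ?thesis
    unfolding poly_weakly_converges_def using deg_M deg_N main by blast
qed

end
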